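(* Let $p$ be a prime, $\rho_1,\rho_2\in(0,1)$ with $\rho_1\neq\rho_2$, $c\in\mathbb{R}$, $M=\begin{bmatrix}\rho_1^{-1} & c\\ 0 & \rho_2^{-1}\end{bmatrix}$, and let $D=\{d_0,d_1,\dots,d_{p-1}\}\subset\mathbb{Z}^2$ be a set of $p$ distinct vectors with $d_0=(0,0)^*$, $d_1=(d_{1,1},0)^*$, $d_{1,1}\neq0$, such that $\mathcal{Z}(\widehat{\delta}_D)=\bigcup_{j=1}^{p-1}\left(\frac{j\bm{a}}{p}+\mathbb{Z}^2\right)$ for some $\bm{a}=(a_1,a_2)^*\in\mathcal{E}_p$. Let $\mu_{M,D}$ be the associated self-affine measure, put $c''=\frac{c}{\rho_1^{-1}-\rho_2^{-1}}$, and let $E_{\bm{a}}=\left\{\frac{h}{l}: la_2-ha_1\in\mathbb{Z}\setminus p\mathbb{Z},\ \gcd(h,l)=1\right\}\cup\{0\}$. Suppose $c''\in\mathbb{Q}\setminus E_{\bm{a}}$. Then $\mu_{M,D}$ is a spectral measure if and only if $\rho_1^{-1}\in p\mathbb{Z}$.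
   Context: In the definition of $E_{\bm a}$, $h,l$ are integers with $l\neq0$. $v^*$ denotes the (conjugate) transpose, so $(i_1,i_2)^*$ is a column vector. $\mathcal{E}_p=\{(i_1,i_2)^*: i_1,i_2\in\{1,\dots,p-1\}\}$. For a finite set $E\subset\mathbb{R}^2$, $\delta_E=\frac{1}{\#E}\sum_{e\in E}\delta_e$, where $\delta_e$ is the Dirac measure at $e$. For a compactly supported Borel probability measure $\mu$ on $\mathbb{R}^2$, $\widehat{\mu}(\xi)=\int e^{-2\pi i\langle\xi,x\rangle}\,d\mu(x)$, $\xi\in\mathbb{R}^2$; $\mathcal{Z}(f)$ is the set of zeros of $f$ in $\mathbb{R}^2$. The self-affine measure $\mu_{M,D}$ is the unique Borel probability measure satisfying $\mu=\frac{1}{\#D}\sum_{d\in D}\mu\circ\varphi_d^{-1}$ with $\varphi_d(x)=M^{-1}(x+d)$. A compactly supported Borel probability measure $\mu$ is a spectral measure if there is a countable $\Lambda\subset\mathbb{R}^2$ (a spectrum of $\mu$) such that $\{e^{-2\pi i\langle\lambda,x\rangle}:\lambda\in\Lambda\}$ is an orthonormal basis of $L^2(\mu)$. *)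

theory Defs
  imports "HOL-Probability.Probability"
begin

definition expo :: "real^'n \<Rightarrow> real^'n \<Rightarrow> complex" where
  "expo \<xi> x = exp (- (2 * of_real pi * \<i> * of_real (\<xi> \<bullet> x)))"

definition fourier :: "(real^'n) measure \<Rightarrow> real^'n \<Rightarrow> complex" where
  "fourier \<mu> \<xi> = (LINT x|\<mu>. expo \<xi> x)"

definition zero_set :: "(real^'n \<Rightarrow> complex) \<Rightarrow> (real^'n) set" where
  "zero_set f = {\<xi>. f \<xi> = 0}"

text \<open>The average of the Dirac measures at the points of a finite nonempty set,
  transported to the Borel sigma-algebra.\<close>

definition delta_set :: "(real^'n) set \<Rightarrow> (real^'n) measure" where
  "delta_set E = distr (uniform_count_measure E) borel (\<lambda>x. x)"

definition int_lattice :: "(real^'n) set" where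
  "int_lattice = {x. \<forall>i. x $ i \<in> \<int>}"

definition int_multiples :: "nat \<Rightarrow> real set" where
  "int_multiples p = (\<lambda>x. real p * x) ` \<int>"

definition digit_vectors :: "nat \<Rightarrow> (real^2) set" where
  "digit_vectors p = {vector [real i, real j] | i j. i \<in> {1..p - 1} \<and> j \<in> {1..p - 1}}"

definition excl_set :: "nat \<Rightarrow> real^2 \<Rightarrow> real set" where
  "excl_set p a =
     {of_int h / of_int l | h l :: int. l \<noteq> 0 \<and>
        of_int l * a $ 2 - of_int h * a $ 1 \<in> \<int> - int_multiples p \<and> gcd h l = 1} \<union> {0}"

definition borel_prob :: "(real^'n) measure \<Rightarrow> bool" where
  "borel_prob \<mu> \<longleftrightarrow> prob_space \<mu> \<and> sets \<mu> = sets borel"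

definition compactly_supported :: "(real^'n) measure \<Rightarrow> bool" where
  "compactly_supported \<mu> \<longleftrightarrow> (\<exists>K. compact K \<and> emeasure \<mu> (- K) = 0)"

definition affine_contr :: "real^'n^'n \<Rightarrow> real^'n \<Rightarrow> real^'n \<Rightarrow> real^'n" where
  "affine_contr M d x = matrix_inv M *v (x + d)"

text \<open>For an expanding \<open>M\<close> and a finite nonempty \<open>D\<close> exactly one measure has this
  property (Hutchinson), namely the self-affine measure of the pair.\<close>

definition self_affine_measure ::
    "real^'n^'n \<Rightarrow> (real^'n) set \<Rightarrow> (real^'n) measure \<Rightarrow> bool" where
  "self_affine_measure M D \<mu> \<longleftrightarrow> borel_prob \<mu> \<and>
     (\<forall>A\<in>sets borel. measure \<mu> A =
        1 / real (card D) * (\<Sum>d\<in>D. measure (distr \<mu> borel (affine_contr M d)) A))"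

definition square_integrable :: "'a measure \<Rightarrow> ('a \<Rightarrow> complex) \<Rightarrow> bool" where
  "square_integrable \<mu> f \<longleftrightarrow>
     f \<in> borel_measurable \<mu> \<and> integrable \<mu> (\<lambda>x. (cmod (f x))\<^sup>2)"

text \<open>An orthonormal basis of the Hilbert space \<open>L\<^sup>2(\<mu>)\<close> of complex functions, as an
  indexed family: orthonormal with dense linear span. In particular functions with different
  indices are different elements of \<open>L\<^sup>2(\<mu>)\<close>.\<close>

definition L2_orthonormal_basis ::
    "'a measure \<Rightarrow> 'i set \<Rightarrow> ('i \<Rightarrow> 'a \<Rightarrow> complex) \<Rightarrow> bool" where
  "L2_orthonormal_basis \<mu> I e \<longleftrightarrow>
     (\<forall>i\<in>I. square_integrable \<mu> (e i)) \<and>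
     (\<forall>i\<in>I. \<forall>j\<in>I. (LINT x|\<mu>. e i x * cnj (e j x)) = (if i = j then 1 else 0)) \<and>
     (\<forall>f. square_integrable \<mu> f \<longrightarrow> (\<forall>\<epsilon>>0. \<exists>F b. finite F \<and> F \<subseteq> I \<and>
        (LINT x|\<mu>. (cmod (f x - (\<Sum>i\<in>F. b i * e i x)))\<^sup>2) < \<epsilon>))"

definition is_spectrum :: "(real^'n) measure \<Rightarrow> (real^'n) set \<Rightarrow> bool" where
  "is_spectrum \<mu> \<Lambda> \<longleftrightarrow> countable \<Lambda> \<and> L2_orthonormal_basis \<mu> \<Lambda> expo"

definition spectral_measure :: "(real^'n) measure \<Rightarrow> bool" where
  "spectral_measure \<mu> \<longleftrightarrow>
     borel_prob \<mu> \<and> compactly_supported \<mu> \<and> (\<exists>\<Lambda>. is_spectrum \<mu> \<Lambda>)"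

end

theory Submission
  imports Defs "HOL-Computational_Algebra.Polynomial_Factorial"
begin

text \<open>
  Put \<open>r = 1 / \<rho>1\<close>, let \<open>N\<close> be the inverse transpose of \<open>M\<close>, and let \<open>m\<close> be the mask polynomial of
  \<open>D\<close> (\<open>digit_mask\<close>), the Fourier transform of the uniform measure on \<open>D\<close>. Self-affinity
  says \<open>\<mu>^(\<xi>) = m(N \<xi>) * \<mu>^(N \<xi>)\<close>, so that \<open>\<mu>^(\<xi>) = 0\<close> exactly when \<open>m(N^k \<xi>) = 0\<close> for some level
  \<open>k \<ge> 1\<close>. Since \<open>N\<close> multiplies first coordinates by \<open>\<rho>1\<close> and the zeros of \<open>m\<close> have first
  coordinates in \<open>(\<int> - p\<int>) / p\<close>, two points of a spectrum differ in their first coordinate by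
  \<open>r^k w / p\<close> with \<open>p\<close> not dividing the integer \<open>w\<close>. A set of frequencies is a spectrum iff it is
  orthogonal and satisfies Parseval's identity for all exponentials.

  Necessity uses only first coordinates. If some level \<open>k\<close> could be avoided, the factor at level
  \<open>k\<close> could be dropped from the product for \<open>\<mu>^\<close> without losing Bessel's inequality, and Parseval's
  identity would fail; hence every level is attained (\<open>pair_at_single_level\<close>). If \<open>r\<close> satisfied an
  integer polynomial relation whose extreme coefficients are prime to \<open>p\<close>, the pigeonhole
  principle modulo \<open>p\<close> would make the set of first coordinates finite (\<open>finite_if_unit_relation\<close>).
  Applied to the relations between the three differences of a triple, this makes the level an
  ultrametric and, as the levels 1 and 2 are attained, forces \<open>r = s / t\<close> in lowest terms
  with \<open>p\<close> dividing \<open>s\<close> (\<open>ratio_rational\<close>); moreover differences at level \<open>k\<close> are then multiples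
  of \<open>r s^(k-1) / p\<close>. If \<open>t > 1\<close> the spectrum is therefore too sparse: \<open>\<mu>^\<close> decays at a logarithmic
  rate along first coordinates (\<open>log_decay\<close>), because the orbit \<open>y (t/s)^j\<close> cannot stay close to
  integers for long. Exhausting the spectrum by the windows of radius \<open>s^n\<close>, the defect in Parseval's
  identity loses at each step at most a factor \<open>1 - \<beta>\<close>, with \<open>\<beta>\<close> summable along a suitable
  sequence of windows, and so it stays positive (\<open>not_spectrum_if_fractional_ratio\<close>).
  Hence \<open>t = 1\<close>.

  For sufficiency write \<open>c'' = h / l\<close> in lowest terms. The exclusion of \<open>E\<close> means \<open>p\<close> divides
  \<open>l a2 - h a1\<close>, and then the line spanned by \<open>e = (l, h)\<close>, an eigenline of \<open>N\<close>, meets the zeros of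
  \<open>m\<close> in exactly the multiples \<open>x e\<close> with \<open>p x\<close> an integer prime to \<open>p\<close>. When \<open>r = p b\<close>, the
  integers \<open>b (e0 + e1 (-r) + ... + e(n-1) (-r)^(n-1))\<close> with digits \<open>0 \<le> ei < p\<close> give orthogonal
  exponentials which satisfy Parseval's identity exactly at the \<open>n\<close>-th stage. The negative base keeps
  the rescaled frequencies in \<open>[-r/(r+1), r/(r+1)]\<close>, where \<open>\<mu>^\<close> has no zero, so the identity
  survives the limit (\<open>parseval_on_line\<close>). Since exponentials span a dense subspace of
  \<open>L2(\<mu>)\<close> (\<open>all_approximable\<close>), this line of frequencies is a spectrum.
\<close>

section \<open>Polynomial relations with p-adic unit coefficients\<close>

definition int_eval :: "int poly \<Rightarrow> real \<Rightarrow> real" where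
  "int_eval f r = poly (map_poly of_int f) r"

lemma int_eval_0 [simp]: "int_eval 0 r = 0"
  by (simp add: int_eval_def)

lemma int_eval_add [simp]: "int_eval (f + g) r = int_eval f r + int_eval g r"
proof -
  have "map_poly real_of_int (f + g) = map_poly of_int f + map_poly of_int g"
    by (intro poly_eqI) (simp add: coeff_map_poly)
  then show ?thesis by (simp add: int_eval_def)
qed

lemma int_eval_diff [simp]: "int_eval (f - g) r = int_eval f r - int_eval g r"
proof -
  have "map_poly real_of_int (f - g) = map_poly of_int f - map_poly of_int g"
    by (intro poly_eqI) (simp add: coeff_map_poly)
  then show ?thesis by (simp add: int_eval_def)
qed

lemma int_eval_mult [simp]: "int_eval (f * g) r = int_eval f r * int_eval g r"
proof -
  have "map_poly real_of_int (f * g) = map_poly of_int f * map_poly of_int g"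
    by (intro poly_eqI) (simp add: coeff_map_poly coeff_mult)
  then show ?thesis by (simp add: int_eval_def)
qed

lemma int_eval_smult [simp]: "int_eval (smult a f) r = of_int a * int_eval f r"
proof -
  have "map_poly real_of_int (smult a f) = smult (of_int a) (map_poly of_int f)"
    by (intro poly_eqI) (simp add: coeff_map_poly)
  then show ?thesis by (simp add: int_eval_def)
qed

lemma int_eval_monom [simp]: "int_eval (monom a n) r = of_int a * r ^ n"
  by (simp add: int_eval_def map_poly_monom poly_monom)

lemma int_eval_const [simp]: "int_eval [:a:] r = of_int a"
  by (simp add: int_eval_def map_poly_pCons)

text \<open>
  By Gauss's lemma a primitive integer polynomial of least degree vanishing at \<open>r\<close> divides, over
  the integers, every integer polynomial vanishing at \<open>r\<close>: pseudo-division only shows this up to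
  an integer factor, which the primitive divisor can be freed of.
\<close>

lemma exists_primitive_minimal_polynomial:
  fixes r :: real and f :: "int poly"
  assumes "f \<noteq> 0" "int_eval f r = 0"
  obtains m where "m \<noteq> 0" "degree m \<ge> 1" "int_eval m r = 0"
    "\<And>g. int_eval g r = 0 \<Longrightarrow> m dvd g"
proof -
  define P where "P g \<longleftrightarrow> g \<noteq> 0 \<and> int_eval g r = 0" for g :: "int poly"
  have "P f" using assms by (simp add: P_def)
  define m0 where "m0 = (ARG_MIN degree g. P g)"
  have Pm0: "P m0" unfolding m0_def using \<open>P f\<close> by (rule arg_min_natI)
  have min: "degree m0 \<le> degree g" if "P g" for g
    unfolding m0_def using that by (rule arg_min_nat_le)
  define m where "m = primitive_part m0"
  have m0: "m0 = smult (content m0) m" by (simp add: m_def)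
  have c0: "content m0 \<noteq> 0" using Pm0 by (simp add: P_def)
  have "of_int (content m0) * int_eval m r = 0"
    using Pm0 m0 int_eval_smult by (metis P_def)
  then have ev: "int_eval m r = 0" using c0 by simp
  have m_ne: "m \<noteq> 0" using Pm0 by (simp add: m_def P_def)
  have cm: "content m = 1" using Pm0 by (simp add: m_def P_def)
  have degm: "degree m = degree m0" using m0 c0 degree_smult_eq by metis
  have "degree m \<ge> 1"
  proof (rule ccontr)
    assume "\<not> degree m \<ge> 1"
    then obtain c where c: "m = [:c:]" by (metis degree_eq_zeroE less_one not_le)
    then show False using ev m_ne by simp
  qed
  moreover have "m dvd g" if g: "int_eval g r = 0" for g
  proof -
    obtain a q where aq: "a \<noteq> 0" "smult a g = m * q + pseudo_mod g m"
      using pseudo_mod(1)[OF m_ne] by blast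
    have "pseudo_mod g m = smult a g - m * q" using aq by simp
    then have "int_eval (pseudo_mod g m) r = 0" using g ev by simp
    then have "pseudo_mod g m = 0"
      using pseudo_mod(2)[OF m_ne, of g] min[of "pseudo_mod g m"] degm by (force simp: P_def)
    then have aq': "smult a g = m * q" using aq by simp
    \<comment> \<open>As \<open>m\<close> is primitive, the integer factor \<open>a\<close> divides all coefficients of \<open>q\<close>.\<close>
    have "normalize a * content g = content q"
      using arg_cong[OF aq', of content] by (simp add: content_mult cm)
    then have "a dvd content q" by (metis dvd_triv_left normalize_dvd_iff)
    then have "[:a:] dvd q" by (metis const_poly_dvd_iff_dvd_content)
    then obtain q' where "q = smult a q'" by (auto simp: dvd_def)
    then have "smult a g = smult a (m * q')" using aq' by simp
    then have "g = m * q'" using aq(1) by (simp only: smult_cancel)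
    then show ?thesis by simp
  qed
  ultimately show ?thesis using that m_ne ev by blast
qed

text \<open>
  The leading coefficient of \<open>f\<close> is invertible modulo \<open>p\<close>, so division with remainder by \<open>f\<close> works
  modulo \<open>p\<close>. As the remainders have bounded degree and coefficients below \<open>p\<close>, the
  ring of integer polynomials modulo \<open>p\<close> and \<open>f\<close> is finite.
\<close>

lemma finite_residues_mod_poly:
  fixes P f :: "int poly" and p :: int
  assumes p: "prime p" and lc: "\<not> p dvd lead_coeff f" and deg: "degree f \<ge> 1"
  shows "\<exists>g h R. P = smult p g + f * h + R \<and> degree R < degree f \<and> (\<forall>i. coeff R i \<in> {0..<p})"
proof -
  define n where "n = degree f"
  have "coprime (lead_coeff f) p"
    using p lc by (metis coprime_commute prime_imp_coprime)
  then obtain c e' where "c * lead_coeff f + e' * p = 1"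
    using bezout_int[of "lead_coeff f" p] by (auto simp: coprime_iff_gcd_eq_1)
  then have e: "lead_coeff f * c = 1 + p * (- e')" by (simp add: algebra_simps)
  define e where "e = - e'"
  note e = e[folded e_def]
  have 1: "\<exists>g h R. P = smult p g + f * h + R \<and> degree R < n"
  proof (induction "degree P" arbitrary: P rule: less_induct)
    case less
    show ?case
    proof (cases "degree P < n")
      case True
      then have "P = smult p 0 + f * 0 + P \<and> degree P < n" by simp
      then show ?thesis by blast
    next
      case False
      define d where "d = degree P"
      have d: "d \<ge> n" "n \<ge> 1" using False deg by (auto simp: d_def n_def)
      define P' where "P' = P - f * monom (c * lead_coeff P) (d - n) + smult p (monom (e * lead_coeff P) d)"
      have "degree (f * monom (c * lead_coeff P) (d - n)) \<le> n + (d - n)"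
        by (rule order.trans[OF degree_mult_le]) (simp add: n_def degree_monom_le)
      then have l1: "degree (f * monom (c * lead_coeff P) (d - n)) \<le> d" using d by simp
      have l2: "degree (smult p (monom (e * lead_coeff P) d)) \<le> d"
        by (meson degree_monom_le degree_smult_le order.trans)
      have le: "degree P' \<le> d" unfolding P'_def
        using l1 l2 by (intro degree_add_le degree_diff_le) (auto simp: d_def)
      have "coeff (f * monom (c * lead_coeff P) (d - n)) d = lead_coeff f * (c * lead_coeff P)"
        using coeff_monom_mult[of "c * lead_coeff P" "d - n" f d] d by (simp add: n_def mult_ac)
      then have "coeff P' d = lead_coeff P - (lead_coeff f * c) * lead_coeff P + p * e * lead_coeff P"
        by (simp add: P'_def d_def)
      also have "\<dots> = lead_coeff P * (1 + p * e - lead_coeff f * c)" by (simp add: algebra_simps)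
      also have "\<dots> = 0" by (simp add: e)
      finally have c0: "coeff P' d = 0" .
      have "degree P' < d"
      proof (cases "P' = 0")
        case True then show ?thesis using d by simp
      next
        case False
        then have "degree P' \<noteq> d" using c0 by auto
        then show ?thesis using le by simp
      qed
      then obtain g h R where ghR: "P' = smult p g + f * h + R" "degree R < n"
        using less by (metis d_def)
      have "P = smult p (g - monom (e * lead_coeff P) d) + f * (h + monom (c * lead_coeff P) (d - n)) + R"
        using ghR(1) unfolding P'_def by (simp add: algebra_simps smult_diff_right)
      then show ?thesis using ghR(2) by blast
    qed
  qed
  then obtain g h R where R: "P = smult p g + f * h + R" "degree R < n" by blast
  define R' where "R' = map_poly (\<lambda>x. x mod p) R"
  have "R = smult p (map_poly (\<lambda>x. x div p) R) + R'"
    by (intro poly_eqI) (simp add: R'_def coeff_map_poly)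
  then have "P = smult p (g + map_poly (\<lambda>x. x div p) R) + f * h + R'"
    using R(1) by (simp add: algebra_simps smult_add_right)
  moreover have "degree R' < degree f"
    using R(2) map_poly_degree_leq[of "\<lambda>x. x mod p" R] by (simp add: R'_def n_def)
  moreover have "\<forall>i. coeff R' i \<in> {0..<p}"
    using prime_gt_0_int[OF p] by (simp add: R'_def coeff_map_poly)
  ultimately show ?thesis by blast
qed

text \<open>
  Modulo \<open>p\<close> the polynomial \<open>G\<close> is a monomial, whose divisors are monomials; but \<open>m\<close> modulo \<open>p\<close> has
  two different terms, its constant and its leading one. The proof compares the lowest and the
  highest coefficient of the cofactor which survive modulo \<open>p\<close>.
\<close>

lemma not_dvd_power_mod_prime:
  fixes m q G :: "int poly" and p :: int
  assumes p: "prime p" and lc: "\<not> p dvd lead_coeff m" and c0: "\<not> p dvd coeff m 0"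
    and deg: "degree m \<ge> 1"
    and k: "\<not> p dvd coeff G k" and others: "\<And>i. i \<noteq> k \<Longrightarrow> p dvd coeff G i"
  shows "\<not> m dvd G"
proof
  assume "m dvd G"
  then obtain q where q: "G = m * q" by blast
  define I where "I = {i. \<not> p dvd coeff q i}"
  have "I \<noteq> {}"
  proof
    assume "I = {}"
    then have "p dvd coeff G k" by (auto simp: q I_def coeff_mult intro!: dvd_sum)
    then show False using k by simp
  qed
  have "I \<subseteq> {..degree q}"
    by (auto simp: I_def) (metis coeff_eq_0 dvd_0_right not_le)
  then have fin: "finite I" by (rule finite_subset) simp
  define s where "s = Min I"
  define t where "t = Max I"
  have sI: "s \<in> I" and tI: "t \<in> I" using fin \<open>I \<noteq> {}\<close> by (auto simp: s_def t_def)
  have lows: "p dvd coeff q i" if "i < s" for i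
    using that fin Min_le[OF fin, of i] by (fastforce simp: s_def I_def)
  have highs: "p dvd coeff q i" if "i > t" for i
    using that fin Max_ge[OF fin, of i] by (fastforce simp: t_def I_def)
  have "coeff G s = coeff m 0 * coeff q s + (\<Sum>i\<in>{..s} - {0}. coeff m i * coeff q (s - i))"
    unfolding q coeff_mult by (subst sum.remove[of _ 0]) auto
  moreover have "p dvd (\<Sum>i\<in>{..s} - {0}. coeff m i * coeff q (s - i))"
    by (intro dvd_sum dvd_mult lows) auto
  moreover have "\<not> p dvd coeff m 0 * coeff q s"
    using sI c0 p by (simp add: I_def prime_dvd_mult_iff)
  ultimately have "\<not> p dvd coeff G s" by (metis dvd_add_left_iff)
  then have sk: "s = k" using others by blast
  define d where "d = degree m"
  have "coeff G (d + t) = coeff m d * coeff q t + (\<Sum>i\<in>{..d+t} - {d}. coeff m i * coeff q (d + t - i))"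
    unfolding q coeff_mult by (subst sum.remove[of _ d]) auto
  moreover have "p dvd (\<Sum>i\<in>{..d+t} - {d}. coeff m i * coeff q (d + t - i))"
  proof (rule dvd_sum)
    fix i assume i: "i \<in> {..d+t} - {d}"
    show "p dvd coeff m i * coeff q (d + t - i)"
    proof (cases "i > d")
      case True then show ?thesis by (simp add: d_def coeff_eq_0)
    next
      case False
      then show ?thesis using i by (intro dvd_mult highs) auto
    qed
  qed
  moreover have "\<not> p dvd coeff m d * coeff q t"
    using tI lc p by (simp add: I_def d_def prime_dvd_mult_iff)
  ultimately have "\<not> p dvd coeff G (d + t)" by (metis dvd_add_left_iff)
  then have "d + t = k" using others by blast
  moreover have "s \<le> t" using sI fin by (simp add: t_def)
  ultimately show False using sk deg by (simp add: d_def)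
qed

text \<open>
  In an infinite set two points would agree in the finite ring of polynomials modulo \<open>p\<close> and \<open>f\<close>, so
  their difference \<open>r^k w\<close> would be \<open>p\<close> times a polynomial in \<open>r\<close>. The resulting relation
  \<open>w X^k - p g\<close> is a monomial modulo \<open>p\<close>, and the minimal polynomial of \<open>r\<close> cannot divide both it and
  \<open>f\<close>. In other words: under the hypothesis on \<open>f\<close>, \<open>r\<close> is a unit at all places above \<open>p\<close>, and the
  points have distinct residues at such a place.
\<close>

lemma finite_if_unit_relation:
  fixes r :: real and f :: "int poly" and p :: int and X :: "real set"
  assumes p: "prime p" and lc: "\<not> p dvd lead_coeff f" and c0: "\<not> p dvd coeff f 0"
    and deg: "degree f \<ge> 1" and root: "int_eval f r = 0"
    and X: "\<And>x y. x \<in> X \<Longrightarrow> y \<in> X \<Longrightarrow> x \<noteq> y \<Longrightarrow>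
              \<exists>k w. \<not> p dvd w \<and> x - y = r ^ k * of_int w"
  shows "finite X"
proof (rule ccontr)
  assume inf: "infinite X"
  then obtain x0 where x0: "x0 \<in> X" by fastforce
  have "\<exists>P. x - x0 = int_eval P r" if xX: "x \<in> X" for x
  proof (cases "x = x0")
    case True then show ?thesis by (intro exI[of _ 0]) simp
  next
    case False
    then obtain k w where "x - x0 = r ^ k * of_int w" using X[OF xX x0 False] by blast
    then show ?thesis by (intro exI[of _ "monom w k"]) simp
  qed
  then obtain P where P: "x - x0 = int_eval (P x) r" if "x \<in> X" for x by metis
  obtain g h R where R: "P x = smult p (g x) + f * h x + R x" "degree (R x) < degree f"
    "coeff (R x) i \<in> {0..<p}" for x i
  proof -
    have "\<forall>x. \<exists>g h R. P x = smult p g + f * h + R \<and> degree R < degree f \<and> (\<forall>i. coeff R i \<in> {0..<p})"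
      using finite_residues_mod_poly[OF p lc deg] by blast
    from choice[OF this] obtain g where "\<forall>x. \<exists>h R. P x = smult p (g x) + f * h + R \<and>
      degree R < degree f \<and> (\<forall>i. coeff R i \<in> {0..<p})" ..
    from choice[OF this] obtain h where "\<forall>x. \<exists>R. P x = smult p (g x) + f * h x + R \<and>
      degree R < degree f \<and> (\<forall>i. coeff R i \<in> {0..<p})" ..
    from choice[OF this] obtain R where "\<forall>x. P x = smult p (g x) + f * h x + R x \<and>
      degree (R x) < degree f \<and> (\<forall>i. coeff (R x) i \<in> {0..<p})" ..
    then show ?thesis using that by blast
  qed
  define code where "code x = map (coeff (R x)) [0..<degree f]" for x
  have "code ` X \<subseteq> {xs. set xs \<subseteq> {0..<p} \<and> length xs = degree f}"
    using R(3) by (auto simp: code_def)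
  moreover have "finite {xs. set xs \<subseteq> {0..<p} \<and> length xs = degree f}"
    by (rule finite_lists_length_eq) simp
  ultimately have "finite (code ` X)" by (rule finite_subset)
  then obtain x y where xy: "x \<in> X" "y \<in> X" "x \<noteq> y" "code x = code y"
    using inf by (metis finite_imageD inj_onI)
  have "R x = R y"
  proof (rule poly_eqI)
    fix i
    show "coeff (R x) i = coeff (R y) i"
    proof (cases "i < degree f")
      case True
      then have "code x ! i = coeff (R x) i" "code y ! i = coeff (R y) i"
        by (simp_all add: code_def)
      then show ?thesis using xy by simp
    next
      case False
      then show ?thesis using R(2)[of x] R(2)[of y] by (simp add: coeff_eq_0)
    qed
  qed
  then have diff: "x - y = of_int p * int_eval (g x - g y) r"
    using P[OF xy(1)] P[OF xy(2)] R(1)[of x] R(1)[of y] root by (simp add: algebra_simps)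
  obtain k w where kw: "\<not> p dvd w" "x - y = r ^ k * of_int w" using X xy by blast
  define G where "G = monom w k - smult p (g x - g y)"
  have "int_eval G r = 0" using diff kw by (simp add: G_def algebra_simps)
  have "f \<noteq> 0" using deg by auto
  obtain m where m: "m \<noteq> 0" "degree m \<ge> 1" "int_eval m r = 0"
    "\<And>g. int_eval g r = 0 \<Longrightarrow> m dvd g"
    using exists_primitive_minimal_polynomial[OF \<open>f \<noteq> 0\<close> root] by metis
  obtain f' where f': "f = m * f'" using m(4)[OF root] by blast
  have "\<not> p dvd lead_coeff m" "\<not> p dvd coeff m 0"
    using lc c0 by (auto simp: f' lead_coeff_mult coeff_mult_0)
  moreover have "\<not> p dvd coeff G k" 
    using kw(1) by (simp add: G_def) (metis diff_add_cancel dvd_add dvd_triv_left)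
  moreover have "p dvd coeff G i" if "i \<noteq> k" for i using that by (simp add: G_def)
  ultimately have "\<not> m dvd G" by (rule not_dvd_power_mod_prime[OF p _ _ m(2)])
  then show False using m(4) \<open>int_eval G r = 0\<close> by blast
qed

section \<open>Difference sets whose levels are all attained\<close>

text \<open>
  The first coordinates of a spectrum, scaled by \<open>p\<close>: every difference is \<open>r^k w\<close> with \<open>p\<close> not
  dividing \<open>w\<close>, and every exponent \<open>k\<close>, the level of the pair, occurs.
\<close>

locale level_set =
  fixes p :: int and r :: real and X :: "real set"
  assumes prime_p: "prime p" and r_gt_1: "1 < r"
    and level_exists: "\<And>x y. x \<in> X \<Longrightarrow> y \<in> X \<Longrightarrow> x \<noteq> y \<Longrightarrow>
          \<exists>k\<ge>1. \<exists>w. \<not> p dvd w \<and> x - y = r ^ k * of_int w"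
    and level_attained: "\<And>k. k \<ge> 1 \<Longrightarrow> \<exists>x\<in>X. \<exists>y\<in>X. x \<noteq> y \<and>
          (\<exists>w. \<not> p dvd w \<and> x - y = r ^ k * of_int w)"
    and infinite_X: "infinite X"
begin

definition has_level :: "real \<Rightarrow> real \<Rightarrow> nat \<Rightarrow> bool" where
  "has_level x y k \<longleftrightarrow> (\<exists>w. \<not> p dvd w \<and> x - y = r ^ k * of_int w)"

lemma has_level_sym: "has_level x y k \<longleftrightarrow> has_level y x k"
proof -
  have "has_level y x k" if h: "has_level x y k" for x y
  proof -
    obtain w where "\<not> p dvd w" "x - y = r ^ k * of_int w" using h by (auto simp: has_level_def)
    then have "\<not> p dvd - w" "y - x = r ^ k * of_int (- w)" by auto
    then show ?thesis unfolding has_level_def by blast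
  qed
  then show ?thesis by blast
qed

lemma ex_level:
  assumes "x \<in> X" "y \<in> X" "x \<noteq> y"
  shows "\<exists>k\<ge>1. has_level x y k"
  using level_exists[OF assms] by (auto simp: has_level_def)

lemma ex_pair_with_level:
  assumes "k \<ge> 1"
  shows "\<exists>x\<in>X. \<exists>y\<in>X. x \<noteq> y \<and> has_level x y k"
  using level_attained[OF assms] by (simp add: has_level_def)

lemma no_unit_relation:
  assumes "\<not> p dvd lead_coeff f" "\<not> p dvd coeff f 0" "degree f \<ge> 1"
  shows "int_eval f r \<noteq> 0"
proof
  assume "int_eval f r = 0"
  have "finite X"
  proof (rule finite_if_unit_relation[OF prime_p assms \<open>int_eval f r = 0\<close>])
    fix x y assume "x \<in> X" "y \<in> X" "x \<noteq> y"
    then show "\<exists>k w. \<not> p dvd w \<and> x - y = r ^ k * of_int w"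
      using level_exists by blast
  qed
  then show False using infinite_X by simp
qed

lemma no_binomial_relation:
  assumes "\<not> p dvd u" "\<not> p dvd v" "r ^ i * of_int u = r ^ j * of_int v"
  shows "i = j"
proof -
  have *: "\<not> i < j" if "\<not> p dvd u" "\<not> p dvd v" "r ^ i * of_int u = r ^ j * of_int v" for u v i j
  proof
    assume "i < j"
    define f where "f = monom v (j - i) + [:- u:]"
    have v0: "v \<noteq> 0" using that by auto
    have deg: "degree f = j - i"
      unfolding f_def using \<open>i < j\<close> v0 by (subst degree_add_eq_left) (auto simp: degree_monom_eq)
    have deg1: "degree f \<ge> 1" using deg \<open>i < j\<close> by linarith
    have "r ^ i * of_int u = r ^ i * (r ^ (j - i) * of_int v)"
      using that(3) \<open>i < j\<close> by (metis add_diff_inverse_nat less_imp_le_nat mult.assoc not_less power_add)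
    then have "int_eval f r = 0" using r_gt_1 by (simp add: f_def)
    moreover have "lead_coeff f = v"
      unfolding deg using \<open>i < j\<close> by (simp add: f_def coeff_pCons split: nat.splits)
    moreover have "coeff f 0 = - u" using \<open>i < j\<close> by (simp add: f_def)
    ultimately show False
      using no_unit_relation[of f] that deg1 by simp
  qed
  show ?thesis using *[OF assms] *[OF assms(2,1) assms(3)[symmetric]] by simp
qed

lemma no_ordered_trinomial_relation:
  assumes "\<not> p dvd a" "\<not> p dvd c" "i < j" "j < k"
  shows "r ^ i * of_int a + r ^ j * of_int b + r ^ k * of_int c \<noteq> 0"
proof
  assume eq: "r ^ i * of_int a + r ^ j * of_int b + r ^ k * of_int c = 0"
  define f where "f = monom c (k - i) + (monom b (j - i) + [:a:])"
  have c0: "c \<noteq> 0" using assms by auto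
  have lt: "degree (monom b (j - i) + [:a:]) < k - i"
    by (rule le_less_trans[OF degree_add_le[of _ "j - i"]])
       (use assms in \<open>auto simp: degree_monom_le\<close>)
  then have deg: "degree f = k - i"
    unfolding f_def using c0 by (subst degree_add_eq_left) (auto simp: degree_monom_eq)
  have deg1: "degree f \<ge> 1" using deg assms by linarith
  have lc: "lead_coeff f = c"
    unfolding deg using assms coeff_eq_0[OF lt] by (simp add: f_def)
  have "r ^ j = r ^ i * r ^ (j - i)" "r ^ k = r ^ i * r ^ (k - i)"
    using assms by (simp_all flip: power_add)
  then have "r ^ i * int_eval f r = 0"
    using eq by (simp add: f_def algebra_simps)
  then have "int_eval f r = 0" using r_gt_1 by simp
  moreover have "coeff f 0 = a" using assms by (simp add: f_def)
  ultimately show False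
    using no_unit_relation[of f] assms deg1 lc by simp
qed

lemma no_trinomial_relation:
  assumes "\<not> p dvd a" "\<not> p dvd b" "\<not> p dvd c" "i \<noteq> j" "j \<noteq> k" "i \<noteq> k"
  shows "r ^ i * of_int a + r ^ j * of_int b + r ^ k * of_int c \<noteq> 0"
proof -
  consider "i < j" "j < k" | "i < k" "k < j" | "j < i" "i < k" | "j < k" "k < i"
    | "k < i" "i < j" | "k < j" "j < i"
    using assms by linarith
  then show ?thesis
    using no_ordered_trinomial_relation[of a c i j k b] no_ordered_trinomial_relation[of a b i k j c]
      no_ordered_trinomial_relation[of b c j i k a] no_ordered_trinomial_relation[of b a j k i c]
      no_ordered_trinomial_relation[of c b k i j a] no_ordered_trinomial_relation[of c a k j i b] assms
    by cases (simp_all add: algebra_simps)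
qed

definition level :: "real \<Rightarrow> real \<Rightarrow> nat" where
  "level x y = (THE k. has_level x y k)"

lemma has_level_unique:
  assumes "has_level x y k" "has_level x y k'"
  shows "k = k'"
proof -
  obtain u v where "\<not> p dvd u" "x - y = r ^ k * of_int u" "\<not> p dvd v" "x - y = r ^ k' * of_int v"
    using assms unfolding has_level_def by blast
  then show ?thesis using no_binomial_relation[of u v k k'] by simp
qed

lemma level_eqI: "has_level x y k \<Longrightarrow> level x y = k"
  unfolding level_def using has_level_unique by blast

lemma level:
  assumes "x \<in> X" "y \<in> X" "x \<noteq> y"
  shows "has_level x y (level x y)" "level x y \<ge> 1"
  using ex_level[OF assms] level_eqI by auto

lemma level_witness:
  assumes "x \<in> X" "y \<in> X" "x \<noteq> y"
  shows "\<exists>w. \<not> p dvd w \<and> x - y = r ^ level x y * of_int w"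
  using level(1)[OF assms] by (simp add: has_level_def)

lemma level_sym: "level x y = level y x"
proof -
  have "has_level x y = has_level y x" by (intro ext has_level_sym)
  then show ?thesis by (simp add: level_def)
qed

text \<open>
  The three differences of a triple add up to zero. With three different levels this would be a
  trinomial relation for \<open>r\<close> with coefficients prime to \<open>p\<close>.
\<close>

lemma level_triple:
  assumes "x \<in> X" "y \<in> X" "z \<in> X" "x \<noteq> y" "y \<noteq> z" "x \<noteq> z"
  shows "level x y = level x z \<or> level x y = level y z \<or> level x z = level y z"
proof -
  obtain u v w where "\<not> p dvd u" "x - y = r ^ level x y * of_int u"
    "\<not> p dvd v" "x - z = r ^ level x z * of_int v"
    "\<not> p dvd w" "y - z = r ^ level y z * of_int w"
    using level_witness assms by meson
  then show ?thesis
    using no_trinomial_relation[of u "- v" w "level x y" "level x z" "level y z"] by auto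
qed

lemma level_pair_relation:
  assumes "x \<in> X" "y \<in> X" "z \<in> X" "x \<noteq> y" "y \<noteq> z" "x \<noteq> z"
    and "level x y = level x z" "level y z \<noteq> level x y"
  shows "\<exists>c w. \<not> p dvd w \<and> y - z = r ^ level y z * of_int w \<and>
    y - z = r ^ level x y * of_int (p * c)"
proof -
  obtain u v w where uvw: "\<not> p dvd u" "x - y = r ^ level x y * of_int u"
    "\<not> p dvd v" "x - z = r ^ level x z * of_int v"
    "\<not> p dvd w" "y - z = r ^ level y z * of_int w"
    using level_witness assms by meson
  have eq: "y - z = r ^ level x y * of_int (v - u)"
    using uvw(2,4) assms(7) by (simp add: algebra_simps)
  have "p dvd v - u"
  proof (rule ccontr)
    assume "\<not> p dvd v - u"
    then have "level y z = level x y"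
      using no_binomial_relation[OF uvw(5), of "v - u"] eq uvw(6) by metis
    then show False using assms(8) by simp
  qed
  then obtain c where "v - u = p * c" by blast
  then show ?thesis using uvw(5,6) eq by metis
qed

text \<open>
  When the levels of a triple are not all equal, the odd one is either above or below the repeated
  one. A triple of the first kind says that some power \<open>r^n\<close> with \<open>n > 0\<close> is a rational number of
  positive \<open>p\<close>-adic valuation, one of the second kind that some such power has negative valuation.
  The two kinds therefore exclude each other.
\<close>

definition expanding_triple :: "real \<Rightarrow> real \<Rightarrow> real \<Rightarrow> bool" where
  "expanding_triple x y z \<longleftrightarrow> x \<in> X \<and> y \<in> X \<and> z \<in> X \<and> x \<noteq> y \<and> y \<noteq> z \<and> x \<noteq> z \<and>
     level x y = level x z \<and> level y z > level x y"

definition contracting_triple :: "real \<Rightarrow> real \<Rightarrow> real \<Rightarrow> bool" where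
  "contracting_triple x y z \<longleftrightarrow> x \<in> X \<and> y \<in> X \<and> z \<in> X \<and> x \<noteq> y \<and> y \<noteq> z \<and> x \<noteq> z \<and>
     level x y = level x z \<and> level y z < level x y"

lemma not_both_triples:
  assumes "expanding_triple x y z" "contracting_triple x' y' z'"
  shows False
proof -
  obtain c w where 1: "\<not> p dvd w" "y - z = r ^ level y z * of_int w"
    "y - z = r ^ level x y * of_int (p * c)"
    using assms(1) level_pair_relation[of x y z] unfolding expanding_triple_def by (metis nless_le)
  obtain c' w' where 2: "\<not> p dvd w'" "y' - z' = r ^ level y' z' * of_int w'"
    "y' - z' = r ^ level x' y' * of_int (p * c')"
    using assms(2) level_pair_relation[of x' y' z'] unfolding contracting_triple_def by (metis nless_le)
  define e where "e = level y z - level x y"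
  define e' where "e' = level x' y' - level y' z'"
  have e: "e > 0" "level y z = level x y + e"
    using assms(1) by (auto simp: e_def expanding_triple_def)
  have e': "e' > 0" "level x' y' = level y' z' + e'"
    using assms(2) by (auto simp: e'_def contracting_triple_def)
  have "r ^ level x y * (r ^ e * of_int w) = r ^ level x y * of_int (p * c)"
    using 1(2,3) unfolding e(2) power_add by (simp only: mult.assoc)
  then have r1: "r ^ e * of_int w = of_int (p * c)" using r_gt_1 by simp
  have "r ^ level y' z' * of_int w' = r ^ level y' z' * (r ^ e' * of_int (p * c'))"
    using 2(2,3) unfolding e'(2) power_add by (simp only: mult.assoc)
  then have r2: "of_int w' = r ^ e' * of_int (p * c')" using r_gt_1 by simp
  \<comment> \<open>Eliminating \<open>r\<close> from \<open>r1\<close> and \<open>r2\<close> leaves an equation between integers.\<close>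
  have "real_of_int (w' ^ e * w ^ e') = (r ^ e' * of_int (p * c')) ^ e * of_int w ^ e'"
    using r2 by simp
  also have "\<dots> = (r ^ e * of_int w) ^ e' * of_int (p * c') ^ e"
    by (simp add: power_mult_distrib mult_ac flip: power_mult)
  also have "\<dots> = real_of_int ((p * c) ^ e' * (p * c') ^ e)"
    using r1 by simp
  finally have "w' ^ e * w ^ e' = (p * c) ^ e' * (p * c') ^ e"
    by linarith
  moreover have "p dvd (p * c) ^ e' * (p * c') ^ e"
    using e'(1) by (intro dvd_mult2 dvd_trans[OF dvd_triv_left dvd_power]) simp
  ultimately have "p dvd w' ^ e * w ^ e'" by simp
  then show False
    using 1(1) 2(1) prime_p by (metis prime_dvd_mult_iff prime_dvd_power)
qed

lemma levels_unbounded: "\<exists>x\<in>X. \<exists>y\<in>X. x \<noteq> y \<and> r ^ level x y > B"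
proof -
  obtain n where n: "B < r ^ n" using real_arch_pow[OF r_gt_1] by blast
  have "r ^ n \<le> r ^ Suc n" using r_gt_1 by (intro power_increasing) auto
  then have n': "B < r ^ Suc n" using n by simp
  obtain x y where "x \<in> X" "y \<in> X" "x \<noteq> y" "has_level x y (Suc n)"
    using ex_pair_with_level[of "Suc n"] by auto
  then show ?thesis using n' level_eqI by metis
qed

lemma power_le_dist:
  assumes "y - z = r ^ k * of_int c" "y \<noteq> z"
  shows "r ^ k \<le> \<bar>y - z\<bar>"
proof -
  have "c \<noteq> 0" using assms by auto
  then have "real_of_int \<bar>c\<bar> \<ge> 1" by linarith
  moreover have "r ^ k > 0" using r_gt_1 by simp
  ultimately have "r ^ k * 1 \<le> r ^ k * real_of_int \<bar>c\<bar>"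
    by (intro mult_left_mono) auto
  also have "\<dots> = \<bar>y - z\<bar>" using assms r_gt_1 by (simp add: abs_mult)
  finally show ?thesis by simp
qed

text \<open>
  If only contracting triples occur, the largest level in every triple is attained twice. Then a
  pair \<open>x1, x2\<close> bounds all levels: a point \<open>u\<close> whose level with \<open>x1\<close> exceeds that of the pair
  has this same level with \<open>x2\<close>, so \<open>x1 - x2\<close> is an integer multiple of that power of \<open>r\<close>. This
  contradicts the fact that all levels are attained.
\<close>

lemma no_contracting_triple: "\<not> contracting_triple x y z"
proof
  assume con: "contracting_triple x y z"
  have no_exp: "\<not> expanding_triple a b c" for a b c using not_both_triples con by blast
  obtain x1 x2 where x12: "x1 \<in> X" "x2 \<in> X" "x1 \<noteq> x2"
    using ex_pair_with_level[of 1] by auto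
  define B where "B = \<bar>x1 - x2\<bar>"
  have B0: "r ^ level x1 x2 \<le> B"
    using level(1)[OF x12] power_le_dist x12(3) unfolding has_level_def B_def by blast
  have bound: "r ^ level u x1 \<le> B" if u: "u \<in> X" "u \<noteq> x1" for u
  proof (cases "level u x1 \<le> level x1 x2")
    case True
    then have "r ^ level u x1 \<le> r ^ level x1 x2" using r_gt_1 by (intro power_increasing) auto
    then show ?thesis using B0 by simp
  next
    case False
    then have neq: "u \<noteq> x2" using level_sym by force
    have t: "level u x1 = level u x2 \<or> level u x1 = level x1 x2 \<or> level u x2 = level x1 x2"
      using level_triple[of u x1 x2] u x12 neq by blast
    have "\<not> (level u x2 = level x1 x2)"
    proof
      assume "level u x2 = level x1 x2"
      then have "expanding_triple x2 u x1"
        unfolding expanding_triple_def using u x12 neq False level_sym[of x2] by auto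
      then show False using no_exp by blast
    qed
    then have eq: "level u x1 = level u x2" using t False by auto
    obtain c w where "x1 - x2 = r ^ level u x1 * of_int (p * c)"
      using level_pair_relation[of u x1 x2] u x12 neq eq False by (metis linear)
    then show ?thesis using power_le_dist x12(3) unfolding B_def by blast
  qed
  have "r ^ level u v \<le> B" if uv: "u \<in> X" "v \<in> X" "u \<noteq> v" for u v
  proof (cases "u = x1 \<or> v = x1")
    case True
    then show ?thesis using bound[of u] bound[of v] uv level_sym by metis
  next
    case False
    have t: "level u v \<le> level u x1 \<or> level u v \<le> level v x1"
    proof (rule ccontr)
      assume n: "\<not> ?thesis"
      then have "level x1 u = level x1 v"
        using level_triple[of u v x1] uv x12 False level_sym by (metis order_refl)
      then have "expanding_triple x1 u v"
        unfolding expanding_triple_def using n uv x12 False level_sym[of x1] by auto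
      then show False using no_exp by blast
    qed
    have "r ^ level u v \<le> r ^ level u x1 \<or> r ^ level u v \<le> r ^ level v x1"
      using t r_gt_1 by (meson less_imp_le power_increasing)
    then show ?thesis using bound[of u] bound[of v] uv False by force
  qed
  then show False using levels_unbounded[of B] by force
qed

text \<open>
  Without contracting triples the smallest level in every triple is attained twice, so a pair at
  level 1 provides every point with a partner at level 1.
\<close>

lemma level_one_neighbour:
  assumes "x \<in> X"
  obtains y where "y \<in> X" "y \<noteq> x" "level x y = 1"
proof -
  obtain a b where ab: "a \<in> X" "b \<in> X" "a \<noteq> b" "has_level a b 1"
    using ex_pair_with_level[of 1] by auto
  have l1: "level a b = 1" using ab(4) by (rule level_eqI)
  consider "x = a" | "x = b" | "x \<noteq> a" "x \<noteq> b" by blast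
  then show ?thesis
  proof cases
    case 1 then show ?thesis using that ab l1 by metis
  next
    case 2 then show ?thesis using that ab l1 level_sym by metis
  next
    case 3
    have "level x a = 1 \<or> level x b = 1"
    proof (rule ccontr)
      assume n: "\<not> ?thesis"
      have "level x a = level x b"
        using level_triple[of x a b] n l1 assms ab 3 by metis
      moreover have "level x a > 1" using level(2)[OF assms ab(1)] 3 n by auto
      ultimately have "contracting_triple x a b"
        unfolding contracting_triple_def using assms ab 3 l1 by auto
      then show False using no_contracting_triple by blast
    qed
    then show ?thesis using that ab 3 by metis
  qed
qed

text \<open>
  A partner of \<open>x\<close> at level 1 is also one of \<open>y\<close>, unless \<open>x\<close> and \<open>y\<close> have level 1 themselves; so
  \<open>x - y\<close> is a difference of two integer multiples of \<open>r\<close>.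
\<close>

lemma diff_multiple_of_r:
  assumes "x \<in> X" "y \<in> X"
  shows "\<exists>z. x - y = r * of_int z"
proof (cases "x = y")
  case True then show ?thesis by (intro exI[of _ 0]) simp
next
  case xy: False
  have lev1: "\<exists>w. u - v = r * of_int w" if "level u v = 1" "u \<in> X" "v \<in> X" "u \<noteq> v" for u v
    using level(1)[OF that(2-4)] that(1) by (auto simp: has_level_def)
  show ?thesis
  proof (cases "level x y = 1")
    case True then show ?thesis using lev1 assms xy by blast
  next
    case False
    obtain c where c: "c \<in> X" "c \<noteq> x" "level x c = 1" using level_one_neighbour assms by blast
    have cy: "c \<noteq> y" using c False by auto
    have big: "level x y > 1" using level(2)[of x y] assms xy False by auto
    have "level y c = 1"
    proof (rule ccontr)
      assume n: "level y c \<noteq> 1"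
      then have eq: "level y x = level y c"
        using level_triple[of x y c] assms c xy cy False by (metis level_sym)
      then have "contracting_triple y x c"
        unfolding contracting_triple_def using assms c xy cy big level_sym[of x y] by auto
      then show False using no_contracting_triple by blast
    qed
    then obtain u v where "x - c = r * of_int u" "y - c = r * of_int v"
      using lev1[of x c] lev1[of y c] c assms cy by auto
    then have "x - y = r * of_int (u - v)" by (simp add: algebra_simps)
    then show ?thesis by blast
  qed
qed

text \<open>
  A pair at level 2 differs by \<open>r^2 w\<close> and also by an integer multiple of \<open>r\<close>, which makes \<open>r\<close>
  rational. In lowest terms \<open>s / t\<close>, the integrality of \<open>(s/t)^(k-1) w\<close> pushes the full power
  \<open>s^(k-1)\<close> into every difference at level \<open>k\<close>.
\<close>

theorem ratio_rational:
  obtains s t :: int where "coprime s t" "0 < t" "0 < s" "p dvd s" "r = of_int s / of_int t"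
    "\<And>x y k w. x \<in> X \<Longrightarrow> y \<in> X \<Longrightarrow> k \<ge> 1 \<Longrightarrow> x - y = r ^ k * of_int w \<Longrightarrow>
       \<exists>w'. x - y = r * of_int (s ^ (k - 1) * w')"
proof -
  obtain a b where ab: "a \<in> X" "b \<in> X" "a \<noteq> b" "has_level a b 2"
    using ex_pair_with_level[of 2] one_le_numeral[of "num.Bit0 num.One"] by blast
  obtain w where w: "\<not> p dvd w" "a - b = r ^ 2 * of_int w"
    using ab(4) unfolding has_level_def by blast
  obtain z where z: "a - b = r * of_int z" using diff_multiple_of_r ab by blast
  have rz: "r * of_int w = of_int z" using w(2) z r_gt_1 by (simp add: power2_eq_square)
  have w0: "w \<noteq> 0" using w by auto
  have "p dvd z"
  proof (rule ccontr)
    assume "\<not> p dvd z"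
    then have "(1::nat) = 0" using no_binomial_relation[OF w(1), of z 1 0] rz by simp
    then show False by simp
  qed
  have req: "r = of_int z / of_int w" using rz w0 by (simp add: field_simps)
  then have "r \<in> \<rat>" by simp
  then obtain s t :: int where st: "t > 0" "coprime s t" "r = of_int s / of_int t"
    by (metis Rats_cases')
  have spos: "s > 0" using st r_gt_1 by (metis less_trans of_int_0_less_iff zero_less_divide_iff zero_less_one not_less_iff_gr_or_eq)
  have "real_of_int (z * t) = of_int (s * w)" using req st w0 by (simp add: field_simps)
  then have "z * t = s * w" by linarith
  then have "p dvd s * w" using \<open>p dvd z\<close> by (metis dvd_mult2)
  then have ps: "p dvd s" using w(1) prime_p by (simp add: prime_dvd_mult_iff)
  have "\<exists>w'. x - y = r * of_int (s ^ (k - 1) * w')"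
    if xy: "x \<in> X" "y \<in> X" "k \<ge> 1" "x - y = r ^ k * of_int w" for x y k w
  proof -
    obtain z where z: "x - y = r * of_int z" using diff_multiple_of_r xy by blast
    obtain k' where k': "k = Suc k'" using xy(3) by (metis Suc_le_D One_nat_def)
    have "r * (r ^ k' * of_int w) = r * of_int z" using z xy(4) k' by (simp add: mult.assoc)
    then have "r ^ k' * of_int w = of_int z" using r_gt_1 by simp
    then have "of_int (s ^ k' * w) = real_of_int (t ^ k' * z)"
      using st by (simp add: power_divide field_simps)
    then have eq: "s ^ k' * w = t ^ k' * z" by linarith
    have "coprime (s ^ k') (t ^ k')" using st(2) by simp
    then have "s ^ k' dvd z" using eq by (metis coprime_dvd_mult_right_iff dvd_triv_left)
    then obtain w' where "z = s ^ k' * w'" by blast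
    then show ?thesis using z k' by auto
  qed
  then show ?thesis using that st spos ps by blast
qed

end

section \<open>Logarithmic decay of products of cosines\<close>

text \<open>
  The largest possible modulus of an average of \<open>p\<close> complex units of which two have phases
  \<open>2 pi y\<close> apart.
\<close>

definition cos_bound :: "nat \<Rightarrow> real \<Rightarrow> real" where
  "cos_bound p y = (real p - 2 + 2 * \<bar>cos (pi * y)\<bar>) / real p"

lemma cos_bound_nonneg: "p \<ge> 2 \<Longrightarrow> 0 \<le> cos_bound p y"
  by (simp add: cos_bound_def)

lemma cos_bound_le_1: "p \<ge> 2 \<Longrightarrow> cos_bound p y \<le> 1"
  by (simp add: cos_bound_def divide_le_eq)

lemma abs_cos_pi_add_int: "\<bar>cos (pi * (y + of_int n))\<bar> = \<bar>cos (pi * y)\<bar>"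
  by (simp add: distrib_left cos_add cos_npi_int sin_npi_int abs_mult)

lemma abs_cos_away_from_ints:
  assumes "0 < \<epsilon>" "\<epsilon> \<le> 1/2" "\<And>n::int. \<epsilon> \<le> \<bar>y - of_int n\<bar>"
  shows "\<bar>cos (pi * y)\<bar> \<le> cos (pi * \<epsilon>)"
proof -
  define f where "f = y - of_int (round y)"
  have f: "\<epsilon> \<le> \<bar>f\<bar>" "\<bar>f\<bar> \<le> 1/2"
    using assms(3)[of "round y"] of_int_round_abs_le[of y] by (auto simp: f_def abs_minus_commute)
  have "\<bar>cos (pi * y)\<bar> = \<bar>cos (pi * f)\<bar>"
    using abs_cos_pi_add_int[of f "round y"] by (simp add: f_def)
  also have "cos (pi * f) = cos (pi * \<bar>f\<bar>)"
    by (simp add: abs_if)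
  also have "\<bar>cos (pi * \<bar>f\<bar>)\<bar> = cos (pi * \<bar>f\<bar>)"
    using f by (intro abs_of_nonneg cos_ge_zero) (auto simp: mult_le_cancel_left intro: order.trans[of _ 0])
  also have "\<dots> \<le> cos (pi * \<epsilon>)"
    using f assms by (intro cos_monotone_0_pi_le) (auto simp: mult_le_cancel_left_pos mult_le_cancel_left2)
  finally show ?thesis .
qed

text \<open>
  If \<open>y (t/s)^j\<close> and \<open>y (t/s)^(j+1)\<close> are both within \<open>1/(s+t)\<close> of integers \<open>n\<close> and \<open>n'\<close>, then
  \<open>s n' = t n\<close>. A run of \<open>J\<close> such steps makes \<open>s^J\<close> divide the nearest integer of \<open>y\<close>, hence
  \<open>s^J \<le> 2 |y|\<close>.
\<close>

lemma geometric_orbit_leaves_ints: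
  fixes s t :: nat and y :: real
  assumes "coprime s t" "0 < t" "t < s" "1 \<le> \<bar>y\<bar>" "2 * \<bar>y\<bar> < real s ^ J"
  shows "\<exists>j\<le>J. \<forall>n::int. 1 / real (s + t) \<le> \<bar>(real t / real s) ^ j * y - of_int n\<bar>"
proof (rule ccontr)
  assume "\<not> ?thesis"
  then have "\<forall>j. \<exists>n::int. j \<le> J \<longrightarrow> \<bar>(real t / real s) ^ j * y - of_int n\<bar> < 1 / real (s + t)"
    by (meson not_le)
  from choice[OF this] obtain n :: "nat \<Rightarrow> int" where
    n: "\<And>j. j \<le> J \<Longrightarrow> \<bar>(real t / real s) ^ j * y - of_int (n j)\<bar> < 1 / real (s + t)" by blast
  have s0: "real s > 0" using assms by simp
  have rec: "int s * n (Suc j) = int t * n j" if j: "Suc j \<le> J" for j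
  proof -
    define u where "u = (real t / real s) ^ j * y"
    have u: "(real t / real s) ^ Suc j * y = real t * u / real s" by (simp add: u_def)
    have 1: "\<bar>u - of_int (n j)\<bar> < 1 / real (s + t)" using n[of j] j by (simp add: u_def)
    have 2: "\<bar>real t * u / real s - of_int (n (Suc j))\<bar> < 1 / real (s + t)"
      using n[of "Suc j"] j unfolding u by simp
    have "real_of_int (int s * n (Suc j) - int t * n j) =
      real t * (u - of_int (n j)) - real s * (real t * u / real s - of_int (n (Suc j)))"
      using s0 by (simp add: field_simps)
    also have "\<bar>\<dots>\<bar> \<le> real t * \<bar>u - of_int (n j)\<bar> + real s * \<bar>real t * u / real s - of_int (n (Suc j))\<bar>"
      by (rule order.trans[OF abs_triangle_ineq4]) (simp add: abs_mult)
    also have "\<dots> < real t * (1 / real (s + t)) + real s * (1 / real (s + t))"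
      using 1 2 s0 assms(2) by (intro add_strict_mono mult_strict_left_mono) auto
    also have "\<dots> = (real t + real s) / real (s + t)" by (simp add: add_divide_distrib)
    also have "\<dots> = 1" using s0 by simp
    finally have "\<bar>int s * n (Suc j) - int t * n j\<bar> < 1" by linarith
    then show ?thesis by simp
  qed
  have "int s ^ j * n j = int t ^ j * n 0" if "j \<le> J" for j
    using that
  proof (induction j)
    case (Suc j)
    have "int s ^ Suc j * n (Suc j) = int s ^ j * (int t * n j)"
      using rec[OF Suc.prems] by (simp add: mult_ac)
    also have "\<dots> = int t ^ Suc j * n 0" using Suc by simp
    finally show ?case .
  qed simp
  then have "int s ^ J * n J = int t ^ J * n 0" by simp
  moreover have "coprime (int s ^ J) (int t ^ J)" using assms(1) by simp
  ultimately have dvd: "int s ^ J dvd n 0"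
    by (metis coprime_dvd_mult_right_iff dvd_triv_left)
  have less1: "1 / real (s + t) \<le> 1" using assms by (simp add: divide_le_eq)
  have n0: "\<bar>y - of_int (n 0)\<bar> < 1" using n[of 0] less1 by simp
  then have "n 0 \<noteq> 0" using assms(4) by auto
  then have "int s ^ J \<le> \<bar>n 0\<bar>" using dvd by (metis dvd_abs_iff zdvd_imp_le zero_less_abs_iff)
  then have "real_of_int (int s ^ J) \<le> real_of_int \<bar>n 0\<bar>" by (simp only: of_int_le_iff)
  then have "real s ^ J \<le> \<bar>real_of_int (n 0)\<bar>" by simp
  also have "\<dots> \<le> \<bar>y\<bar> + 1" using n0 by linarith
  finally show False using assms(4,5) by linarith
qed

lemma ex_least_power_gt:
  fixes s x :: real
  assumes "1 < s" "1 \<le> x"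
  obtains J where "x < s ^ J" "s ^ J \<le> s * x"
proof -
  have ex: "\<exists>n. x < s ^ n" using real_arch_pow[OF assms(1)] by blast
  define J where "J = (LEAST n. x < s ^ n)"
  have J: "x < s ^ J" "\<And>m. m < J \<Longrightarrow> \<not> x < s ^ m"
    unfolding J_def using LeastI_ex[OF ex] not_less_Least by blast+
  have "J \<noteq> 0" using J(1) assms by (intro notI) simp
  then obtain J' where J': "J = Suc J'" using not0_implies_Suc by blast
  then have "s ^ J' \<le> x" using J(2)[of J'] by simp
  then have "s ^ J \<le> s * x" using assms J' by simp
  then show ?thesis using that J(1) by blast
qed

text \<open>
  Iterating \<open>step\<close> bounds \<open>F\<close> by a product of cosine factors along the orbit \<open>y (t/s)^j\<close>. A factor
  bounded away from 1 occurs before \<open>|y|\<close> has dropped below a fixed root of itself, here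
  governed by \<open>A\<close>. So multiplying \<open>log |y|\<close> by \<open>2 A\<close> gains one
  factor \<open>rate\<close>.
\<close>

locale log_decay =
  fixes p s t A :: nat and F :: "'a \<Rightarrow> real" and y :: "'a \<Rightarrow> real" and N :: "'a \<Rightarrow> 'a"
  assumes p: "2 \<le> p" and st: "coprime s t" "1 < t" "t < s" and A: "s \<le> t ^ A" "1 \<le> A"
    and F: "\<And>\<xi>. 0 \<le> F \<xi>" "\<And>\<xi>. F \<xi> \<le> 1"
    and step: "\<And>\<xi>. F \<xi> \<le> cos_bound p (y (N \<xi>)) * F (N \<xi>)"
    and yN: "\<And>\<xi>. y (N \<xi>) = real t / real s * y \<xi>"
begin

definition rate :: real where
  "rate = (real p - 2 + 2 * cos (pi * (1 / real (s + t)))) / real p"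

lemma rate: "0 \<le> rate" "rate < 1"
proof -
  have b: "1 / real (s + t) \<le> 1/2" using st by (simp add: divide_le_eq)
  have "cos (pi * (1 / real (s + t))) \<ge> 0"
  proof (rule cos_ge_zero)
    show "- (pi / 2) \<le> pi * (1 / real (s + t))" by (rule order.trans[of _ 0]) auto
    show "pi * (1 / real (s + t)) \<le> pi / 2"
      using mult_left_mono[OF b, of pi] by simp
  qed
  then show "0 \<le> rate" using p by (simp add: rate_def)
  have "cos (pi * (1 / real (s + t))) < cos 0"
    using b st by (intro cos_monotone_0_pi) (auto simp: divide_simps)
  then show "rate < 1" using p by (simp add: rate_def divide_less_eq)
qed

lemma y_funpow: "y ((N ^^ n) \<xi>) = (real t / real s) ^ n * y \<xi>"
  by (induction n) (simp_all add: yN)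

lemma F_le_F_N: "F \<xi> \<le> F (N \<xi>)"
  by (rule order.trans[OF step]) (use F cos_bound_le_1[OF p] in \<open>simp add: mult_left_le_one_le cos_bound_nonneg[OF p]\<close>)

lemma F_le_funpow: "F \<xi> \<le> F ((N ^^ n) \<xi>)"
  by (induction n) (auto intro: order.trans F_le_F_N)

text \<open>
  The orbit starts at \<open>N \<xi>\<close>, where \<open>step\<close> evaluates the first factor; \<open>|y| \<ge> s\<close> guarantees that
  this starting value is still at least 1 in modulus.
\<close>

lemma one_bad_factor:
  assumes "real s \<le> \<bar>y \<xi>\<bar>" "2 * \<bar>y \<xi>\<bar> < real s ^ J"
  obtains j where "j \<le> J" "F \<xi> \<le> rate * F ((N ^^ Suc j) \<xi>)"
proof -
  have y': "\<bar>y (N \<xi>)\<bar> = real t * \<bar>y \<xi>\<bar> / real s" using st by (simp add: yN abs_mult)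
  have "real s * 1 \<le> \<bar>y \<xi>\<bar> * real t" using assms(1) st by (intro mult_mono) auto
  then have "1 \<le> \<bar>y (N \<xi>)\<bar>" using st by (simp add: y' le_divide_eq mult.commute)
  moreover have "\<bar>y (N \<xi>)\<bar> \<le> \<bar>y \<xi>\<bar>"
    using st mult_right_mono[of "real t" "real s" "\<bar>y \<xi>\<bar>"] by (simp add: y' divide_le_eq mult.commute)
  ultimately obtain j where j: "j \<le> J"
    "\<And>n::int. 1 / real (s + t) \<le> \<bar>(real t / real s) ^ j * y (N \<xi>) - of_int n\<bar>"
    using geometric_orbit_leaves_ints[of s t "y (N \<xi>)" J] st assms(2) by force
  have arg: "(real t / real s) ^ j * y (N \<xi>) = y (N ((N ^^ j) \<xi>))"
    using y_funpow[of j \<xi>] by (simp add: yN)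
  have "\<bar>cos (pi * y (N ((N ^^ j) \<xi>)))\<bar> \<le> cos (pi * (1 / real (s + t)))"
    using j(2) st unfolding arg by (intro abs_cos_away_from_ints) (auto simp: divide_le_eq)
  then have "cos_bound p (y (N ((N ^^ j) \<xi>))) \<le> rate"
    using p by (simp add: cos_bound_def rate_def divide_right_mono)
  then have "cos_bound p (y (N ((N ^^ j) \<xi>))) * F (N ((N ^^ j) \<xi>)) \<le> rate * F (N ((N ^^ j) \<xi>))"
    using F by (intro mult_right_mono) auto
  then have "F ((N ^^ j) \<xi>) \<le> rate * F ((N ^^ Suc j) \<xi>)"
    using step[of "(N ^^ j) \<xi>"] by simp
  then show ?thesis using F_le_funpow[of \<xi> j] j(1) that by fastforce
qed

text \<open>
  With \<open>Y = 2 s^2\<close> and \<open>Z = Y^((2A)^i)\<close>, a point with \<open>|y| \<ge> Z^(2A)\<close> needs a bad factor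
  within \<open>J\<close> steps, where \<open>s^J\<close> is comparable to \<open>|y|\<close>. After these steps the size is about
  \<open>t^J / Y \<ge> |y|^(1/A) / Y \<ge> Z^2 / Y \<ge> Z\<close>, so the induction hypothesis still applies.
\<close>

lemma decay:
  assumes "real (2 * s\<^sup>2) ^ ((2 * A) ^ i) \<le> \<bar>y \<xi>\<bar>"
  shows "F \<xi> \<le> rate ^ i"
  using assms
proof (induction i arbitrary: \<xi>)
  case 0
  then show ?case using F by simp
next
  case (Suc i)
  define Y where "Y = real (2 * s\<^sup>2)"
  define Z where "Z = Y ^ ((2 * A) ^ i)"
  have s1: "real s > 1" using st by simp
  have "1 * 1 \<le> real s * real s" using s1 by (intro mult_mono) auto
  then have Y1: "Y \<ge> 1" by (simp add: Y_def power2_eq_square)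
  have ZY: "Y \<le> Z" unfolding Z_def using Y1 A by (intro self_le_power) auto
  have Z1: "Z \<ge> 1" using ZY Y1 by simp
  have big: "(Z ^ 2) ^ A \<le> \<bar>y \<xi>\<bar>"
  proof -
    have "(Z ^ 2) ^ A = Y ^ ((2 * A) ^ Suc i)" by (simp add: Z_def mult_ac flip: power_mult)
    then show ?thesis using Suc.prems by (simp only: Y_def)
  qed
  have "Z \<le> (Z ^ 2) ^ A" using Z1 A by (subst power_mult[symmetric], intro self_le_power) auto
  then have yY: "Y \<le> \<bar>y \<xi>\<bar>" using ZY big by simp
  have "real s * 1 \<le> real s * (2 * real s)" using s1 by (intro mult_left_mono) auto
  then have sY: "real s \<le> Y" by (simp add: Y_def power2_eq_square)
  obtain J where J: "2 * \<bar>y \<xi>\<bar> < real s ^ J" "real s ^ J \<le> real s * (2 * \<bar>y \<xi>\<bar>)"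
    using ex_least_power_gt[OF s1, of "2 * \<bar>y \<xi>\<bar>"] Y1 yY by auto
  obtain j where j: "j \<le> J" "F \<xi> \<le> rate * F ((N ^^ Suc j) \<xi>)"
    using one_bad_factor[of \<xi> J] sY yY J(1) by auto
  have "(Z ^ 2) ^ A < real s ^ J" using big J(1) Y1 yY by linarith
  also have "\<dots> \<le> (real t ^ A) ^ J"
    using A(1) by (intro power_mono) (metis of_nat_le_iff of_nat_power, simp)
  also have "\<dots> = (real t ^ J) ^ A" by (simp add: mult.commute flip: power_mult)
  finally have ZtJ: "Z ^ 2 < real t ^ J" by (rule power_less_imp_less_base) simp
  have q01: "0 < real t / real s" "real t / real s \<le> 1" using st by auto
  have "Z * Y \<le> Z * Z" using ZY Z1 by (intro mult_left_mono) auto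
  also have "\<dots> \<le> real t ^ J" using ZtJ by (simp add: power2_eq_square)
  also have "\<dots> \<le> real t ^ Suc J" using st by (intro power_increasing) auto
  finally have ZY': "Z * Y \<le> real t ^ Suc J" .
  have "real s ^ Suc J \<le> Y * \<bar>y \<xi>\<bar>"
    using mult_left_mono[OF J(2), of "real s"] by (simp add: Y_def power2_eq_square mult_ac)
  then have "Z * real s ^ Suc J \<le> Z * (Y * \<bar>y \<xi>\<bar>)" using Z1 by (intro mult_left_mono) auto
  also have "\<dots> \<le> real t ^ Suc J * \<bar>y \<xi>\<bar>"
    using mult_right_mono[OF ZY', of "\<bar>y \<xi>\<bar>"] by (simp add: mult.assoc)
  finally have "Z \<le> (real t / real s) ^ Suc J * \<bar>y \<xi>\<bar>"
    using s1 by (simp add: power_divide field_simps)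
  also have "\<dots> \<le> (real t / real s) ^ Suc j * \<bar>y \<xi>\<bar>"
    using q01 j(1) by (intro mult_right_mono power_decreasing) auto
  also have "\<dots> = \<bar>y ((N ^^ Suc j) \<xi>)\<bar>"
    unfolding y_funpow abs_mult using q01 by simp
  finally have "F ((N ^^ Suc j) \<xi>) \<le> rate ^ i"
    by (intro Suc.IH) (simp add: Z_def Y_def)
  then have "rate * F ((N ^^ Suc j) \<xi>) \<le> rate * rate ^ i" using rate by (intro mult_left_mono) auto
  then show ?case using j(2) by simp
qed

end

section \<open>Exponentials, Parseval and Bessel\<close>

lemma expo_continuous: "continuous_on UNIV (\<lambda>x. expo \<xi> x)"
  unfolding expo_def by (intro continuous_intros)

lemma expo_measurable [measurable]: "(\<lambda>x. expo \<xi> x) \<in> borel_measurable borel"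
  by (intro borel_measurable_continuous_onI expo_continuous)

lemma norm_expo [simp]: "cmod (expo \<xi> x) = 1"
  by (simp add: expo_def norm_exp_eq_Re)

lemma expo_0 [simp]: "expo 0 x = 1" "expo \<xi> 0 = 1"
  by (simp_all add: expo_def)

lemma cnj_expo: "cnj (expo \<xi> x) = expo (- \<xi>) x"
  by (simp add: expo_def exp_cnj)

lemma expo_add_left: "expo (\<xi> + \<eta>) x = expo \<xi> x * expo \<eta> x"
  by (simp add: expo_def inner_add_left algebra_simps flip: exp_add)

lemma expo_add_right: "expo \<xi> (x + y) = expo \<xi> x * expo \<xi> y"
  by (simp add: expo_def inner_add_right algebra_simps flip: exp_add)

lemma expo_mult_cnj: "expo \<xi> x * cnj (expo \<eta> x) = expo (\<xi> - \<eta>) x"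
  using expo_add_left[of \<xi> "- \<eta>" x] by (simp add: cnj_expo)

lemma integrable_expo:
  fixes \<mu> :: "(real^'n) measure"
  assumes "prob_space \<mu>" "sets \<mu> = sets borel"
  shows "integrable \<mu> (expo \<xi>)"
proof -
  interpret prob_space \<mu> by fact
  have [measurable]: "expo \<xi> \<in> borel_measurable \<mu>"
    using expo_measurable[of \<xi>] measurable_cong_sets[OF assms(2) refl] by blast
  show ?thesis by (rule integrable_const_bound[of _ 1]) auto
qed

lemma integral_expo_mult_cnj: "(LINT x|\<mu>. expo \<xi> x * cnj (expo \<eta> x)) = fourier \<mu> (\<xi> - \<eta>)"
  by (simp add: expo_mult_cnj fourier_def)

lemma norm_fourier_le_1:
  fixes \<mu> :: "(real^'n) measure"
  assumes "prob_space \<mu>"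
  shows "cmod (fourier \<mu> \<xi>) \<le> 1"
proof -
  interpret prob_space \<mu> by fact
  have "cmod (fourier \<mu> \<xi>) \<le> (LINT x|\<mu>. cmod (expo \<xi> x))"
    unfolding fourier_def by (rule integral_norm_bound)
  then show ?thesis by (simp add: prob_space)
qed

lemma fourier_0: "prob_space \<mu> \<Longrightarrow> fourier \<mu> 0 = 1"
  by (simp add: fourier_def prob_space.prob_space)

lemma isCont_fourier:
  fixes \<mu> :: "(real^'n) measure"
  assumes "prob_space \<mu>" "sets \<mu> = sets borel"
  shows "isCont (fourier \<mu>) \<xi>"
  unfolding continuous_at_sequentially comp_def
proof (intro allI impI)
  interpret prob_space \<mu> by fact
  have [measurable]: "expo \<eta> \<in> borel_measurable \<mu>" for \<eta>
    using expo_measurable[of \<eta>] measurable_cong_sets[OF assms(2) refl] by blast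
  fix X :: "nat \<Rightarrow> real^'n" assume X: "X \<longlonglongrightarrow> \<xi>"
  show "(\<lambda>n. fourier \<mu> (X n)) \<longlonglongrightarrow> fourier \<mu> \<xi>"
    unfolding fourier_def
  proof (rule integral_dominated_convergence[of _ _ _ "\<lambda>_. 1"])
    show "AE x in \<mu>. (\<lambda>n. expo (X n) x) \<longlonglongrightarrow> expo \<xi> x"
      unfolding expo_def by (intro AE_I2 tendsto_intros X)
  qed auto
qed

text \<open>
  Both Bessel's inequality and the fact that the Fourier coefficients are the best coefficients
  are read off from this expansion of the squared distance.
\<close>

lemma L2_distance_identity:
  fixes M :: "'a measure" and f :: "'a \<Rightarrow> complex" and e :: "'i \<Rightarrow> 'a \<Rightarrow> complex" and b :: "'i \<Rightarrow> complex"
  assumes fin: "finite I"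
    and ff: "integrable M (\<lambda>x. f x * cnj (f x))"
    and fe: "\<And>i. i \<in> I \<Longrightarrow> integrable M (\<lambda>x. f x * cnj (e i x))"
    and ee: "\<And>i j. i \<in> I \<Longrightarrow> j \<in> I \<Longrightarrow> integrable M (\<lambda>x. e i x * cnj (e j x))"
    and on: "\<And>i j. i \<in> I \<Longrightarrow> j \<in> I \<Longrightarrow> (LINT x|M. e i x * cnj (e j x)) = (if i = j then 1 else 0)"
  defines "c \<equiv> \<lambda>i. LINT x|M. f x * cnj (e i x)"
  shows "of_real (LINT x|M. (cmod (f x - (\<Sum>i\<in>I. b i * e i x)))\<^sup>2) =
    (LINT x|M. f x * cnj (f x)) - of_real (\<Sum>i\<in>I. (cmod (c i))\<^sup>2) + of_real (\<Sum>i\<in>I. (cmod (b i - c i))\<^sup>2)"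
proof -
  have ef: "integrable M (\<lambda>x. e i x * cnj (f x))" if "i \<in> I" for i
    using integrable_cnj[OF fe[OF that]] by (simp add: mult.commute)
  have cfe: "(LINT x|M. f x * cnj (e i x)) = c i" for i
    by (simp add: c_def)
  have cef: "(LINT x|M. e i x * cnj (f x)) = cnj (c i)" for i
    unfolding c_def by (subst Bochner_Integration.integral_cnj[symmetric]) (simp add: mult.commute)
  have expand: "complex_of_real ((cmod (f x - (\<Sum>i\<in>I. b i * e i x)))\<^sup>2) =
     f x * cnj (f x) - (\<Sum>i\<in>I. cnj (b i) * (f x * cnj (e i x))) - (\<Sum>i\<in>I. b i * (e i x * cnj (f x)))
     + (\<Sum>i\<in>I. \<Sum>j\<in>I. b i * cnj (b j) * (e i x * cnj (e j x)))" for x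
    unfolding complex_norm_square
    by (simp add: algebra_simps sum_distrib_left sum_distrib_right sum_product, subst sum.swap)
       (simp add: mult_ac)
  have "of_real (LINT x|M. (cmod (f x - (\<Sum>i\<in>I. b i * e i x)))\<^sup>2) =
     (LINT x|M. complex_of_real ((cmod (f x - (\<Sum>i\<in>I. b i * e i x)))\<^sup>2))"
    by (rule integral_complex_of_real[symmetric])
  also have "\<dots> = (LINT x|M. f x * cnj (f x)) - (\<Sum>i\<in>I. cnj (b i) * c i) - (\<Sum>i\<in>I. b i * cnj (c i))
     + (\<Sum>i\<in>I. \<Sum>j\<in>I. b i * cnj (b j) * (LINT x|M. e i x * cnj (e j x)))"
    unfolding expand using ff fe ee ef
    by (simp add: cef cfe)
  also have "(\<Sum>i\<in>I. \<Sum>j\<in>I. b i * cnj (b j) * (LINT x|M. e i x * cnj (e j x))) = (\<Sum>i\<in>I. b i * cnj (b i))"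
    by (intro sum.cong refl) (simp add: on fin if_distrib cong: if_cong)
  also have "(LINT x|M. f x * cnj (f x)) - (\<Sum>i\<in>I. cnj (b i) * c i) - (\<Sum>i\<in>I. b i * cnj (c i)) + (\<Sum>i\<in>I. b i * cnj (b i))
     = (LINT x|M. f x * cnj (f x)) - of_real (\<Sum>i\<in>I. (cmod (c i))\<^sup>2) + of_real (\<Sum>i\<in>I. (cmod (b i - c i))\<^sup>2)"
    unfolding of_real_sum complex_norm_square
    by (simp add: algebra_simps sum.distrib sum_subtractf)
  finally show ?thesis .
qed

lemma expo_distance:
  fixes \<mu> :: "(real^'n) measure"
  assumes "prob_space \<mu>" "sets \<mu> = sets borel" "finite I"
    and on: "\<And>\<kappa> \<eta>. \<kappa> \<in> I \<Longrightarrow> \<eta> \<in> I \<Longrightarrow> \<kappa> \<noteq> \<eta> \<Longrightarrow> fourier \<mu> (\<kappa> - \<eta>) = 0"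
  shows "(LINT x|\<mu>. (cmod (expo \<xi> x - (\<Sum>\<kappa>\<in>I. b \<kappa> * expo \<kappa> x)))\<^sup>2) =
    1 - (\<Sum>\<kappa>\<in>I. (cmod (fourier \<mu> (\<xi> - \<kappa>)))\<^sup>2) + (\<Sum>\<kappa>\<in>I. (cmod (b \<kappa> - fourier \<mu> (\<xi> - \<kappa>)))\<^sup>2)"
proof -
  interpret prob_space \<mu> by fact
  have "complex_of_real (LINT x|\<mu>. (cmod (expo \<xi> x - (\<Sum>\<kappa>\<in>I. b \<kappa> * expo \<kappa> x)))\<^sup>2) =
    1 - of_real (\<Sum>\<kappa>\<in>I. (cmod (fourier \<mu> (\<xi> - \<kappa>)))\<^sup>2) + of_real (\<Sum>\<kappa>\<in>I. (cmod (b \<kappa> - fourier \<mu> (\<xi> - \<kappa>)))\<^sup>2)"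
    using L2_distance_identity[of I \<mu> "expo \<xi>" expo b] assms(3) on fourier_0[OF assms(1)] prob_space
    by (simp add: expo_mult_cnj integrable_expo[OF assms(1,2)] flip: fourier_def)
  then have "complex_of_real (LINT x|\<mu>. (cmod (expo \<xi> x - (\<Sum>\<kappa>\<in>I. b \<kappa> * expo \<kappa> x)))\<^sup>2) =
    of_real (1 - (\<Sum>\<kappa>\<in>I. (cmod (fourier \<mu> (\<xi> - \<kappa>)))\<^sup>2) + (\<Sum>\<kappa>\<in>I. (cmod (b \<kappa> - fourier \<mu> (\<xi> - \<kappa>)))\<^sup>2))"
    by simp
  then show ?thesis by (simp only: of_real_eq_iff)
qed

lemma fourier_bessel:
  fixes \<mu> :: "(real^'n) measure"
  assumes "prob_space \<mu>" "sets \<mu> = sets borel" "finite I"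
    and on: "\<And>\<kappa> \<eta>. \<kappa> \<in> I \<Longrightarrow> \<eta> \<in> I \<Longrightarrow> \<kappa> \<noteq> \<eta> \<Longrightarrow> fourier \<mu> (\<kappa> - \<eta>) = 0"
  shows "(\<Sum>\<kappa>\<in>I. (cmod (fourier \<mu> (\<xi> - \<kappa>)))\<^sup>2) \<le> 1"
proof -
  have "0 \<le> (LINT x|\<mu>. (cmod (expo \<xi> x - (\<Sum>\<kappa>\<in>I. fourier \<mu> (\<xi> - \<kappa>) * expo \<kappa> x)))\<^sup>2)"
    by simp
  then show ?thesis by (subst (asm) expo_distance[OF assms]) auto
qed

lemma spectrum_orthogonal:
  assumes "is_spectrum \<mu> \<Lambda>" "\<kappa> \<in> \<Lambda>" "\<eta> \<in> \<Lambda>" "\<kappa> \<noteq> \<eta>"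
  shows "fourier \<mu> (\<kappa> - \<eta>) = 0"
  using assms unfolding is_spectrum_def L2_orthonormal_basis_def
  by (metis integral_expo_mult_cnj)

lemma spectrum_parseval:
  fixes \<mu> :: "(real^'n) measure"
  assumes "prob_space \<mu>" "sets \<mu> = sets borel" "is_spectrum \<mu> \<Lambda>" "0 < \<epsilon>"
  obtains I where "finite I" "I \<subseteq> \<Lambda>" "1 - \<epsilon> < (\<Sum>\<kappa>\<in>I. (cmod (fourier \<mu> (\<xi> - \<kappa>)))\<^sup>2)"
proof -
  interpret prob_space \<mu> by fact
  have [measurable]: "expo \<xi> \<in> borel_measurable \<mu>"
    using expo_measurable[of \<xi>] measurable_cong_sets[OF assms(2) refl] by blast
  have "square_integrable \<mu> (expo \<xi>)" by (simp add: square_integrable_def)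
  then obtain I b where I: "finite I" "I \<subseteq> \<Lambda>"
    "(LINT x|\<mu>. (cmod (expo \<xi> x - (\<Sum>\<kappa>\<in>I. b \<kappa> * expo \<kappa> x)))\<^sup>2) < \<epsilon>"
    using assms(3,4) unfolding is_spectrum_def L2_orthonormal_basis_def by meson
  have on: "fourier \<mu> (\<kappa> - \<eta>) = 0" if "\<kappa> \<in> I" "\<eta> \<in> I" "\<kappa> \<noteq> \<eta>" for \<kappa> \<eta>
    using spectrum_orthogonal[OF assms(3)] I(2) that by blast
  have "0 \<le> (\<Sum>\<kappa>\<in>I. (cmod (b \<kappa> - fourier \<mu> (\<xi> - \<kappa>)))\<^sup>2)" by (simp add: sum_nonneg)
  then have "1 - \<epsilon> < (\<Sum>\<kappa>\<in>I. (cmod (fourier \<mu> (\<xi> - \<kappa>)))\<^sup>2)"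
    using I(3) expo_distance[OF assms(1,2) I(1) on, of \<xi> b] by linarith
  then show ?thesis using that I by blast
qed

definition digit_mask :: "(real^'n) set \<Rightarrow> real^'n \<Rightarrow> complex" where
  "digit_mask D \<xi> = (\<Sum>d\<in>D. expo \<xi> d) / of_nat (card D)"

lemma norm_digit_mask_le_1: "cmod (digit_mask D \<xi>) \<le> 1"
proof -
  have "cmod (\<Sum>d\<in>D. expo \<xi> d) \<le> (\<Sum>d\<in>D. cmod (expo \<xi> d))" by (rule norm_sum)
  then show ?thesis by (cases "card D = 0") (simp_all add: digit_mask_def norm_divide divide_le_eq)
qed

text \<open>
  Bessel's inequality for the exponentials on \<open>D^J\<close> with uniform measure, where \<open>\<kappa>\<close> acts by the
  product of the characters \<open>T k \<kappa>\<close>: the inner products are the products of masks over \<open>J\<close>. Arbitrary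
  finite \<open>J\<close> is what allows single levels to be dropped.
\<close>

lemma finite_level_bessel:
  fixes T :: "nat \<Rightarrow> real^'n \<Rightarrow> real^'n"
  assumes D: "finite D" "D \<noteq> {}" and J: "finite J" and I: "finite I"
    and T: "\<And>k x y. T k (x - y) = T k x - T k y"
    and on: "\<And>\<kappa> \<eta>. \<kappa> \<in> I \<Longrightarrow> \<eta> \<in> I \<Longrightarrow> \<kappa> \<noteq> \<eta> \<Longrightarrow> \<exists>k\<in>J. digit_mask D (T k (\<kappa> - \<eta>)) = 0"
  shows "(\<Sum>\<kappa>\<in>I. \<Prod>k\<in>J. (cmod (digit_mask D (T k (\<xi> - \<kappa>))))\<^sup>2) \<le> 1"
proof -
  define W where "W = PiE J (\<lambda>_. D)"
  define M where "M = uniform_count_measure W"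
  define e where "e \<kappa> \<omega> = (\<Prod>k\<in>J. expo (T k \<kappa>) (\<omega> k))" for \<kappa> :: "real^'n" and \<omega> :: "nat \<Rightarrow> real^'n"
  have W: "finite W" "W \<noteq> {}" "card W = card D ^ card J"
    using D J by (auto simp: W_def finite_PiE PiE_eq_empty_iff card_PiE)
  have int: "(LINT \<omega>|M. e \<kappa> \<omega> * cnj (e \<eta> \<omega>)) = (\<Prod>k\<in>J. digit_mask D (T k (\<kappa> - \<eta>)))" for \<kappa> \<eta>
  proof -
    have "(LINT \<omega>|M. e \<kappa> \<omega> * cnj (e \<eta> \<omega>)) = (\<Sum>\<omega>\<in>W. e \<kappa> \<omega> * cnj (e \<eta> \<omega>)) / of_nat (card W)"
      unfolding M_def uniform_count_measure_def using W(1)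
      by (subst lebesgue_integral_point_measure_finite)
         (auto simp: scaleR_conv_of_real divide_inverse mult.commute simp flip: sum_distrib_left)
    also have "(\<Sum>\<omega>\<in>W. e \<kappa> \<omega> * cnj (e \<eta> \<omega>)) = (\<Sum>\<omega>\<in>W. \<Prod>k\<in>J. expo (T k (\<kappa> - \<eta>)) (\<omega> k))"
      by (simp add: e_def expo_mult_cnj T flip: prod.distrib)
    also have "\<dots> = (\<Prod>k\<in>J. \<Sum>d\<in>D. expo (T k (\<kappa> - \<eta>)) d)"
      unfolding W_def by (rule prod_sum_PiE[symmetric]) (use D J in auto)
    finally show ?thesis by (simp add: digit_mask_def prod_dividef W(3))
  qed
  have integ: "integrable M g" for g :: "_ \<Rightarrow> complex"
    unfolding M_def uniform_count_measure_def using W(1) by (intro integrable_point_measure_finite)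
  have on': "(LINT \<omega>|M. e \<kappa> \<omega> * cnj (e \<eta> \<omega>)) = (if \<kappa> = \<eta> then 1 else 0)" if "\<kappa> \<in> I" "\<eta> \<in> I" for \<kappa> \<eta>
  proof (cases "\<kappa> = \<eta>")
    case True
    have "T k 0 = 0" for k using T[of k 0 0] by simp
    then show ?thesis using True D by (simp add: int digit_mask_def)
  next
    case False
    then show ?thesis using on[OF that] J by (simp add: int prod_zero_iff)
  qed
  have "T k 0 = 0" for k using T[of k 0 0] by simp
  then have one: "(LINT \<omega>|M. e \<xi> \<omega> * cnj (e \<xi> \<omega>)) = 1" using D by (simp add: int digit_mask_def)
  define c where "c \<kappa> = (\<Prod>k\<in>J. digit_mask D (T k (\<xi> - \<kappa>)))" for \<kappa>
  have "complex_of_real (LINT \<omega>|M. (cmod (e \<xi> \<omega> - (\<Sum>\<kappa>\<in>I. c \<kappa> * e \<kappa> \<omega>)))\<^sup>2) =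
     of_real (1 - (\<Sum>\<kappa>\<in>I. (cmod (c \<kappa>))\<^sup>2))"
    using L2_distance_identity[of I M "e \<xi>" e c] I integ on' one by (simp add: int flip: c_def)
  then have "(LINT \<omega>|M. (cmod (e \<xi> \<omega> - (\<Sum>\<kappa>\<in>I. c \<kappa> * e \<kappa> \<omega>)))\<^sup>2) = 1 - (\<Sum>\<kappa>\<in>I. (cmod (c \<kappa>))\<^sup>2)"
    by (simp only: of_real_eq_iff)
  moreover have "0 \<le> (LINT \<omega>|M. (cmod (e \<xi> \<omega> - (\<Sum>\<kappa>\<in>I. c \<kappa> * e \<kappa> \<omega>)))\<^sup>2)" by simp
  ultimately show ?thesis by (simp add: c_def prod_norm[symmetric] prod_power_distrib)
qed

section \<open>Spectra force an integral ratio\<close>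

lemma sum_le_one_minus_loss:
  fixes f g :: "'a \<Rightarrow> real"
  assumes "finite I" "i \<in> I" "\<And>j. j \<in> I \<Longrightarrow> f j \<le> g j" "sum g I \<le> 1"
    and "f i \<le> c * g i" "c \<le> 1"
  shows "sum f I \<le> 1 - (1 - c) * f i"
proof -
  have "sum f I = f i + sum f (I - {i})" using assms by (simp add: sum.remove)
  also have "\<dots> \<le> f i + sum g (I - {i})" using assms by (intro add_left_mono sum_mono) auto
  also have "\<dots> = f i + (sum g I - g i)" using assms by (simp add: sum.remove)
  also have "\<dots> \<le> 1 - (g i - f i)" using assms by simp
  also have "\<dots> \<le> 1 - (1 - c) * f i"
  proof -
    have "(1 - c) * f i \<le> (1 - c) * g i" using assms by (intro mult_left_mono) auto
    then show ?thesis using assms(5) by (simp add: algebra_simps)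
  qed
  finally show ?thesis .
qed

lemma cos_bound_less_1:
  assumes "0 < p" "0 < \<bar>x\<bar>" "\<bar>x\<bar> < 1"
  shows "cos_bound p x < 1"
proof -
  have "cos (pi * \<bar>x\<bar>) < cos 0"
    using assms by (intro cos_monotone_0_pi) auto
  moreover have "cos pi < cos (pi * \<bar>x\<bar>)"
    using assms by (intro cos_monotone_0_pi) auto
  moreover have "cos (pi * \<bar>x\<bar>) = cos (pi * x)" by (simp add: abs_if)
  ultimately have "\<bar>cos (pi * x)\<bar> < 1" by auto
  then show ?thesis using assms by (simp add: cos_bound_def divide_less_eq)
qed

text \<open>
  What necessity needs about a self-affine measure: a coordinate \<open>u\<close> scaled by \<open>\<rho>\<close> under \<open>N\<close>, and
  information on the mask in terms of that coordinate only. The vector \<open>v\<close> is a direction of unit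
  coordinate.
\<close>

locale mask_system =
  fixes p :: nat and \<rho> \<delta> :: real and D :: "(real^'n) set" and \<mu> :: "(real^'n) measure"
    and N :: "real^'n \<Rightarrow> real^'n" and u :: "real^'n \<Rightarrow> real" and v :: "real^'n"
  assumes prime_p: "prime p" and \<rho>: "0 < \<rho>" "\<rho> < 1"
    and prob: "prob_space \<mu>" and sets: "sets \<mu> = sets borel"
    and finite_D: "finite D" and D_ne: "D \<noteq> {}"
    and N_diff: "\<And>x y. N (x - y) = N x - N y"
    and N_tendsto: "\<And>x. (\<lambda>n. (N ^^ n) x) \<longlonglongrightarrow> 0"
    and u_diff: "\<And>x y. u (x - y) = u x - u y"
    and u_N: "\<And>x. u (N x) = \<rho> * u x"
    and u_v: "\<And>\<tau>. u (\<tau> *\<^sub>R v) = \<tau>"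
    and refinement: "\<And>\<xi>. fourier \<mu> \<xi> = digit_mask D (N \<xi>) * fourier \<mu> (N \<xi>)"
    and \<delta>: "1 \<le> \<bar>\<delta>\<bar>"
    and mask_bound: "\<And>\<xi>. cmod (digit_mask D \<xi>) \<le> cos_bound p (\<delta> * u \<xi>)"
    and mask_zero: "\<And>\<xi>. digit_mask D \<xi> = 0 \<Longrightarrow> \<exists>w. \<not> int p dvd w \<and> real p * u \<xi> = of_int w"
begin

lemma funpow_N_diff: "(N ^^ k) (x - y) = (N ^^ k) x - (N ^^ k) y"
  by (induction k) (simp_all add: N_diff)

lemma u_funpow_N: "u ((N ^^ k) x) = \<rho> ^ k * u x"
  by (induction k) (simp_all add: u_N)

lemma fourier_product:
  "fourier \<mu> \<xi> = (\<Prod>k\<in>{1..n}. digit_mask D ((N ^^ k) \<xi>)) * fourier \<mu> ((N ^^ n) \<xi>)"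
proof (induction n)
  case (Suc n)
  then show ?case using refinement[of "(N ^^ n) \<xi>"] by (simp add: mult.assoc)
qed simp

lemma fourier_zero_imp_mask_zero:
  assumes "fourier \<mu> \<xi> = 0"
  shows "\<exists>k\<ge>1. digit_mask D ((N ^^ k) \<xi>) = 0"
proof -
  have "(\<lambda>n. fourier \<mu> ((N ^^ n) \<xi>)) \<longlonglongrightarrow> fourier \<mu> 0"
    by (rule isCont_tendsto_compose[OF isCont_fourier[OF prob sets] N_tendsto])
  then have "eventually (\<lambda>n. fourier \<mu> ((N ^^ n) \<xi>) \<noteq> 0) sequentially"
    by (rule tendsto_imp_eventually_ne) (simp add: fourier_0[OF prob])
  then obtain n where "fourier \<mu> ((N ^^ n) \<xi>) \<noteq> 0"
    by (auto simp: eventually_sequentially)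
  then have "(\<Prod>k\<in>{1..n}. digit_mask D ((N ^^ k) \<xi>)) = 0"
    using assms fourier_product[of \<xi> n] by simp
  then show ?thesis by auto
qed

lemma fourier_sq_product:
  "(cmod (fourier \<mu> \<xi>))\<^sup>2 = (\<Prod>k\<in>{1..n}. (cmod (digit_mask D ((N ^^ k) \<xi>)))\<^sup>2) * (cmod (fourier \<mu> ((N ^^ n) \<xi>)))\<^sup>2"
  by (subst fourier_product[of \<xi> n]) (simp add: norm_mult power_mult_distrib prod_norm[symmetric] prod_power_distrib)

lemma norm_F_le_1: "cmod (fourier \<mu> \<xi>) \<le> 1"
  by (rule norm_fourier_le_1[OF prob])

lemma fourier_sq_le_partial_product:
  assumes "J \<subseteq> {1..n}"
  shows "(cmod (fourier \<mu> \<xi>))\<^sup>2 \<le> (\<Prod>k\<in>J. (cmod (digit_mask D ((N ^^ k) \<xi>)))\<^sup>2)"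
proof -
  have le1: "(cmod (digit_mask D x))\<^sup>2 \<le> 1" for x
    using norm_digit_mask_le_1[of D x] by (simp add: power_le_one)
  have fin: "finite J" using assms finite_subset by blast
  have "(cmod (fourier \<mu> \<xi>))\<^sup>2 \<le> (\<Prod>k\<in>{1..n}. (cmod (digit_mask D ((N ^^ k) \<xi>)))\<^sup>2) * 1"
    unfolding fourier_sq_product[of \<xi> n] using norm_F_le_1
    by (intro mult_left_mono prod_nonneg) (auto simp: power_le_one)
  also have "\<dots> = (\<Prod>k\<in>J. (cmod (digit_mask D ((N ^^ k) \<xi>)))\<^sup>2) *
      (\<Prod>k\<in>{1..n} - J. (cmod (digit_mask D ((N ^^ k) \<xi>)))\<^sup>2)"
    using assms by (simp add: prod.subset_diff mult.commute)
  also have "\<dots> \<le> (\<Prod>k\<in>J. (cmod (digit_mask D ((N ^^ k) \<xi>)))\<^sup>2) * 1"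
    using le1 by (intro mult_left_mono prod_le_1 prod_nonneg) auto
  finally show ?thesis by simp
qed

lemma p_ge_2: "2 \<le> p"
  using prime_p prime_ge_2_nat by blast

lemma generic_frequency:
  assumes "0 < \<epsilon>"
  shows "\<exists>\<eta>. \<bar>u \<eta>\<bar> \<le> \<epsilon> \<and> fourier \<mu> \<eta> \<noteq> 0 \<and>
    (\<forall>k. cmod (digit_mask D ((N ^^ k) \<eta>)) < 1) \<and> (\<forall>k. cmod (fourier \<mu> ((N ^^ k) \<eta>)) < 1)"
proof -
  have "(\<lambda>\<tau>. fourier \<mu> (\<tau> *\<^sub>R v)) \<midarrow>0\<rightarrow> fourier \<mu> 0"
  proof (rule isCont_tendsto_compose[OF isCont_fourier[OF prob sets]])
    have "(\<lambda>\<tau>. \<tau> *\<^sub>R v) \<midarrow>0\<rightarrow> 0 *\<^sub>R v" by (intro tendsto_intros)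
    then show "(\<lambda>\<tau>. \<tau> *\<^sub>R v) \<midarrow>0\<rightarrow> 0" by simp
  qed
  then have "eventually (\<lambda>\<tau>. fourier \<mu> (\<tau> *\<^sub>R v) \<noteq> 0) (at 0)"
    by (rule tendsto_imp_eventually_ne) (simp add: fourier_0[OF prob])
  then obtain d where d: "d > 0" "\<And>\<tau>. \<tau> \<noteq> 0 \<Longrightarrow> \<bar>\<tau>\<bar> < d \<Longrightarrow> fourier \<mu> (\<tau> *\<^sub>R v) \<noteq> 0"
    by (auto simp: eventually_at dist_real_def)
  define \<tau> where "\<tau> = min (min (d / 2) \<epsilon>) (1 / (2 * \<bar>\<delta>\<bar>))"
  have \<tau>: "\<tau> > 0" "\<tau> < d" "\<tau> \<le> \<epsilon>" "\<tau> \<le> 1 / (2 * \<bar>\<delta>\<bar>)"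
    using d(1) assms \<delta> by (auto simp: \<tau>_def)
  have mask: "cmod (digit_mask D ((N ^^ k) (\<tau> *\<^sub>R v))) < 1" for k
  proof (rule le_less_trans[OF mask_bound cos_bound_less_1])
    have eq: "\<bar>\<delta> * u ((N ^^ k) (\<tau> *\<^sub>R v))\<bar> = \<rho> ^ k * (\<bar>\<delta>\<bar> * \<tau>)"
      using \<rho> \<tau> by (simp add: u_funpow_N u_v abs_mult)
    have "\<bar>\<delta>\<bar> * \<tau> \<le> 1/2" using \<tau>(4) \<delta> by (simp add: field_simps)
    moreover have "\<rho> ^ k \<le> 1" using \<rho> by (simp add: power_le_one)
    ultimately have "\<rho> ^ k * (\<bar>\<delta>\<bar> * \<tau>) \<le> 1 * (1/2)" using \<rho> \<tau> by (intro mult_mono) auto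
    then show "\<bar>\<delta> * u ((N ^^ k) (\<tau> *\<^sub>R v))\<bar> < 1" using eq by simp
    show "0 < \<bar>\<delta> * u ((N ^^ k) (\<tau> *\<^sub>R v))\<bar>"
      unfolding eq using \<rho> \<tau> \<delta> by (intro mult_pos_pos) auto
  qed (use p_ge_2 in simp)
  have "cmod (fourier \<mu> ((N ^^ k) (\<tau> *\<^sub>R v))) < 1" for k
  proof -
    have "cmod (fourier \<mu> ((N ^^ k) (\<tau> *\<^sub>R v))) \<le> cmod (digit_mask D ((N ^^ Suc k) (\<tau> *\<^sub>R v))) * 1"
      unfolding refinement[of "(N ^^ k) (\<tau> *\<^sub>R v)"] norm_mult
      using norm_F_le_1 by (intro mult_mono) auto
    then show ?thesis using mask[of "Suc k"] by simp
  qed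
  then show ?thesis using mask d(2)[of \<tau>] \<tau> by (intro exI[of _ "\<tau> *\<^sub>R v"]) (simp add: u_v)
qed

text \<open>
  Otherwise the product over all levels but \<open>k0\<close> still separates the points of \<open>\<Lambda>\<close>, so its squares
  obey Bessel's inequality. Restoring the factor at level \<open>k0\<close> lowers the term of
  \<open>\<kappa>0\<close> by a definite amount, independent of the finite subset considered, and
  Parseval's identity fails at \<open>\<xi>\<close>.
\<close>

lemma pair_at_single_level:
  assumes "is_spectrum \<mu> \<Lambda>" "k0 \<ge> 1"
  shows "\<exists>x\<in>\<Lambda>. \<exists>y\<in>\<Lambda>. x \<noteq> y \<and> (\<forall>k\<ge>1. digit_mask D ((N ^^ k) (x - y)) = 0 \<longrightarrow> k = k0)"
proof (rule ccontr)
  assume "\<not> ?thesis"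
  then have "\<forall>x y. \<exists>k. x \<in> \<Lambda> \<longrightarrow> y \<in> \<Lambda> \<longrightarrow> x \<noteq> y \<longrightarrow> k \<ge> 1 \<and> k \<noteq> k0 \<and> digit_mask D ((N ^^ k) (x - y)) = 0"
    by blast
  obtain lv where lv: "\<And>x y. x \<in> \<Lambda> \<Longrightarrow> y \<in> \<Lambda> \<Longrightarrow> x \<noteq> y \<Longrightarrow>
      lv x y \<ge> 1 \<and> lv x y \<noteq> k0 \<and> digit_mask D ((N ^^ lv x y) (x - y)) = 0"
    using \<open>\<forall>x y. \<exists>k. x \<in> \<Lambda> \<longrightarrow> y \<in> \<Lambda> \<longrightarrow> x \<noteq> y \<longrightarrow> k \<ge> 1 \<and> k \<noteq> k0 \<and> digit_mask D ((N ^^ k) (x - y)) = 0\<close>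
    by metis
  obtain I0 where "I0 \<subseteq> \<Lambda>" "1 - 1/2 < (\<Sum>\<kappa>\<in>I0. (cmod (fourier \<mu> (0 - \<kappa>)))\<^sup>2)"
    using spectrum_parseval[OF prob sets assms(1), of "1/2" 0] by auto
  then have "I0 \<noteq> {}" by auto
  then obtain \<kappa>0 where \<kappa>0: "\<kappa>0 \<in> \<Lambda>" using \<open>I0 \<subseteq> \<Lambda>\<close> by blast
  obtain \<eta> where "\<bar>u \<eta>\<bar> \<le> 1" and \<eta>: "fourier \<mu> \<eta> \<noteq> 0"
    "\<And>k. cmod (digit_mask D ((N ^^ k) \<eta>)) < 1" "\<And>k. cmod (fourier \<mu> ((N ^^ k) \<eta>)) < 1"
    using generic_frequency[OF zero_less_one] by blast
  define \<xi> where "\<xi> = \<kappa>0 + \<eta>"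
  define c where "c = (cmod (digit_mask D ((N ^^ k0) \<eta>)))\<^sup>2"
  have c: "c < 1" using \<eta>(2)[of k0] by (simp add: c_def power_less_one_iff)
  define \<epsilon> where "\<epsilon> = (1 - c) * (cmod (fourier \<mu> \<eta>))\<^sup>2"
  have "\<epsilon> > 0" using c \<eta> by (simp add: \<epsilon>_def)
  then obtain I1 where I1: "finite I1" "I1 \<subseteq> \<Lambda>" "1 - \<epsilon> < (\<Sum>\<kappa>\<in>I1. (cmod (fourier \<mu> (\<xi> - \<kappa>)))\<^sup>2)"
    using spectrum_parseval[OF prob sets assms(1)] by metis
  define I where "I = insert \<kappa>0 I1"
  have I: "finite I" "I \<subseteq> \<Lambda>" "\<kappa>0 \<in> I" using I1 \<kappa>0 by (auto simp: I_def)
  have "1 - \<epsilon> < (\<Sum>\<kappa>\<in>I. (cmod (fourier \<mu> (\<xi> - \<kappa>)))\<^sup>2)"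
    by (rule less_le_trans[OF I1(3)]) (use I in \<open>auto simp: I_def intro!: sum_mono2\<close>)
  moreover have "(\<Sum>\<kappa>\<in>I. (cmod (fourier \<mu> (\<xi> - \<kappa>)))\<^sup>2) \<le> 1 - \<epsilon>"
  proof -
    \<comment> \<open>All chosen levels of pairs from \<open>I\<close>, and \<open>k0\<close> itself, are at most \<open>n\<close>.\<close>
    define n where "n = Max (insert k0 ((\<lambda>(x, y). lv x y) ` (I \<times> I)))"
    have n: "k0 \<le> n" "\<And>x y. x \<in> I \<Longrightarrow> y \<in> I \<Longrightarrow> lv x y \<le> n"
      using I(1) unfolding n_def by (auto intro!: Max_ge)
    define J where "J = {1..n} - {k0}"
    define g where "g \<kappa> = (\<Prod>k\<in>J. (cmod (digit_mask D ((N ^^ k) (\<xi> - \<kappa>))))\<^sup>2)" for \<kappa>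
    have "sum g I \<le> 1"
      unfolding g_def
    proof (rule finite_level_bessel[OF finite_D D_ne _ I(1) funpow_N_diff])
      show "finite J" by (simp add: J_def)
      fix \<kappa> \<kappa>' assume "\<kappa> \<in> I" "\<kappa>' \<in> I" "\<kappa> \<noteq> \<kappa>'"
      then show "\<exists>k\<in>J. digit_mask D ((N ^^ k) (\<kappa> - \<kappa>')) = 0"
        using lv[of \<kappa> \<kappa>'] n(2) I(2) by (intro bexI[of _ "lv \<kappa> \<kappa>'"]) (auto simp: J_def)
    qed
    moreover have "(cmod (fourier \<mu> (\<xi> - \<kappa>)))\<^sup>2 \<le> g \<kappa>" for \<kappa>
      unfolding g_def by (rule fourier_sq_le_partial_product[of _ n]) (auto simp: J_def)
    moreover have "(cmod (fourier \<mu> (\<xi> - \<kappa>0)))\<^sup>2 \<le> c * g \<kappa>0"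
    proof -
      have "(cmod (fourier \<mu> (\<xi> - \<kappa>0)))\<^sup>2 \<le> (\<Prod>k\<in>{1..n}. (cmod (digit_mask D ((N ^^ k) (\<xi> - \<kappa>0))))\<^sup>2)"
        by (rule fourier_sq_le_partial_product[of _ n]) simp
      also have "\<dots> = c * g \<kappa>0"
        using assms(2) n(1) by (subst prod.remove[of _ k0]) (auto simp: g_def J_def c_def \<xi>_def)
      finally show ?thesis .
    qed
    ultimately show ?thesis
      using sum_le_one_minus_loss[of I \<kappa>0 "\<lambda>\<kappa>. (cmod (fourier \<mu> (\<xi> - \<kappa>)))\<^sup>2" g c] I c
      by (simp add: \<epsilon>_def \<xi>_def)
  qed
  ultimately show False by simp
qed


lemma mask_zero_iterate:
  assumes "digit_mask D ((N ^^ k) (x - y)) = 0"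
  shows "\<exists>w. \<not> int p dvd w \<and> real p * u x - real p * u y = (1 / \<rho>) ^ k * of_int w"
proof -
  obtain w where w: "\<not> int p dvd w" "real p * (\<rho> ^ k * u (x - y)) = of_int w"
    using mask_zero[OF assms] by (auto simp: u_funpow_N)
  have "real p * u x - real p * u y = (1 / \<rho>) ^ k * of_int w"
    unfolding w(2)[symmetric] using \<rho> by (simp add: u_diff power_divide right_diff_distrib)
  then show ?thesis using w(1) by blast
qed

lemma orthogonal_imp_mask_zero:
  assumes "is_spectrum \<mu> \<Lambda>" "x \<in> \<Lambda>" "y \<in> \<Lambda>" "x \<noteq> y"
  shows "\<exists>k\<ge>1. digit_mask D ((N ^^ k) (x - y)) = 0"
  by (rule fourier_zero_imp_mask_zero[OF spectrum_orthogonal[OF assms]])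

lemma u_neq:
  assumes "is_spectrum \<mu> \<Lambda>" "x \<in> \<Lambda>" "y \<in> \<Lambda>" "x \<noteq> y"
  shows "u x \<noteq> u y"
proof
  assume eq: "u x = u y"
  obtain k w where "\<not> int p dvd w" "real p * u x - real p * u y = (1 / \<rho>) ^ k * of_int w"
    using orthogonal_imp_mask_zero[OF assms] mask_zero_iterate by blast
  then show False using eq \<rho> by auto
qed

lemma infinite_spectrum:
  assumes "is_spectrum \<mu> \<Lambda>"
  shows "infinite \<Lambda>"
proof
  assume fin: "finite \<Lambda>"
  define single where "single k z \<longleftrightarrow> z \<in> \<Lambda> \<times> \<Lambda> \<and> fst z \<noteq> snd z \<and>
     (\<forall>k'\<ge>1. digit_mask D ((N ^^ k') (fst z - snd z)) = 0 \<longrightarrow> k' = k)" for k z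
  have "\<forall>k. \<exists>z. k \<ge> 1 \<longrightarrow> single k z"
  proof
    fix k :: nat
    show "\<exists>z. k \<ge> 1 \<longrightarrow> single k z"
    proof (cases "k \<ge> 1")
      case True
      then obtain x y where "x \<in> \<Lambda>" "y \<in> \<Lambda>" "x \<noteq> y"
        "\<forall>k'\<ge>1. digit_mask D ((N ^^ k') (x - y)) = 0 \<longrightarrow> k' = k"
        using pair_at_single_level[OF assms True] by blast
      then have "single k (x, y)" by (simp add: single_def)
      then show ?thesis by blast
    qed blast
  qed
  from choice[OF this] obtain f where f: "\<forall>k. k \<ge> 1 \<longrightarrow> single k (f k)" ..
  have "inj_on f {1..}"
  proof (rule inj_onI)
    fix i j :: nat assume ij: "i \<in> {1..}" "j \<in> {1..}" "f i = f j"
    have si: "single i (f i)" "single j (f i)" using f ij by auto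
    then have "\<exists>k\<ge>1. digit_mask D ((N ^^ k) (fst (f i) - snd (f i))) = 0"
      by (intro orthogonal_imp_mask_zero[OF assms]) (auto simp: single_def mem_Times_iff)
    then show "i = j" using si unfolding single_def by metis
  qed
  moreover have "f ` {1..} \<subseteq> \<Lambda> \<times> \<Lambda>" using f by (auto simp: single_def)
  ultimately have "finite {1::nat..}"
    using fin by (meson finite_SigmaI finite_imageD finite_subset)
  then show False by (simp add: infinite_Ici)
qed

lemma spectrum_level_set:
  assumes "is_spectrum \<mu> \<Lambda>"
  shows "level_set (int p) (1 / \<rho>) ((\<lambda>x. real p * u x) ` \<Lambda>)"
proof
  show "prime (int p)" using prime_p by simp
  show "1 < 1 / \<rho>" using \<rho> by simp
  have p0: "real p \<noteq> 0" using p_ge_2 by simp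
  show "\<exists>k\<ge>1. \<exists>w. \<not> int p dvd w \<and> x - y = (1 / \<rho>) ^ k * of_int w"
    if "x \<in> (\<lambda>x. real p * u x) ` \<Lambda>" "y \<in> (\<lambda>x. real p * u x) ` \<Lambda>" "x \<noteq> y" for x y
    using that orthogonal_imp_mask_zero[OF assms] mask_zero_iterate by blast
  show "\<exists>x\<in>(\<lambda>x. real p * u x) ` \<Lambda>. \<exists>y\<in>(\<lambda>x. real p * u x) ` \<Lambda>. x \<noteq> y \<and>
      (\<exists>w. \<not> int p dvd w \<and> x - y = (1 / \<rho>) ^ k * of_int w)" if k: "k \<ge> 1" for k
  proof -
    obtain x y where xy: "x \<in> \<Lambda>" "y \<in> \<Lambda>" "x \<noteq> y"
      "\<forall>k'\<ge>1. digit_mask D ((N ^^ k') (x - y)) = 0 \<longrightarrow> k' = k"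
      using pair_at_single_level[OF assms k] by blast
    then have "digit_mask D ((N ^^ k) (x - y)) = 0"
      using orthogonal_imp_mask_zero[OF assms xy(1-3)] by blast
    then show ?thesis using mask_zero_iterate u_neq[OF assms xy(1-3)] xy p0
      by (intro bexI[of _ "real p * u x"] bexI[of _ "real p * u y"]) auto
  qed
  have "inj_on (\<lambda>x. real p * u x) \<Lambda>"
    using u_neq[OF assms] p0 by (auto simp: inj_on_def)
  then show "infinite ((\<lambda>x. real p * u x) ` \<Lambda>)"
    using infinite_spectrum[OF assms] finite_imageD by blast
qed

lemma log_decay_fourier:
  assumes "coprime s t" "1 < t" "t < s" "s \<le> t ^ A" "1 \<le> A" "\<rho> = real t / real s"
  shows "log_decay p s t A (\<lambda>\<xi>. cmod (fourier \<mu> \<xi>)) (\<lambda>\<xi>. \<delta> * u \<xi>) N"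
proof
  show "cmod (fourier \<mu> \<xi>) \<le> cos_bound p (\<delta> * u (N \<xi>)) * cmod (fourier \<mu> (N \<xi>))" for \<xi>
    by (subst refinement) (simp add: norm_mult mult_right_mono mask_bound)
qed (use assms p_ge_2 norm_F_le_1 in \<open>auto simp: u_N\<close>)

text \<open>
  Passing from \<open>I\<close> to the larger index set \<open>I'\<close>, the sum of \<open>f = g h\<close> can recover at most the fraction
  \<open>\<beta>\<close> of its defect \<open>1 - sum f I\<close>, since \<open>g\<close> has total mass at most 1 and dominates \<open>f\<close> on \<open>I\<close>.
\<close>

lemma window_step:
  fixes f g h :: "'b \<Rightarrow> real"
  assumes "finite I'" "I \<subseteq> I'" "\<And>j. j \<in> I' \<Longrightarrow> f j = g j * h j" "\<And>j. j \<in> I' \<Longrightarrow> 0 \<le> g j"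
    "\<And>j. j \<in> I' \<Longrightarrow> h j \<le> 1" "\<And>j. j \<in> I' - I \<Longrightarrow> h j \<le> \<beta>" "0 \<le> \<beta>" "sum g I' \<le> 1"
  shows "(1 - sum f I) * (1 - \<beta>) \<le> 1 - sum f I'"
proof -
  have f_le: "f j \<le> g j" if "j \<in> I'" for j
    using assms(3,4,5)[OF that] by (simp add: mult_left_le)
  have "sum f I' = sum f I + sum f (I' - I)"
    using assms(1,2) by (metis add.commute sum.subset_diff)
  also have "sum f (I' - I) \<le> (\<Sum>j\<in>I' - I. \<beta> * g j)"
    using assms by (intro sum_mono) (auto simp: mult.commute[of \<beta>] mult_left_mono)
  also have "\<dots> = \<beta> * (sum g I' - sum g I)"
    using assms(1,2) by (simp add: sum_diff finite_subset flip: sum_distrib_left)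
  also have "\<dots> \<le> \<beta> * (1 - sum f I)"
  proof (intro mult_left_mono diff_mono)
    show "sum f I \<le> sum g I" using f_le assms(2) by (intro sum_mono) auto
  qed (use assms in auto)
  finally show ?thesis by (simp add: algebra_simps)
qed

text \<open>
  The window \<open>W n\<close> consists of the points whose difference to \<open>\<kappa>0\<close> is below \<open>s^n\<close> in the scale
  of the gaps. Its points have pairwise levels at most \<open>n\<close>, so the partial products up to \<open>n\<close>
  obey Bessel's inequality on it. For a point outside \<open>W n\<close>, the remaining factor at level
  \<open>n + m\<close> with \<open>2 A m \<le> n\<close> is evaluated at first coordinate at least \<open>s^n \<rho>^(n+m) \<ge> s^m\<close> up to
  constants, which tends to infinity only because \<open>t > 1\<close>. By logarithmic decay it is at most
  \<open>\<beta>^j\<close> for \<open>m = m(j) = C (2A)^j\<close>. The \<open>j\<close>-th block of windows leads from \<open>2A m(j)\<close> to \<open>2A m(j+1)\<close>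
  in the constant number \<open>B\<close> of steps of length \<open>m(j)\<close>, so that the total loss over all blocks is a geometric
  series, which is at most 1/2 if the blocks start at a large \<open>j0\<close>.
\<close>

lemma not_spectrum_if_fractional_ratio:
  assumes spec: "is_spectrum \<mu> \<Lambda>" and st: "coprime s t" "1 < t" "t < s" "\<rho> = real t / real s"
    and gaps: "\<And>x y k. x \<in> \<Lambda> \<Longrightarrow> y \<in> \<Lambda> \<Longrightarrow> k \<ge> 1 \<Longrightarrow> digit_mask D ((N ^^ k) (x - y)) = 0 \<Longrightarrow>
        real s ^ (k - 1) / \<rho> \<le> real p * \<bar>u x - u y\<bar>"
  shows False
proof -
  have p0: "real p \<ge> 2" using p_ge_2 by simp
  have s1: "real s > 1" and t1: "real t > 1" using st by auto
  obtain A0 where "real s < real t ^ A0" using real_arch_pow[OF t1] by blast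
  moreover have "A0 \<noteq> 0" using \<open>real s < real t ^ A0\<close> s1 by (intro notI) simp
  ultimately obtain A where A: "s \<le> t ^ A" "1 \<le> A"
    by (metis less_imp_le_nat less_one not_le of_nat_less_iff of_nat_power)
  interpret decay: log_decay p s t A "\<lambda>\<xi>. cmod (fourier \<mu> \<xi>)" "\<lambda>\<xi>. \<delta> * u \<xi>" N
    using log_decay_fourier[OF st(1-3) A st(4)] .
  define \<beta> where "\<beta> = decay.rate"
  have \<beta>: "0 \<le> \<beta>" "\<beta> < 1" using decay.rate by (auto simp: \<beta>_def)
  define Y where "Y = real (2 * s\<^sup>2)"
  have "1 * 1 \<le> real s * real s" using s1 by (intro mult_mono) auto
  then have Y1: "Y \<ge> 1" by (simp add: Y_def power2_eq_square)
  define Q where "Q = 2 * A"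
  have Q: "Q \<ge> 2" using A by (simp add: Q_def)
  \<comment> \<open>\<open>C\<close> absorbs the constant lost when first coordinates are compared with the window radius.\<close>
  obtain C where C: "4 * real p * Y \<le> real s ^ C"
    using real_arch_pow[OF s1] less_imp_le by blast
  define m where "m j = C * Q ^ j" for j
  have growth: "Y ^ (Q ^ j) \<le> real s ^ m j / (4 * real p)" for j
  proof -
    have "1 \<le> Q ^ j" using Q by simp
    then have "4 * real p \<le> (4 * real p) ^ (Q ^ j)" using p0 Q by (intro self_le_power) auto
    then have "4 * real p * Y ^ (Q ^ j) \<le> (4 * real p) ^ (Q ^ j) * Y ^ (Q ^ j)"
      using Y1 by (intro mult_right_mono) auto
    also have "\<dots> = (4 * real p * Y) ^ (Q ^ j)" by (simp add: power_mult_distrib)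
    also have "\<dots> \<le> (real s ^ C) ^ (Q ^ j)" using C p0 Y1 by (intro power_mono) auto
    also have "\<dots> = real s ^ m j" by (simp add: m_def power_mult)
    finally show ?thesis using p0 by (simp add: field_simps)
  qed
  define B where "B = (Q - 1) * Q"
  obtain j0 where j0: "real B * \<beta> ^ j0 \<le> (1 - \<beta>) / 2"
  proof -
    have "(\<lambda>j. real B * \<beta> ^ j) \<longlonglongrightarrow> real B * 0"
      using \<beta> by (intro tendsto_intros LIMSEQ_power_zero) auto
    then have "eventually (\<lambda>j. real B * \<beta> ^ j < (1 - \<beta>) / 2) sequentially"
      using \<beta> by (intro order_tendstoD) auto
    then show ?thesis using that by (auto simp: eventually_sequentially intro: less_imp_le)
  qed
  obtain I0 where "I0 \<subseteq> \<Lambda>" "1 - 1/2 < (\<Sum>\<kappa>\<in>I0. (cmod (fourier \<mu> (0 - \<kappa>)))\<^sup>2)"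
    using spectrum_parseval[OF prob sets spec, of "1/2" 0] by auto
  then have "I0 \<noteq> {}" by auto
  then obtain \<kappa>0 where \<kappa>0: "\<kappa>0 \<in> \<Lambda>" using \<open>I0 \<subseteq> \<Lambda>\<close> by blast
  \<comment> \<open>The bound on \<open>u \<eta>\<close> keeps \<open>\<xi>\<close> at least half a window radius away from far points.\<close>
  obtain \<eta> where u\<eta>: "\<bar>u \<eta>\<bar> \<le> 1 / (4 * real p)" and \<eta>: "fourier \<mu> \<eta> \<noteq> 0"
    "\<And>k. cmod (digit_mask D ((N ^^ k) \<eta>)) < 1" "\<And>k. cmod (fourier \<mu> ((N ^^ k) \<eta>)) < 1"
    using generic_frequency[of "1 / (4 * real p)"] p0 by auto
  define \<xi> where "\<xi> = \<kappa>0 + \<eta>"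
  define near where "near n \<kappa> \<longleftrightarrow> 2 * real p * \<bar>u \<kappa> - u \<kappa>0\<bar> < real s ^ n / \<rho>" for n \<kappa>
  have near_mono: "near n' \<kappa>" if "near n \<kappa>" "n \<le> n'" for n n' \<kappa>
  proof -
    have "real s ^ n / \<rho> \<le> real s ^ n' / \<rho>"
      using that(2) s1 \<rho> by (intro divide_right_mono power_increasing) auto
    then show ?thesis using that(1) unfolding near_def by linarith
  qed
  have near_level: "k \<le> n" if "near n x" "near n y" "x \<in> \<Lambda>" "y \<in> \<Lambda>" "k \<ge> 1"
    "digit_mask D ((N ^^ k) (x - y)) = 0" for n x y k
  proof -
    have "\<bar>u x - u y\<bar> \<le> \<bar>u x - u \<kappa>0\<bar> + \<bar>u y - u \<kappa>0\<bar>" by linarith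
    then have "real p * \<bar>u x - u y\<bar> \<le> real p * (\<bar>u x - u \<kappa>0\<bar> + \<bar>u y - u \<kappa>0\<bar>)"
      by (intro mult_left_mono) auto
    then have "real p * \<bar>u x - u y\<bar> < real s ^ n / \<rho>"
      using that(1,2) unfolding near_def by (simp add: distrib_left)
    then have "real s ^ (k - 1) / \<rho> < real s ^ n / \<rho>" using gaps that(3-6) by fastforce
    then have "real s ^ (k - 1) < real s ^ n" using \<rho> by (simp add: divide_less_cancel)
    then have "k - 1 < n" using s1 by (simp add: power_strict_increasing_iff)
    then show ?thesis by simp
  qed
  define g where "g n \<kappa> = (\<Prod>k\<in>{1..n}. (cmod (digit_mask D ((N ^^ k) (\<xi> - \<kappa>))))\<^sup>2)" for n \<kappa>
  define f where "f \<kappa> = (cmod (fourier \<mu> (\<xi> - \<kappa>)))\<^sup>2" for \<kappa>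
  have g_sum: "sum (g n) I \<le> 1" if I: "finite I" "I \<subseteq> \<Lambda>" "\<And>\<kappa>. \<kappa> \<in> I \<Longrightarrow> near n \<kappa>" for n I
    unfolding g_def
  proof (rule finite_level_bessel[OF finite_D D_ne _ I(1) funpow_N_diff])
    fix x y assume xy: "x \<in> I" "y \<in> I" "x \<noteq> y"
    then obtain k where k: "k \<ge> 1" "digit_mask D ((N ^^ k) (x - y)) = 0"
      using orthogonal_imp_mask_zero[OF spec] I(2) by blast
    have "x \<in> \<Lambda>" "y \<in> \<Lambda>" using xy I(2) by auto
    then have "k \<le> n" using near_level[of n x y k] xy I(3) k by simp
    then show "\<exists>k\<in>{1..n}. digit_mask D ((N ^^ k) (x - y)) = 0" using k by auto
  qed simp
  have far_small: "(cmod (fourier \<mu> ((N ^^ (n + m j)) (\<xi> - \<kappa>))))\<^sup>2 \<le> \<beta> ^ j"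
    if "\<not> near n \<kappa>" "Q * m j \<le> n" for n j \<kappa>
  proof -
    have "real s ^ n / \<rho> \<le> 2 * real p * \<bar>u \<kappa> - u \<kappa>0\<bar>" using that(1) by (simp add: near_def)
    moreover have "real s ^ n \<le> real s ^ n / \<rho>" using \<rho> s1 by (simp add: le_divide_eq)
    moreover have "2 * real p * \<bar>u \<eta>\<bar> \<le> 1/2" using u\<eta> p0 by (simp add: field_simps)
    moreover have "\<bar>u (\<xi> - \<kappa>)\<bar> \<ge> \<bar>u \<kappa> - u \<kappa>0\<bar> - \<bar>u \<eta>\<bar>"
      using u_diff[of \<xi> \<kappa>] u_diff[of \<xi> \<eta>] by (simp add: \<xi>_def)
    moreover have "2 * real p * \<bar>u (\<xi> - \<kappa>)\<bar> \<ge> 2 * real p * (\<bar>u \<kappa> - u \<kappa>0\<bar> - \<bar>u \<eta>\<bar>)"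
      using calculation(4) by (intro mult_left_mono) auto
    moreover have "1 \<le> real s ^ n" using s1 by simp
    ultimately have "real s ^ n / 2 \<le> 2 * real p * \<bar>u (\<xi> - \<kappa>)\<bar>"
      by (simp add: right_diff_distrib)
    then have u1: "real s ^ n / (4 * real p) \<le> \<bar>u (\<xi> - \<kappa>)\<bar>" using p0 by (simp add: field_simps)
    have Am: "A * m j + m j \<le> n + m j" "A * m j + A * m j \<le> n" using that(2) by (auto simp: Q_def)
    have "real s ^ m j \<le> (real t ^ A) ^ m j"
      using A(1) by (intro power_mono) (metis of_nat_le_iff of_nat_power, simp)
    also have "\<dots> = real t ^ (A * m j)" by (simp add: power_mult)
    finally have "real s ^ m j * real s ^ m j \<le> real t ^ (A * m j) * real t ^ (A * m j)"
      using s1 by (intro mult_mono) auto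
    also have "\<dots> \<le> real t ^ (n + m j)"
      unfolding power_add[symmetric] using t1 Am by (intro power_increasing) auto
    finally have "real s ^ m j * real s ^ m j * real s ^ n \<le> real t ^ (n + m j) * real s ^ n"
      using s1 by (intro mult_right_mono) auto
    then have "real s ^ m j \<le> \<rho> ^ (n + m j) * real s ^ n"
      using s1 by (simp add: st(4) power_divide field_simps power_add)
    then have "real s ^ m j / (4 * real p) \<le> \<rho> ^ (n + m j) * (real s ^ n / (4 * real p))"
      using p0 by (simp add: divide_right_mono)
    also have "\<dots> \<le> \<rho> ^ (n + m j) * \<bar>u (\<xi> - \<kappa>)\<bar>" using u1 \<rho> by (intro mult_left_mono) auto
    also have "\<dots> = \<bar>u ((N ^^ (n + m j)) (\<xi> - \<kappa>))\<bar>" using \<rho> by (simp only: u_funpow_N abs_mult) simp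
    also have "\<dots> \<le> \<bar>\<delta> * u ((N ^^ (n + m j)) (\<xi> - \<kappa>))\<bar>"
      using mult_right_mono[OF \<delta>, of "\<bar>u ((N ^^ (n + m j)) (\<xi> - \<kappa>))\<bar>"] by (simp add: abs_mult)
    finally have "Y ^ (Q ^ j) \<le> \<bar>\<delta> * u ((N ^^ (n + m j)) (\<xi> - \<kappa>))\<bar>" using growth[of j] by simp
    then have "cmod (fourier \<mu> ((N ^^ (n + m j)) (\<xi> - \<kappa>))) \<le> \<beta> ^ j"
      unfolding \<beta>_def by (intro decay.decay) (simp add: Y_def Q_def)
    moreover have "(cmod (fourier \<mu> ((N ^^ (n + m j)) (\<xi> - \<kappa>))))\<^sup>2 \<le> cmod (fourier \<mu> ((N ^^ (n + m j)) (\<xi> - \<kappa>)))"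
      unfolding power2_eq_square using norm_F_le_1 by (intro mult_left_le) auto
    ultimately show ?thesis by linarith
  qed
  define n0 where "n0 = Q * m j0"
  \<comment> \<open>The defect at the first window is at least \<open>\<epsilon>\<close>, whatever the finite subset \<open>I\<close> is; this is
    what makes the final contradiction possible.\<close>
  define \<epsilon> where "\<epsilon> = (1 - (cmod (fourier \<mu> ((N ^^ n0) \<eta>)))\<^sup>2) * (cmod (fourier \<mu> \<eta>))\<^sup>2"
  have "\<epsilon> > 0" using \<eta> by (simp add: \<epsilon>_def power_less_one_iff)
  then obtain I1 where I1: "finite I1" "I1 \<subseteq> \<Lambda>" "1 - \<epsilon> / 2 < sum f I1"
    unfolding f_def using spectrum_parseval[OF prob sets spec, of "\<epsilon> / 2"] by (metis half_gt_zero)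
  define I where "I = insert \<kappa>0 I1"
  have I: "finite I" "I \<subseteq> \<Lambda>" "\<kappa>0 \<in> I" using I1 \<kappa>0 by (auto simp: I_def)
  have big: "1 - \<epsilon> / 2 < sum f I"
    by (rule less_le_trans[OF I1(3)]) (use I in \<open>auto simp: I_def f_def intro!: sum_mono2\<close>)
  define W where "W n = {\<kappa>\<in>I. near n \<kappa>}" for n
  define a where "a n = 1 - sum f (W n)" for n
  have W: "finite (W n)" "W n \<subseteq> \<Lambda>" "\<kappa>0 \<in> W n" for n
    using I \<rho> s1 by (auto simp: W_def near_def)
  have f_eq: "f \<kappa> = g n \<kappa> * (cmod (fourier \<mu> ((N ^^ n) (\<xi> - \<kappa>))))\<^sup>2" for n \<kappa>
    unfolding f_def g_def by (rule fourier_sq_product)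
  have a_anti: "a n' \<le> a n" if "n \<le> n'" for n n'
    unfolding a_def using W that near_mono by (intro diff_left_mono sum_mono2) (auto simp: W_def f_def)
  have start: "\<epsilon> \<le> a n0"
  proof -
    have "sum f (W n0) \<le> 1 - (1 - (cmod (fourier \<mu> ((N ^^ n0) \<eta>)))\<^sup>2) * f \<kappa>0"
    proof (rule sum_le_one_minus_loss[of _ _ f "g n0"])
      show "f \<kappa> \<le> g n0 \<kappa>" for \<kappa>
        unfolding f_def g_def by (rule fourier_sq_le_partial_product[OF order_refl])
      show "f \<kappa>0 \<le> (cmod (fourier \<mu> ((N ^^ n0) \<eta>)))\<^sup>2 * g n0 \<kappa>0"
        using f_eq[of \<kappa>0 n0] by (simp add: \<xi>_def)
      show "sum (g n0) (W n0) \<le> 1" using W by (intro g_sum) (auto simp: W_def)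
    qed (use W norm_F_le_1 in \<open>auto simp: power_le_one\<close>)
    then show ?thesis by (simp add: a_def \<epsilon>_def f_def \<xi>_def)
  qed
  have step: "a n * (1 - \<beta> ^ j) \<le> a (n + m j)" if "Q * m j \<le> n" for n j
    unfolding a_def
  proof (rule window_step[where g = "g (n + m j)" and h = "\<lambda>\<kappa>. (cmod (fourier \<mu> ((N ^^ (n + m j)) (\<xi> - \<kappa>))))\<^sup>2"])
    show "W n \<subseteq> W (n + m j)" using near_mono by (auto simp: W_def)
    show "sum (g (n + m j)) (W (n + m j)) \<le> 1" using W by (intro g_sum) (auto simp: W_def)
    show "(cmod (fourier \<mu> ((N ^^ (n + m j)) (\<xi> - \<kappa>))))\<^sup>2 \<le> \<beta> ^ j" if "\<kappa> \<in> W (n + m j) - W n" for \<kappa>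
      using that \<open>Q * m j \<le> n\<close> by (intro far_small) (auto simp: W_def)
  qed (use W \<beta> norm_F_le_1 f_eq in \<open>auto simp: power_le_one g_def prod_nonneg\<close>)
  have a0: "a n \<ge> 0" for n
  proof -
    have "sum f (W n) \<le> sum (g n) (W n)"
      unfolding f_def g_def by (intro sum_mono fourier_sq_le_partial_product[OF order_refl])
    also have "\<dots> \<le> 1" using W by (intro g_sum) (auto simp: W_def)
    finally show ?thesis by (simp add: a_def)
  qed
  have steps: "a n - real i * \<beta> ^ j * a n \<le> a (n + i * m j)" if "Q * m j \<le> n" for n i j
  proof (induction i)
    case (Suc i)
    have "a (n + i * m j) * (1 - \<beta> ^ j) \<le> a (n + i * m j + m j)"
      using that by (intro step) simp
    moreover have "\<beta> ^ j * a (n + i * m j) \<le> \<beta> ^ j * a n"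
      using \<beta> by (intro mult_left_mono a_anti) auto
    ultimately show ?case using Suc by (simp add: algebra_simps)
  qed simp
  have block: "a (Q * m j) - real B * \<beta> ^ j * a (Q * m j) \<le> a (Q * m (Suc j))" for j
  proof -
    obtain q where "Q = Suc q" using Q by (metis Suc_le_D numeral_2_eq_2)
    then have "Q * m j + B * m j = Q * m (Suc j)" by (simp add: B_def m_def algebra_simps)
    then show ?thesis using steps[of j "Q * m j" B] by simp
  qed
  have m_mono: "Q * m j \<le> Q * m (j + i)" for i j
    using Q by (simp add: m_def power_increasing)
  have blocks: "a n0 - (\<Sum>k<i. real B * \<beta> ^ (j0 + k)) * a n0 \<le> a (Q * m (j0 + i))" for i
  proof (induction i)
    case 0 then show ?case by (simp add: n0_def)
  next
    case (Suc i)
    have "n0 \<le> Q * m (j0 + i)" unfolding n0_def by (rule m_mono)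
    then have "a (Q * m (j0 + i)) \<le> a n0" by (rule a_anti)
    then have "real B * \<beta> ^ (j0 + i) * a (Q * m (j0 + i)) \<le> real B * \<beta> ^ (j0 + i) * a n0"
      using \<beta> by (intro mult_left_mono) auto
    then show ?case using Suc block[of "j0 + i"] by (simp add: algebra_simps)
  qed
  have total: "(\<Sum>k<i. real B * \<beta> ^ (j0 + k)) \<le> 1/2" for i
  proof -
    have "(\<Sum>k<i. real B * \<beta> ^ (j0 + k)) = real B * \<beta> ^ j0 * (\<Sum>k<i. \<beta> ^ k)"
      by (simp add: power_add sum_distrib_left mult_ac)
    also have "(\<Sum>k<i. \<beta> ^ k) \<le> 1 / (1 - \<beta>)"
      using \<beta> by (simp add: sum_gp_strict divide_right_mono)
    then have "real B * \<beta> ^ j0 * (\<Sum>k<i. \<beta> ^ k) \<le> ((1 - \<beta>) / 2) * (1 / (1 - \<beta>))"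
      using j0 \<beta> by (intro mult_mono) (auto simp: sum_nonneg)
    also have "\<dots> = 1/2" using \<beta> by simp
    finally show ?thesis .
  qed
  have half: "\<epsilon> / 2 \<le> a (Q * m (j0 + i))" for i
  proof -
    have "(\<Sum>k<i. real B * \<beta> ^ (j0 + k)) * a n0 \<le> 1/2 * a n0"
      using total a0 by (intro mult_right_mono)
    then show ?thesis using blocks[of i] start by linarith
  qed
  obtain n1 where n1: "\<And>\<kappa>. \<kappa> \<in> I \<Longrightarrow> near n1 \<kappa>"
  proof -
    have "\<exists>n. near n \<kappa>" for \<kappa>
    proof -
      obtain n where "2 * real p * \<bar>u \<kappa> - u \<kappa>0\<bar> < real s ^ n" using real_arch_pow[OF s1] by blast
      moreover have "real s ^ n \<le> real s ^ n / \<rho>" using \<rho> s1 by (simp add: le_divide_eq)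
      ultimately show ?thesis unfolding near_def by (meson less_le_trans)
    qed
    then obtain nn where nn: "\<And>\<kappa>. near (nn \<kappa>) \<kappa>" by metis
    have "near (Max (nn ` I)) \<kappa>" if "\<kappa> \<in> I" for \<kappa>
      using near_mono[OF nn] that I(1) by simp
    then show ?thesis using that by blast
  qed
  have C0: "C \<noteq> 0"
  proof
    assume "C = 0"
    then have "4 * real p * Y \<le> 1" using C by simp
    moreover have "8 * 1 \<le> 4 * real p * Y" using p0 Y1 by (intro mult_mono) auto
    ultimately show False by simp
  qed
  have "n1 \<le> Q * m (j0 + n1)"
  proof -
    have "n1 < Q ^ n1" using Q by (intro power_gt_expt) auto
    also have "\<dots> \<le> Q ^ (j0 + n1)" using Q by (intro power_increasing) auto
    also have "\<dots> \<le> Q * (C * Q ^ (j0 + n1))" using Q C0 by simp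
    finally show ?thesis by (simp add: m_def)
  qed
  then have "W (Q * m (j0 + n1)) = I" using n1 near_mono by (auto simp: W_def)
  then have "\<epsilon> / 2 \<le> 1 - sum f I" using half[of n1] by (simp add: a_def)
  then show False using big by simp
qed

theorem ratio_multiple_of_p_if_spectrum:
  assumes spec: "is_spectrum \<mu> \<Lambda>"
  shows "1 / \<rho> \<in> int_multiples p"
proof -
  interpret level_set "int p" "1 / \<rho>" "(\<lambda>x. real p * u x) ` \<Lambda>"
    by (rule spectrum_level_set[OF spec])
  obtain s t :: int where st: "coprime s t" "0 < t" "0 < s" "int p dvd s" "1 / \<rho> = of_int s / of_int t"
    and gap: "\<And>x y k w. x \<in> (\<lambda>x. real p * u x) ` \<Lambda> \<Longrightarrow> y \<in> (\<lambda>x. real p * u x) ` \<Lambda> \<Longrightarrow> k \<ge> 1 \<Longrightarrow>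
       x - y = (1 / \<rho>) ^ k * of_int w \<Longrightarrow> \<exists>w'. x - y = 1 / \<rho> * of_int (s ^ (k - 1) * w')"
    by (rule ratio_rational) blast
  have "t = 1"
  proof (rule ccontr)
    assume "t \<noteq> 1"
    define s' t' where "s' = nat s" and "t' = nat t"
    have s't': "s = int s'" "t = int t'" using st by (auto simp: s'_def t'_def)
    have \<rho>_eq: "\<rho> = real t' / real s'" using st(2,3,5) \<rho> by (simp add: s't' field_simps)
    have "coprime s' t'" using st(1) by (simp add: s't')
    moreover have "1 < t'" using \<open>t \<noteq> 1\<close> st(2) by (simp add: s't')
    moreover have "t' < s'" using \<rho> st(2,3) by (simp add: \<rho>_eq s't' divide_less_eq split: if_splits)
    moreover have "real s' ^ (k - 1) / \<rho> \<le> real p * \<bar>u x - u y\<bar>"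
      if xy: "x \<in> \<Lambda>" "y \<in> \<Lambda>" "k \<ge> 1" "digit_mask D ((N ^^ k) (x - y)) = 0" for x y k
    proof -
      obtain w where w: "\<not> int p dvd w" "real p * u x - real p * u y = (1 / \<rho>) ^ k * of_int w"
        using mask_zero_iterate[OF xy(4)] by blast
      then obtain w' where w': "real p * u x - real p * u y = 1 / \<rho> * of_int (s ^ (k - 1) * w')"
        using gap xy(1-3) by blast
      have "real p * u x - real p * u y \<noteq> 0" using w \<rho> by auto
      then have "w' \<noteq> 0" using w' by auto
      then have "real_of_int \<bar>w'\<bar> \<ge> 1" by linarith
      then have "real s' ^ (k - 1) / \<rho> * 1 \<le> real s' ^ (k - 1) / \<rho> * real_of_int \<bar>w'\<bar>"
        using \<rho> by (intro mult_left_mono) auto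
      also have "\<dots> = \<bar>1 / \<rho> * of_int (s ^ (k - 1) * w')\<bar>"
        using \<rho> by (simp add: abs_mult s't')
      also have "\<dots> = real p * \<bar>u x - u y\<bar>"
        unfolding w'[symmetric] right_diff_distrib[symmetric] abs_mult by simp
      finally show ?thesis by simp
    qed
    ultimately show False
      using not_spectrum_if_fractional_ratio[OF spec _ _ _ \<rho>_eq] by blast
  qed
  obtain z where "s = int p * z" using st(4) by blast
  then have "1 / \<rho> = real p * of_int z" using st(5) \<open>t = 1\<close> by simp
  then show ?thesis unfolding int_multiples_def by (intro image_eqI[of _ _ "of_int z"]) auto
qed

end

section \<open>Self-affine measures\<close>

lemma affine_contr_measurable [measurable]: "affine_contr M d \<in> borel_measurable borel"
  unfolding affine_contr_def
  by (intro borel_measurable_continuous_onI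
      continuous_on_compose2[OF matrix_vector_mult_linear_continuous_on[of UNIV]] continuous_intros) simp

lemma integral_uniform_count_product:
  fixes g :: "'a \<times> 'b \<Rightarrow> 'c :: {banach, second_countable_topology, real_normed_field}"
  assumes D: "finite D" "D \<noteq> {}" and \<mu>: "prob_space \<mu>"
    and g: "g \<in> borel_measurable (uniform_count_measure D \<Otimes>\<^sub>M \<mu>)" and b: "\<And>z. norm (g z) \<le> B"
  shows "(LINT z|(uniform_count_measure D \<Otimes>\<^sub>M \<mu>). g z) = (\<Sum>d\<in>D. LINT x|\<mu>. g (d, x)) / of_nat (card D)"
proof -
  interpret U: prob_space "uniform_count_measure D" using D by (rule prob_space_uniform_count_measure)
  interpret \<mu>: prob_space \<mu> by fact
  interpret P: pair_prob_space "uniform_count_measure D" \<mu> ..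
  have "integrable (uniform_count_measure D \<Otimes>\<^sub>M \<mu>) g"
    by (rule P.integrable_const_bound[of _ B]) (use g b in auto)
  then have "(LINT z|(uniform_count_measure D \<Otimes>\<^sub>M \<mu>). g z) =
    (LINT d|uniform_count_measure D. LINT x|\<mu>. g (d, x))"
    using P.integral_fst'[of g] by simp
  also have "\<dots> = (\<Sum>d\<in>D. LINT x|\<mu>. g (d, x)) / of_nat (card D)"
    unfolding uniform_count_measure_def using D(1)
    by (subst lebesgue_integral_point_measure_finite)
       (auto simp: scaleR_conv_of_real divide_inverse mult.commute simp flip: sum_distrib_left)
  finally show ?thesis .
qed

text \<open>
  The defining identity, stated for sets, says that \<open>\<mu>\<close> is the image of the product of the uniform
  measure on \<open>D\<close> with \<open>\<mu>\<close> under \<open>(d, x) \<mapsto> M^{-1} (x + d)\<close>; Fubini then extends it to functions.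
\<close>

lemma self_affine_integral:
  fixes \<mu> :: "(real^'n) measure" and f :: "real^'n \<Rightarrow> 'c :: {banach, second_countable_topology, real_normed_field}"
  assumes sa: "self_affine_measure M D \<mu>" and D: "finite D" "D \<noteq> {}"
    and f[measurable]: "f \<in> borel_measurable borel" and b: "\<And>z. norm (f z) \<le> B"
  shows "(LINT x|\<mu>. f x) = (\<Sum>d\<in>D. LINT x|\<mu>. f (affine_contr M d x)) / of_nat (card D)"
proof -
  have \<mu>: "prob_space \<mu>" and sets[measurable_cong]: "sets \<mu> = sets borel"
    using sa by (auto simp: self_affine_measure_def borel_prob_def)
  interpret \<mu>: prob_space \<mu> by fact
  define P where "P = uniform_count_measure D \<Otimes>\<^sub>M \<mu>"
  interpret U: prob_space "uniform_count_measure D" using D by (rule prob_space_uniform_count_measure)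
  interpret P: pair_prob_space "uniform_count_measure D" \<mu> ..
  define \<phi> where "\<phi> = (\<lambda>(d, x). affine_contr M d x)"
  have [measurable]: "\<phi> \<in> borel_measurable P"
  proof -
    have "\<phi> \<in> measurable (count_space D \<Otimes>\<^sub>M \<mu>) borel"
      using D(1) by (intro measurable_pair_measure_countable1 countable_finite) (auto simp: \<phi>_def)
    moreover have "sets P = sets (count_space D \<Otimes>\<^sub>M \<mu>)"
      unfolding P_def by (intro sets_pair_measure_cong sets_uniform_count_measure_count_space refl)
    ultimately show ?thesis using measurable_cong_sets by blast
  qed
  define \<nu> where "\<nu> = distr P borel \<phi>"
  have prob\<nu>: "prob_space \<nu>" unfolding \<nu>_def
    by (rule prob_space.prob_space_distr[OF P.prob_space_axioms[folded P_def]]) measurable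
  have lint: "(LINT x|\<nu>. h x) = (\<Sum>d\<in>D. LINT x|\<mu>. h (affine_contr M d x)) / of_nat (card D)"
    if h[measurable]: "h \<in> borel_measurable borel" and bh: "\<And>z. norm (h z) \<le> B'"
    for h :: "real^'n \<Rightarrow> 'd :: {banach, second_countable_topology, real_normed_field}" and B'
  proof -
    have "(LINT x|\<nu>. h x) = (LINT z|P. h (\<phi> z))" unfolding \<nu>_def by (rule integral_distr) auto
    also have "\<dots> = (\<Sum>d\<in>D. LINT x|\<mu>. h (\<phi> (d, x))) / of_nat (card D)"
      unfolding P_def
    proof (rule integral_uniform_count_product[OF D \<mu>])
      show "(\<lambda>z. h (\<phi> z)) \<in> borel_measurable (uniform_count_measure D \<Otimes>\<^sub>M \<mu>)"
        unfolding P_def[symmetric] by measurable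
    qed (rule bh)
    finally show ?thesis by (simp add: \<phi>_def)
  qed
  have "\<mu> = \<nu>"
  proof (rule measure_eqI)
    show "sets \<mu> = sets \<nu>" by (simp add: sets \<nu>_def)
    fix A assume "A \<in> sets \<mu>"
    then have A[measurable]: "A \<in> sets borel" by (simp add: sets)
    have "measure \<nu> A = (LINT x|\<nu>. indicator A x)"
      using A by (simp add: \<nu>_def)
    also have "\<dots> = (\<Sum>d\<in>D. LINT x|\<mu>. indicator A (affine_contr M d x)) / real (card D)"
      by (rule lint[of _ 1]) (auto simp: indicator_def)
    also have "(\<Sum>d\<in>D. LINT x|\<mu>. indicator A (affine_contr M d x)) =
        (\<Sum>d\<in>D. measure (distr \<mu> borel (affine_contr M d)) A)"
    proof (intro sum.cong refl)
      fix d
      have "measure (distr \<mu> borel (affine_contr M d)) A = (LINT x|distr \<mu> borel (affine_contr M d). indicator A x)"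
        using A by simp
      also have "\<dots> = (LINT x|\<mu>. indicator A (affine_contr M d x))"
        by (rule integral_distr) auto
      finally show "(LINT x|\<mu>. indicator A (affine_contr M d x)) = measure (distr \<mu> borel (affine_contr M d)) A" ..
    qed
    also have "\<dots> / real (card D) = measure \<mu> A"
      using sa A by (simp add: self_affine_measure_def)
    finally show "emeasure \<mu> A = emeasure \<nu> A"
      using prob_space.finite_measure[OF prob\<nu>] prob_space.finite_measure[OF \<mu>]
      by (simp add: finite_measure.emeasure_eq_measure)
  qed
  then show ?thesis using lint[OF f b] by simp
qed

lemma self_affine_fourier:
  fixes \<mu> :: "(real^'n) measure"
  assumes sa: "self_affine_measure M D \<mu>" and D: "finite D" "D \<noteq> {}"
  shows "fourier \<mu> \<xi> = digit_mask D (\<xi> v* matrix_inv M) * fourier \<mu> (\<xi> v* matrix_inv M)"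
proof -
  have "expo \<xi> (affine_contr M d x) = expo (\<xi> v* matrix_inv M) d * expo (\<xi> v* matrix_inv M) x" for d x
  proof -
    have "\<xi> \<bullet> affine_contr M d x = (\<xi> v* matrix_inv M) \<bullet> (d + x)"
      by (simp add: affine_contr_def dot_lmul_matrix add.commute)
    then have "expo \<xi> (affine_contr M d x) = expo (\<xi> v* matrix_inv M) (d + x)"
      by (simp add: expo_def)
    then show ?thesis by (simp add: expo_add_right)
  qed
  then show ?thesis
    unfolding fourier_def digit_mask_def
    by (subst self_affine_integral[OF sa D expo_measurable, of _ 1]) (simp_all add: sum_distrib_right)
qed

text \<open>
  Invariance gives \<open>T R \<le> T (R / \<rho> - B)\<close> for the tail \<open>T R\<close>, the mass where \<open>|L|\<close> exceeds \<open>R\<close>. Beyond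
  \<open>R0\<close> the argument on the right exceeds \<open>R + 1\<close>, so the tail does not decrease along \<open>R0 + n\<close>,
  and it tends to zero.
\<close>

lemma self_affine_functional_bounded:
  fixes \<mu> :: "(real^'n) measure" and L :: "real^'n \<Rightarrow> real"
  assumes sa: "self_affine_measure M D \<mu>" and D: "finite D" "D \<noteq> {}"
    and L[measurable]: "L \<in> borel_measurable borel" and \<rho>: "0 < \<rho>" "\<rho> < 1"
    and LM: "\<And>d x. L (affine_contr M d x) = \<rho> * (L x + L d)"
  shows "\<exists>R\<ge>0. measure \<mu> {x. R < \<bar>L x\<bar>} = 0"
proof -
  have \<mu>: "prob_space \<mu>" and sets[measurable_cong]: "sets \<mu> = sets borel"
    using sa by (auto simp: self_affine_measure_def borel_prob_def)
  interpret prob_space \<mu> by fact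
  define T where "T R = measure \<mu> {x. R < \<bar>L x\<bar>}" for R
  define B where "B = Max ((\<lambda>d. \<bar>L d\<bar>) ` D)"
  have B: "\<bar>L d\<bar> \<le> B" if "d \<in> D" for d using D that by (simp add: B_def)
  have B0: "0 \<le> B" using B D by (meson abs_ge_zero all_not_in_conv order.trans)
  define R0 where "R0 = (B + 1) * \<rho> / (1 - \<rho>)"
  have R0: "R0 \<ge> 0" using \<rho> B0 by (simp add: R0_def)
  have meas[measurable]: "{x. R < \<bar>L x\<bar>} \<in> sets borel" for R by measurable
  have T_anti: "T R' \<le> T R" if "R \<le> R'" for R R'
    unfolding T_def using that by (intro finite_measure_mono) (auto simp: sets)
  have step: "T R \<le> T (R + 1)" if R: "R0 \<le> R" for R
  proof -
    have "(B + 1) * \<rho> \<le> R * (1 - \<rho>)" using R \<rho> by (simp add: R0_def pos_divide_le_eq)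
    then have ge: "R + 1 \<le> R / \<rho> - B" using \<rho> by (simp add: field_simps)
    have "T R = 1 / real (card D) * (\<Sum>d\<in>D. measure (distr \<mu> borel (affine_contr M d)) {x. R < \<bar>L x\<bar>})"
      using sa unfolding self_affine_measure_def T_def by simp
    also have "\<dots> \<le> 1 / real (card D) * (\<Sum>d\<in>D. T (R + 1))"
    proof (intro mult_left_mono sum_mono)
      fix d assume d: "d \<in> D"
      have "measure (distr \<mu> borel (affine_contr M d)) {x. R < \<bar>L x\<bar>} =
          measure \<mu> (affine_contr M d -` {x. R < \<bar>L x\<bar>} \<inter> space \<mu>)"
        by (rule measure_distr) auto
      also have "\<dots> \<le> T (R + 1)"
        unfolding T_def
      proof (intro finite_measure_mono subsetI)
        fix x assume "x \<in> affine_contr M d -` {x. R < \<bar>L x\<bar>} \<inter> space \<mu>"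
        then have "R < \<rho> * \<bar>L x + L d\<bar>" using \<rho> by (simp add: LM abs_mult)
        then have "R / \<rho> < \<bar>L x + L d\<bar>" using \<rho> by (simp add: field_simps)
        then show "x \<in> {x. R + 1 < \<bar>L x\<bar>}" using B[OF d] ge by auto
      qed (simp add: sets)
      finally show "measure (distr \<mu> borel (affine_contr M d)) {x. R < \<bar>L x\<bar>} \<le> T (R + 1)" .
    qed simp
    also have "\<dots> = T (R + 1)" using D by simp
    finally show ?thesis .
  qed
  have le: "T R0 \<le> T (R0 + real n)" for n
  proof (induction n)
    case (Suc n)
    then show ?case using step[of "R0 + real n"] by (simp add: algebra_simps)
  qed simp
  have "(\<lambda>n. T (R0 + real n)) \<longlonglongrightarrow> measure \<mu> (\<Inter>n. {x. R0 + real n < \<bar>L x\<bar>})"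
    unfolding T_def
    by (rule finite_Lim_measure_decseq) (auto simp: sets decseq_def)
  also have "(\<Inter>n. {x. R0 + real n < \<bar>L x\<bar>}) = {}"
  proof -
    have "\<exists>n. \<not> R0 + real n < \<bar>L x\<bar>" for x
    proof -
      obtain n where "\<bar>L x\<bar> - R0 < real n" using reals_Archimedean2 by blast
      then have "\<not> R0 + real n < \<bar>L x\<bar>" by linarith
      then show ?thesis by blast
    qed
    then show ?thesis by blast
  qed
  finally have "(\<lambda>n. T (R0 + real n)) \<longlonglongrightarrow> 0" by simp
  then have "T R0 \<le> 0" by (rule LIMSEQ_le_const) (use le in auto)
  then have "T R0 = 0" by (simp add: T_def measure_le_0_iff)
  then show ?thesis using R0 by (auto simp: T_def)
qed

lemma fourier_delta_set:
  assumes "finite D" "D \<noteq> {}"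
  shows "fourier (delta_set D) \<xi> = digit_mask D \<xi>"
proof -
  have "fourier (delta_set D) \<xi> = (LINT x|uniform_count_measure D. expo \<xi> x)"
    unfolding fourier_def delta_set_def
    by (rule integral_distr[OF _ expo_measurable]) (auto simp: measurable_def)
  also have "\<dots> = digit_mask D \<xi>"
    unfolding uniform_count_measure_def digit_mask_def using assms
    by (subst lebesgue_integral_point_measure_finite)
       (auto simp: scaleR_conv_of_real divide_inverse sum_distrib_left mult.commute)
  finally show ?thesis .
qed

lemma norm_digit_mask_le_cos_bound:
  assumes "finite D" "x \<in> D" "y \<in> D" "x \<noteq> y"
  shows "cmod (digit_mask D \<xi>) \<le> (real (card D) - 2 + 2 * \<bar>cos (pi * (\<xi> \<bullet> (x - y)))\<bar>) / real (card D)"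
proof -
  have card: "card (D - {x, y}) = card D - 2" "card D \<ge> 2"
    using assms card_mono[of D "{x, y}"] by (auto simp: card_Diff_subset)
  have sum: "(\<Sum>d\<in>D. expo \<xi> d) = (\<Sum>d\<in>{x, y}. expo \<xi> d) + (\<Sum>d\<in>D - {x, y}. expo \<xi> d)"
    using assms by (metis add.commute empty_subsetI insert_subset sum.subset_diff)
  define \<theta> where "\<theta> = pi * (\<xi> \<bullet> (x - y))"
  have "expo \<xi> x + expo \<xi> y = expo \<xi> y * (1 + cis (- 2 * \<theta>))"
  proof -
    have "expo \<xi> (x - y) = cis (- 2 * \<theta>)"
      by (simp add: expo_def cis_conv_exp \<theta>_def mult_ac)
    then have "expo \<xi> x = expo \<xi> y * cis (- 2 * \<theta>)"
      using expo_add_right[of \<xi> y "x - y"] by simp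
    then show ?thesis by (simp add: algebra_simps)
  qed
  also have "1 + cis (- 2 * \<theta>) = cis (- \<theta>) * (2 * cos \<theta>)"
  proof -
    have "cis (- \<theta>) * (2 * of_real (cos \<theta>)) = cis (- \<theta>) * (cis \<theta> + cis (- \<theta>))"
      by (simp add: complex_eq_iff)
    then show ?thesis by (simp add: distrib_left cis_mult)
  qed
  finally have pair: "cmod (expo \<xi> x + expo \<xi> y) = 2 * \<bar>cos \<theta>\<bar>" by (simp add: norm_mult)
  have "cmod (\<Sum>d\<in>D. expo \<xi> d) \<le> cmod (\<Sum>d\<in>{x, y}. expo \<xi> d) + cmod (\<Sum>d\<in>D - {x, y}. expo \<xi> d)"
    unfolding sum by (rule norm_triangle_ineq)
  also have "cmod (\<Sum>d\<in>D - {x, y}. expo \<xi> d) \<le> (\<Sum>d\<in>D - {x, y}. cmod (expo \<xi> d))" by (rule norm_sum)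
  finally have "cmod (\<Sum>d\<in>D. expo \<xi> d) \<le> 2 * \<bar>cos \<theta>\<bar> + (real (card D) - 2)"
    using pair assms(4) card by simp
  then show ?thesis
    unfolding digit_mask_def norm_divide by (simp add: \<theta>_def divide_right_mono)
qed

section \<open>Density of trigonometric polynomials\<close>

lemma norm_add_square_le:
  fixes x y :: complex
  shows "(cmod (x + y))\<^sup>2 \<le> 2 * (cmod x)\<^sup>2 + 2 * (cmod y)\<^sup>2"
proof -
  have "(cmod (x + y))\<^sup>2 \<le> (cmod x + cmod y)\<^sup>2"
    by (intro power_mono norm_triangle_ineq) auto
  also have "\<dots> \<le> 2 * (cmod x)\<^sup>2 + 2 * (cmod y)\<^sup>2"
    using sum_squares_ge_zero[of "cmod x - cmod y" 0] by (simp add: power2_eq_square algebra_simps)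
  finally show ?thesis .
qed

lemma square_integrable_add:
  assumes "square_integrable M f" "square_integrable M g"
  shows "square_integrable M (\<lambda>x. f x + g x)"
  unfolding square_integrable_def
proof
  have [measurable]: "f \<in> borel_measurable M" "g \<in> borel_measurable M"
    using assms by (auto simp: square_integrable_def)
  show "(\<lambda>x. f x + g x) \<in> borel_measurable M" by measurable
  show "integrable M (\<lambda>x. (cmod (f x + g x))\<^sup>2)"
  proof (rule Bochner_Integration.integrable_bound)
    show "integrable M (\<lambda>x. 2 * (cmod (f x))\<^sup>2 + 2 * (cmod (g x))\<^sup>2)"
      using assms by (auto simp: square_integrable_def)
    show "AE x in M. norm ((cmod (f x + g x))\<^sup>2) \<le> norm (2 * (cmod (f x))\<^sup>2 + 2 * (cmod (g x))\<^sup>2)"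
    proof (rule AE_I2)
      fix x
      show "norm ((cmod (f x + g x))\<^sup>2) \<le> norm (2 * (cmod (f x))\<^sup>2 + 2 * (cmod (g x))\<^sup>2)"
        using norm_add_square_le[of "f x" "g x"] by simp
    qed
  qed measurable
qed

lemma square_integrable_scale:
  assumes "square_integrable M f"
  shows "square_integrable M (\<lambda>x. c * f x)"
  using assms by (auto simp: square_integrable_def norm_mult power_mult_distrib)

lemma square_integrable_diff:
  assumes "square_integrable M f" "square_integrable M g"
  shows "square_integrable M (\<lambda>x. f x - g x)"
  using square_integrable_add[OF assms(1) square_integrable_scale[OF assms(2), of "-1"]] by simp

lemma L2_parallelogram_bound:
  assumes "square_integrable M f" "square_integrable M g"
  shows "(LINT x|M. (cmod (f x + g x))\<^sup>2) \<le> 2 * (LINT x|M. (cmod (f x))\<^sup>2) + 2 * (LINT x|M. (cmod (g x))\<^sup>2)"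
proof -
  have "(LINT x|M. (cmod (f x + g x))\<^sup>2) \<le> (LINT x|M. 2 * (cmod (f x))\<^sup>2 + 2 * (cmod (g x))\<^sup>2)"
  proof (rule integral_mono)
    show "integrable M (\<lambda>x. (cmod (f x + g x))\<^sup>2)"
      using square_integrable_add[OF assms] by (simp add: square_integrable_def)
    show "integrable M (\<lambda>x. 2 * (cmod (f x))\<^sup>2 + 2 * (cmod (g x))\<^sup>2)"
      using assms by (auto simp: square_integrable_def)
  qed (rule norm_add_square_le)
  then show ?thesis using assms by (simp add: square_integrable_def)
qed

text \<open>
  The linear span of the exponentials is an algebra that separates points, since \<open>x\<close> and \<open>y\<close> are
  told apart by a frequency \<open>\<xi>\<close> with \<open>\<xi> \<bullet> (x - y) = 1/2\<close>; so the Stone-Weierstrass theorem applies to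
  its real members.
\<close>

inductive trig_poly :: "(real^'n \<Rightarrow> complex) \<Rightarrow> bool" where
  trig_expo: "trig_poly (expo \<xi>)"
| trig_add: "trig_poly f \<Longrightarrow> trig_poly g \<Longrightarrow> trig_poly (\<lambda>x. f x + g x)"
| trig_scale: "trig_poly f \<Longrightarrow> trig_poly (\<lambda>x. c * f x)"

lemma trig_expo_mult: "trig_poly g \<Longrightarrow> trig_poly (\<lambda>x. expo \<xi> x * g x)"
proof (induction rule: trig_poly.induct)
  case (trig_expo \<eta>)
  have "(\<lambda>x. expo \<xi> x * expo \<eta> x) = expo (\<xi> + \<eta>)" by (simp add: fun_eq_iff expo_add_left)
  then show ?case using trig_poly.trig_expo[of "\<xi> + \<eta>"] by simp
next
  case (trig_add f g)
  then show ?case using trig_poly.trig_add by (simp add: distrib_left)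
next
  case (trig_scale f c)
  then show ?case using trig_poly.trig_scale[of "\<lambda>x. expo \<xi> x * f x" c] by (simp add: mult.left_commute)
qed

lemma trig_mult: "trig_poly f \<Longrightarrow> trig_poly g \<Longrightarrow> trig_poly (\<lambda>x. f x * g x)"
proof (induction rule: trig_poly.induct)
  case (trig_expo \<eta>)
  then show ?case by (rule trig_expo_mult)
next
  case (trig_add f f')
  then show ?case using trig_poly.trig_add[of "\<lambda>x. f x * g x" "\<lambda>x. f' x * g x"] by (simp add: distrib_right)
next
  case (trig_scale f c)
  then show ?case using trig_poly.trig_scale[of "\<lambda>x. f x * g x" c] by (simp add: mult.assoc)
qed

lemma trig_const: "trig_poly (\<lambda>_. c)"
  using trig_scale[OF trig_expo[of 0], of c] by simp

lemma trig_continuous: "trig_poly f \<Longrightarrow> continuous_on UNIV f"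
  by (induction rule: trig_poly.induct) (auto intro!: continuous_intros expo_continuous)

lemma trig_cos: "trig_poly (\<lambda>x. complex_of_real (cos (2 * pi * (\<xi> \<bullet> x))))"
proof -
  have eq: "(\<lambda>x. complex_of_real (cos (2 * pi * (\<xi> \<bullet> x)))) = (\<lambda>x. 1/2 * (expo \<xi> x + expo (- \<xi>) x))"
    by (rule ext) (simp add: expo_def cos_exp_eq cos_of_real[symmetric] mult_ac)
  show ?thesis
    unfolding eq by (intro trig_scale trig_add trig_expo)
qed

lemma trig_sin: "trig_poly (\<lambda>x. complex_of_real (sin (2 * pi * (\<xi> \<bullet> x))))"
proof -
  have eq: "(\<lambda>x. complex_of_real (sin (2 * pi * (\<xi> \<bullet> x)))) =
      (\<lambda>x. (1 / (2 * \<i>)) * (expo (- \<xi>) x + (- 1) * expo \<xi> x))"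
    by (rule ext) (simp add: expo_def sin_exp_eq sin_of_real[symmetric] mult_ac)
  show ?thesis
    unfolding eq by (intro trig_scale trig_add trig_expo)
qed

lemma trig_approximates_continuous:
  fixes g :: "real^'n \<Rightarrow> real"
  assumes "compact K" "continuous_on K g" "0 < e"
  obtains h where "trig_poly (\<lambda>x. complex_of_real (h x))" "\<And>x. x \<in> K \<Longrightarrow> \<bar>g x - h x\<bar> < e"
proof -
  interpret function_ring_on "{h :: real^'n \<Rightarrow> real. trig_poly (\<lambda>x. complex_of_real (h x))}" K
  proof
    show "compact K" by fact
    fix f f' :: "real^'n \<Rightarrow> real" and c :: real
    assume "f \<in> {h. trig_poly (\<lambda>x. complex_of_real (h x))}"
    then have f: "trig_poly (\<lambda>x. complex_of_real (f x))" by simp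
    then have "continuous_on UNIV (\<lambda>x. Re (complex_of_real (f x)))"
      by (intro continuous_on_Re trig_continuous)
    then show "continuous_on K f" using continuous_on_subset by auto
    assume "f' \<in> {h. trig_poly (\<lambda>x. complex_of_real (h x))}"
    then have f': "trig_poly (\<lambda>x. complex_of_real (f' x))" by simp
    show "(\<lambda>x. f x + f' x) \<in> {h. trig_poly (\<lambda>x. complex_of_real (h x))}"
      using trig_add[OF f f'] by simp
    show "(\<lambda>x. f x * f' x) \<in> {h. trig_poly (\<lambda>x. complex_of_real (h x))}"
      using trig_mult[OF f f'] by simp
  next
    fix c :: real
    show "(\<lambda>_. c) \<in> {h. trig_poly (\<lambda>x::real^'n. complex_of_real (h x))}"
      by (simp add: trig_const)
  next
    fix x y :: "real^'n" assume xy: "x \<noteq> y"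
    define \<xi> where "\<xi> = (1 / (2 * ((x - y) \<bullet> (x - y)))) *\<^sub>R (x - y)"
    have "\<xi> \<bullet> (x - y) = 1/2" using xy by (simp add: \<xi>_def)
    then have eq: "\<xi> \<bullet> x = \<xi> \<bullet> y + 1/2" by (simp add: inner_diff_right)
    have cos: "cos (2 * pi * (\<xi> \<bullet> x)) = - cos (2 * pi * (\<xi> \<bullet> y))"
      and sin: "sin (2 * pi * (\<xi> \<bullet> x)) = - sin (2 * pi * (\<xi> \<bullet> y))"
      unfolding eq by (simp_all add: distrib_left)
    show "\<exists>f\<in>{h. trig_poly (\<lambda>x. complex_of_real (h x))}. f x \<noteq> f y"
    proof (cases "cos (2 * pi * (\<xi> \<bullet> y)) = 0")
      case True
      then have "sin (2 * pi * (\<xi> \<bullet> y)) \<noteq> 0" using sin_cos_squared_add[of "2 * pi * (\<xi> \<bullet> y)"] by auto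
      then show ?thesis using sin trig_sin[of \<xi>]
        by (intro bexI[of _ "\<lambda>x. sin (2 * pi * (\<xi> \<bullet> x))"]) auto
    next
      case False
      then show ?thesis using cos trig_cos[of \<xi>]
        by (intro bexI[of _ "\<lambda>x. cos (2 * pi * (\<xi> \<bullet> x))"]) auto
    qed
  qed
  show ?thesis using Stone_Weierstrass_basic[OF assms(2,3)] that by auto
qed

text \<open>
  \<open>approximable\<close> is the closure of the subspace \<open>A\<close> in \<open>L2(\<mu>)\<close>. If it contains all exponentials,
  it contains in turn continuous functions (uniform approximation on \<open>K\<close>), indicators of
  closed sets (monotone limits), indicators of Borel sets (a Dynkin argument), and everything.
\<close>

locale L2_closure =
  fixes \<mu> :: "(real^'n) measure" and A :: "(real^'n \<Rightarrow> complex) set" and K :: "(real^'n) set"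
  assumes prob: "prob_space \<mu>" and sets: "sets \<mu> = sets borel"
    and K: "compact K" "emeasure \<mu> (- K) = 0"
    and A_sq: "\<And>h. h \<in> A \<Longrightarrow> square_integrable \<mu> h"
    and A_add: "\<And>h h'. h \<in> A \<Longrightarrow> h' \<in> A \<Longrightarrow> (\<lambda>x. h x + h' x) \<in> A"
    and A_scale: "\<And>h c. h \<in> A \<Longrightarrow> (\<lambda>x. c * h x) \<in> A"
begin

definition approximable :: "(real^'n \<Rightarrow> complex) \<Rightarrow> bool" where
  "approximable f \<longleftrightarrow> square_integrable \<mu> f \<and> (\<forall>\<epsilon>>0. \<exists>h\<in>A. (LINT x|\<mu>. (cmod (f x - h x))\<^sup>2) < \<epsilon>)"

lemma approximable_limit:
  assumes "square_integrable \<mu> f"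
    and "\<And>\<epsilon>. \<epsilon> > 0 \<Longrightarrow> \<exists>h. approximable h \<and> (LINT x|\<mu>. (cmod (f x - h x))\<^sup>2) < \<epsilon>"
  shows "approximable f"
  unfolding approximable_def
proof (intro conjI allI impI assms(1))
  fix \<epsilon> :: real assume \<epsilon>: "\<epsilon> > 0"
  obtain h where h: "approximable h" "(LINT x|\<mu>. (cmod (f x - h x))\<^sup>2) < \<epsilon> / 4"
    using assms(2)[of "\<epsilon> / 4"] \<epsilon> by auto
  obtain h' where h': "h' \<in> A" "(LINT x|\<mu>. (cmod (h x - h' x))\<^sup>2) < \<epsilon> / 4"
    using h(1) \<epsilon> unfolding approximable_def by (meson divide_pos_pos zero_less_numeral)
  have sq: "square_integrable \<mu> h" using h(1) by (simp add: approximable_def)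
  have "(LINT x|\<mu>. (cmod (f x - h' x))\<^sup>2) \<le> 2 * (LINT x|\<mu>. (cmod (f x - h x))\<^sup>2) + 2 * (LINT x|\<mu>. (cmod (h x - h' x))\<^sup>2)"
    using L2_parallelogram_bound[OF square_integrable_diff[OF assms(1) sq] square_integrable_diff[OF sq A_sq[OF h'(1)]]]
    by simp
  then have "(LINT x|\<mu>. (cmod (f x - h' x))\<^sup>2) < \<epsilon>" using h h' by linarith
  then show "\<exists>h\<in>A. (LINT x|\<mu>. (cmod (f x - h x))\<^sup>2) < \<epsilon>" using h'(1) by blast
qed

lemma approximable_add:
  assumes f: "approximable f" and g: "approximable g"
  shows "approximable (\<lambda>x. f x + g x)"
  unfolding approximable_def
proof (intro conjI allI impI)
  have sq: "square_integrable \<mu> f" "square_integrable \<mu> g" using f g by (auto simp: approximable_def)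
  then show "square_integrable \<mu> (\<lambda>x. f x + g x)" by (rule square_integrable_add)
  fix \<epsilon> :: real assume \<epsilon>: "\<epsilon> > 0"
  then have \<epsilon>4: "\<epsilon> / 4 > 0" by simp
  obtain h where h: "h \<in> A" "(LINT x|\<mu>. (cmod (f x - h x))\<^sup>2) < \<epsilon> / 4"
    using f \<epsilon>4 unfolding approximable_def by meson
  obtain h' where h': "h' \<in> A" "(LINT x|\<mu>. (cmod (g x - h' x))\<^sup>2) < \<epsilon> / 4"
    using g \<epsilon>4 unfolding approximable_def by meson
  have "(LINT x|\<mu>. (cmod ((f x - h x) + (g x - h' x)))\<^sup>2) < \<epsilon>"
    using L2_parallelogram_bound[OF square_integrable_diff[OF sq(1) A_sq[OF h(1)]] square_integrable_diff[OF sq(2) A_sq[OF h'(1)]]]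
      h(2) h'(2) by linarith
  then have "(LINT x|\<mu>. (cmod (f x + g x - (h x + h' x)))\<^sup>2) < \<epsilon>" by (simp add: algebra_simps)
  then show "\<exists>h\<in>A. (LINT x|\<mu>. (cmod (f x + g x - h x))\<^sup>2) < \<epsilon>" using A_add[OF h(1) h'(1)]
    by (intro bexI[of _ "\<lambda>x. h x + h' x"])
qed

lemma approximable_scale:
  assumes f: "approximable f"
  shows "approximable (\<lambda>x. c * f x)"
  unfolding approximable_def
proof (intro conjI allI impI)
  have sq: "square_integrable \<mu> f" using f by (auto simp: approximable_def)
  then show "square_integrable \<mu> (\<lambda>x. c * f x)" by (rule square_integrable_scale)
  fix \<epsilon> :: real assume \<epsilon>: "\<epsilon> > 0"
  have c1: "(cmod c)\<^sup>2 + 1 > 0" by (simp add: add_nonneg_pos)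
  then have "\<epsilon> / ((cmod c)\<^sup>2 + 1) > 0" using \<epsilon> by simp
  then obtain h where h: "h \<in> A" "(LINT x|\<mu>. (cmod (f x - h x))\<^sup>2) < \<epsilon> / ((cmod c)\<^sup>2 + 1)"
    using f unfolding approximable_def by meson
  have "(LINT x|\<mu>. (cmod (c * f x - c * h x))\<^sup>2) = (cmod c)\<^sup>2 * (LINT x|\<mu>. (cmod (f x - h x))\<^sup>2)"
    by (simp add: norm_mult power_mult_distrib flip: right_diff_distrib)
  also have "\<dots> \<le> ((cmod c)\<^sup>2 + 1) * (LINT x|\<mu>. (cmod (f x - h x))\<^sup>2)"
    by (intro mult_right_mono) auto
  also have "\<dots> < \<epsilon>" using h(2) c1 by (simp add: pos_less_divide_eq mult.commute)
  finally show "\<exists>h\<in>A. (LINT x|\<mu>. (cmod (c * f x - h x))\<^sup>2) < \<epsilon>" using A_scale[OF h(1)]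
    by (intro bexI[of _ "\<lambda>x. c * h x"])
qed

lemma approximable_diff: "approximable f \<Longrightarrow> approximable g \<Longrightarrow> approximable (\<lambda>x. f x - g x)"
  using approximable_add[of f "\<lambda>x. - 1 * g x"] approximable_scale[of g "- 1"] by simp

lemma approximable_dominated:
  assumes g: "\<And>n::nat. approximable (g n)" and f: "f \<in> borel_measurable \<mu>"
    and lim: "\<And>x. (\<lambda>n. g n x) \<longlonglongrightarrow> f x"
    and w: "integrable \<mu> (\<lambda>x. (w x)\<^sup>2)" "w \<in> borel_measurable \<mu>"
    and gw: "\<And>n x. cmod (g n x) \<le> w x"
  shows "approximable f"
proof -
  have [measurable]: "f \<in> borel_measurable \<mu>" "g n \<in> borel_measurable \<mu>" "w \<in> borel_measurable \<mu>" for n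
    using f w g by (auto simp: approximable_def square_integrable_def)
  have fw: "cmod (f x) \<le> w x" for x
    by (rule LIMSEQ_le_const2[OF tendsto_norm[OF lim]]) (use gw in auto)
  have w0: "0 \<le> w x" for x using fw[of x] norm_ge_zero order.trans by blast
  have sq: "square_integrable \<mu> f"
    unfolding square_integrable_def
  proof (intro conjI f Bochner_Integration.integrable_bound[OF w(1)])
    show "AE x in \<mu>. norm ((cmod (f x))\<^sup>2) \<le> norm ((w x)\<^sup>2)"
      using fw w0 by (auto intro!: power_mono)
  qed measurable
  have "(\<lambda>n. LINT x|\<mu>. (cmod (f x - g n x))\<^sup>2) \<longlonglongrightarrow> (LINT x|\<mu>. 0)"
  proof (rule integral_dominated_convergence[of _ _ _ "\<lambda>x. 4 * (w x)\<^sup>2"])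
    show "AE x in \<mu>. (\<lambda>n. (cmod (f x - g n x))\<^sup>2) \<longlonglongrightarrow> 0"
    proof (rule AE_I2)
      fix x
      have "(\<lambda>n. (cmod (f x - g n x))\<^sup>2) \<longlonglongrightarrow> (cmod (f x - f x))\<^sup>2" by (intro tendsto_intros lim)
      then show "(\<lambda>n. (cmod (f x - g n x))\<^sup>2) \<longlonglongrightarrow> 0" by simp
    qed
    show "AE x in \<mu>. norm ((cmod (f x - g n x))\<^sup>2) \<le> 4 * (w x)\<^sup>2" for n
    proof (rule AE_I2)
      fix x
      have "cmod (f x - g n x) \<le> 2 * w x"
        using norm_triangle_ineq4[of "f x" "g n x"] fw[of x] gw[of n x] by linarith
      then have "(cmod (f x - g n x))\<^sup>2 \<le> (2 * w x)\<^sup>2" by (intro power_mono) auto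
      then show "norm ((cmod (f x - g n x))\<^sup>2) \<le> 4 * (w x)\<^sup>2" by (simp add: power_mult_distrib)
    qed
  qed (use w in auto)
  then have lim0: "(\<lambda>n. LINT x|\<mu>. (cmod (f x - g n x))\<^sup>2) \<longlonglongrightarrow> 0" by simp
  show ?thesis
  proof (rule approximable_limit[OF sq])
    fix \<epsilon> :: real assume "\<epsilon> > 0"
    then have "eventually (\<lambda>n. (LINT x|\<mu>. (cmod (f x - g n x))\<^sup>2) < \<epsilon>) sequentially"
      using order_tendstoD(2)[OF lim0] by blast
    then show "\<exists>h. approximable h \<and> (LINT x|\<mu>. (cmod (f x - h x))\<^sup>2) < \<epsilon>"
      using g by (auto simp: eventually_sequentially)
  qed
qed

lemma approximable_bounded_limit:
  assumes "\<And>n::nat. approximable (g n)" "f \<in> borel_measurable borel"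
    "\<And>x. (\<lambda>n. g n x) \<longlonglongrightarrow> f x" "\<And>n x. cmod (g n x) \<le> 1"
  shows "approximable f"
proof -
  interpret prob_space \<mu> by (rule prob)
  have "f \<in> borel_measurable \<mu>" using assms(2) measurable_cong_sets[OF sets refl] by blast
  then show ?thesis
    by (rule approximable_dominated[OF assms(1) _ assms(3), of "\<lambda>_. 1"]) (use assms in auto)
qed

context
  assumes expo_approximable: "\<And>\<xi>. approximable (expo \<xi>)"
begin

lemma trig_approximable: "trig_poly f \<Longrightarrow> approximable f"
  by (induction rule: trig_poly.induct) (auto intro: expo_approximable approximable_add approximable_scale)

lemma continuous_approximable:
  fixes g :: "real^'n \<Rightarrow> real"
  assumes g: "continuous_on UNIV g" "\<And>x. \<bar>g x\<bar> \<le> 1"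
  shows "approximable (\<lambda>x. complex_of_real (g x))"
proof (rule approximable_limit)
  interpret prob_space \<mu> by (rule prob)
  have [measurable]: "g \<in> borel_measurable \<mu>"
    using borel_measurable_continuous_onI[OF g(1)] measurable_cong_sets[OF sets refl] by blast
  show sq: "square_integrable \<mu> (\<lambda>x. complex_of_real (g x))"
    unfolding square_integrable_def
  proof
    show "integrable \<mu> (\<lambda>x. (cmod (complex_of_real (g x)))\<^sup>2)"
      by (rule integrable_const_bound[of _ 1]) (use g(2) in \<open>auto simp: abs_square_le_1\<close>)
  qed measurable
  fix \<epsilon> :: real assume \<epsilon>: "\<epsilon> > 0"
  obtain h where h: "trig_poly (\<lambda>x. complex_of_real (h x))" "\<And>x. x \<in> K \<Longrightarrow> \<bar>g x - h x\<bar> < sqrt (\<epsilon> / 2)"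
    using trig_approximates_continuous[OF K(1) continuous_on_subset[OF g(1)], of "sqrt (\<epsilon> / 2)"] \<epsilon> by auto
  have ap: "approximable (\<lambda>x. complex_of_real (h x))" using h(1) by (rule trig_approximable)
  have "- K \<in> sets borel" using K(1) by (intro borel_comp borel_closed compact_imp_closed)
  then have "AE x in \<mu>. x \<in> K"
    by (intro AE_I[of _ _ "- K"]) (use K sets in auto)
  then have ae: "AE x in \<mu>. (cmod (complex_of_real (g x) - complex_of_real (h x)))\<^sup>2 \<le> \<epsilon> / 2"
  proof eventually_elim
    fix x assume "x \<in> K"
    then have "\<bar>g x - h x\<bar>\<^sup>2 \<le> (sqrt (\<epsilon> / 2))\<^sup>2" using h(2)[of x] by (intro power_mono) auto
    then show "(cmod (complex_of_real (g x) - complex_of_real (h x)))\<^sup>2 \<le> \<epsilon> / 2"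
      using \<epsilon> by (simp flip: of_real_diff)
  qed
  have "(LINT x|\<mu>. (cmod (complex_of_real (g x) - complex_of_real (h x)))\<^sup>2) \<le> (LINT x|\<mu>. \<epsilon> / 2)"
    using square_integrable_diff[OF sq, of "\<lambda>x. complex_of_real (h x)"] ap
    by (intro integral_mono_AE ae) (auto simp only: approximable_def square_integrable_def integrable_const)
  also have "\<dots> < \<epsilon>" using \<epsilon> by (simp add: prob_space)
  finally show "\<exists>h. approximable h \<and> (LINT x|\<mu>. (cmod (complex_of_real (g x) - h x))\<^sup>2) < \<epsilon>"
    using ap by blast
qed

lemma closed_indicator_approximable:
  assumes C: "closed C"
  shows "approximable (indicator C)"
proof (cases "C = {}")
  case True
  then have "(indicator C :: _ \<Rightarrow> complex) = (\<lambda>_. 0)" by auto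
  then show ?thesis using trig_approximable[OF trig_const[of 0]] by simp
next
  case False
  define g where "g n x = max 0 (1 - real n * infdist x C)" for n x
  show ?thesis
  proof (rule approximable_bounded_limit[of "\<lambda>n x. complex_of_real (g n x)"])
    show "approximable (\<lambda>x. complex_of_real (g n x))" for n
    proof (rule continuous_approximable)
      show "continuous_on UNIV (g n)" unfolding g_def by (intro continuous_intros)
      show "\<bar>g n x\<bar> \<le> 1" for x by (simp add: g_def infdist_nonneg)
    qed
    show "(indicator C :: _ \<Rightarrow> complex) \<in> borel_measurable borel" using borel_closed[OF C] by simp
    show "cmod (complex_of_real (g n x)) \<le> 1" for n x by (simp add: g_def infdist_nonneg)
    fix x
    show "(\<lambda>n. complex_of_real (g n x)) \<longlonglongrightarrow> indicator C x"
    proof (cases "x \<in> C")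
      case True
      then show ?thesis by (simp add: g_def)
    next
      case x: False
      then have "infdist x C > 0"
        using in_closed_iff_infdist_zero[OF C False] infdist_nonneg[of x C] by fastforce
      then obtain N where "1 < real N * infdist x C" using reals_Archimedean3 by blast
      then have z: "g n x = 0" if "n \<ge> N" for n
        using that mult_right_mono[of "real N" "real n" "infdist x C"] infdist_nonneg[of x C]
        unfolding g_def by fastforce
      show ?thesis
        by (rule tendsto_eventually) (use z x in \<open>auto simp: eventually_sequentially intro!: exI[of _ N]\<close>)
    qed
  qed
qed

lemma indicator_approximable:
  assumes "S \<in> sets borel"
  shows "approximable (indicator S)"
proof -
  have "Int_stable (Collect closed :: (real^'n) set set)" by (auto simp: Int_stable_def)
  moreover have "Collect closed \<subseteq> Pow (UNIV :: (real^'n) set)" by simp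
  moreover have "S \<in> sigma_sets UNIV (Collect closed)"
    using assms unfolding borel_eq_closed by simp
  ultimately show ?thesis
  proof (induction rule: sigma_sets_induct_disjoint)
    case (basic S)
    then show ?case using closed_indicator_approximable by simp
  next
    case empty
    show ?case by (rule closed_indicator_approximable[OF closed_empty])
  next
    case (compl S)
    have "(indicator (UNIV - S) :: _ \<Rightarrow> complex) = (\<lambda>x. 1 - indicator S x)"
      by (auto simp: indicator_def fun_eq_iff)
    then show ?case using approximable_diff[OF trig_approximable[OF trig_const[of 1]] compl(2)] by simp
  next
    case (union S)
    have fin: "(indicator (\<Union>i<n. S i) :: _ \<Rightarrow> complex) x = (\<Sum>i<n. indicator (S i) x)" for n x
      using union(1) by (intro indicator_UN_disjoint) (auto simp: disjoint_family_on_def)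
    have ap: "approximable (\<lambda>x. \<Sum>i<n. indicator (S i) x)" for n
    proof (induction n)
      case 0
      then show ?case using trig_approximable[OF trig_const[of 0]] by simp
    next
      case (Suc n)
      then show ?case using approximable_add[OF Suc union(3)[of n]] by simp
    qed
    show ?case
    proof (rule approximable_bounded_limit[of "\<lambda>n x. \<Sum>i<n. indicator (S i) x"])
      have [measurable]: "S i \<in> sets borel" for i
        using union(2) unfolding borel_eq_closed by auto
      show "(indicator (\<Union> (range S)) :: _ \<Rightarrow> complex) \<in> borel_measurable borel" by measurable
      show "cmod (\<Sum>i<n. indicator (S i) x) \<le> 1" for n x
        unfolding fin[symmetric] by (simp add: indicator_def)
      fix x
      show "(\<lambda>n. \<Sum>i<n. indicator (S i) x) \<longlonglongrightarrow> (indicator (\<Union> (range S)) x :: complex)"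
        unfolding fin[symmetric] by (rule LIMSEQ_indicator_UN)
    qed (rule ap)
  qed
qed

theorem all_approximable:
  assumes f: "square_integrable \<mu> f"
  shows "approximable f"
proof -
  have fm[measurable]: "f \<in> borel_measurable \<mu>" using f by (simp add: square_integrable_def)
  have spc: "space \<mu> = UNIV" using sets by (metis sets_eq_imp_space_eq space_borel)
  obtain F where F: "\<And>i. simple_function \<mu> (F i)" "\<And>x. x \<in> space \<mu> \<Longrightarrow> (\<lambda>i. F i x) \<longlonglongrightarrow> f x"
    "\<And>i x. x \<in> space \<mu> \<Longrightarrow> dist (F i x) 0 \<le> 2 * dist (f x) 0"
    using borel_measurable_implies_sequence_metric[OF fm, of 0] by blast
  show ?thesis
  proof (rule approximable_dominated[of F _ "\<lambda>x. 2 * cmod (f x)"])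
    fix i
    have rep: "F i = (\<lambda>x. \<Sum>y\<in>F i ` UNIV. y * indicator (F i -` {y}) x)"
    proof
      fix x
      have fin: "finite (F i ` UNIV)" using simple_functionD(1)[OF F(1)[of i]] spc by simp
      have "(\<Sum>y\<in>F i ` UNIV. y * indicator (F i -` {y}) x) = (\<Sum>y\<in>F i ` UNIV. if y = F i x then y else 0)"
        by (intro sum.cong) (auto simp: indicator_def)
      then show "F i x = (\<Sum>y\<in>F i ` UNIV. y * indicator (F i -` {y}) x)" using fin by simp
    qed
    have S: "F i -` {y} \<in> sets borel" for y
      using simple_functionD(2)[OF F(1)[of i], of "{y}"] spc sets by simp
    have "finite Y \<Longrightarrow> approximable (\<lambda>x. \<Sum>y\<in>Y. y * indicator (F i -` {y}) x)" for Y
    proof (induction Y rule: finite_induct)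
      case empty
      then show ?case using trig_approximable[OF trig_const[of 0]] by simp
    next
      case (insert y Y)
      then show ?case
        using approximable_add[OF approximable_scale[OF indicator_approximable[OF S]] insert(3)]
          insert(1,2) by (simp only: sum.insert simp_thms)
    qed
    then have "approximable (\<lambda>x. \<Sum>y\<in>F i ` UNIV. y * indicator (F i -` {y}) x)"
      using simple_functionD(1)[OF F(1)[of i]] spc by metis
    then show "approximable (F i)" by (subst rep)
  next
    show "integrable \<mu> (\<lambda>x. (2 * cmod (f x))\<^sup>2)"
      using f by (simp add: square_integrable_def power_mult_distrib)
  qed (use F spc in auto)
qed

end

end

section \<open>Spectra on an eigenline\<close>

lemma sum_roots_of_unity:
  fixes m :: int
  assumes "p > 0"
  shows "(\<Sum>j<p. cis (2 * pi * (real j * of_int m / real p))) = (if int p dvd m then of_nat p else 0)"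
proof -
  define z where "z = cis (2 * pi * (of_int m / real p))"
  have zj: "cis (2 * pi * (real j * of_int m / real p)) = z ^ j" for j
    unfolding z_def Complex.DeMoivre by (rule arg_cong[of _ _ cis]) simp
  have one: "z = 1 \<longleftrightarrow> int p dvd m"
  proof
    assume "z = 1"
    then have "cos (2 * pi * (of_int m / real p)) = 1" unfolding z_def by (metis Re_complex_of_real cis.simps(1) of_real_1)
    then obtain k :: int where "2 * pi * (of_int m / real p) = of_int k * 2 * pi"
      using cos_one_2pi_int by blast
    then have "(2 * pi) * (of_int m / real p) = (2 * pi) * of_int k" by (simp only: mult_ac)
    then have "of_int m / real p = of_int k" by (subst (asm) mult_cancel_left) simp
    then have "real_of_int m = of_int (k * int p)" using assms by (simp add: field_simps)
    then have "m = k * int p" by linarith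
    then show "int p dvd m" by simp
  next
    assume "int p dvd m"
    then obtain k where k: "m = int p * k" by blast
    have "z = cis (2 * pi * of_int k)" using assms by (simp add: z_def k)
    also have "\<dots> = 1" by (rule cis_multiple_2pi) simp
    finally show "z = 1" .
  qed
  have zp: "z ^ p = 1"
  proof -
    have "z ^ p = cis (2 * pi * of_int m)"
      unfolding z_def Complex.DeMoivre using assms by (intro arg_cong[of _ _ cis]) simp
    also have "\<dots> = 1" by (rule cis_multiple_2pi) simp
    finally show ?thesis .
  qed
  show ?thesis
  proof (cases "z = 1")
    case True
    then show ?thesis unfolding zj using one by simp
  next
    case False
    then show ?thesis unfolding zj using one zp by (simp add: sum_gp_strict)
  qed
qed

text \<open>
  On the line spanned by the eigenvector \<open>e\<close>, the mask has period 1 (as \<open>e\<close> has integral inner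
  products with the digits) and vanishes exactly at the fractions with denominator \<open>p\<close>.
\<close>

locale line_spectrum = mask_system p \<rho> \<delta> D \<mu> N u v
  for p :: nat and \<rho> \<delta> :: real and D :: "(real^'n) set" and \<mu> :: "(real^'n) measure"
    and N :: "real^'n \<Rightarrow> real^'n" and u :: "real^'n \<Rightarrow> real" and v :: "real^'n" +
  fixes b :: int and e :: "real^'n" and q :: "real^'n \<Rightarrow> int"
  assumes b: "1 \<le> b" and ratio: "1 / \<rho> = of_int (int p * b)"
    and card_D: "card D = p"
    and N_e: "\<And>x. N (x *\<^sub>R e) = (\<rho> * x) *\<^sub>R e"
    and e_digit: "\<And>d. d \<in> D \<Longrightarrow> e \<bullet> d = of_int (q d)"
    and e_mask: "\<And>x. digit_mask D (x *\<^sub>R e) = 0 \<longleftrightarrow> (\<exists>w. \<not> int p dvd w \<and> real p * x = of_int w)"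
begin

definition R :: int where "R = int p * b"

lemma R: "R \<ge> 2" "\<rho> = 1 / of_int R" "int p dvd R"
proof -
  have "int p * 1 \<le> int p * b" using b by (intro mult_left_mono) auto
  moreover have "2 \<le> int p" using p_ge_2 by simp
  ultimately show "R \<ge> 2" unfolding R_def by linarith
  have "1 / \<rho> = of_int R" using ratio by (simp add: R_def)
  then show "\<rho> = 1 / of_int R" by (metis div_by_1 divide_divide_eq_right mult_1)
qed (simp add: R_def)

lemma R_pos: "0 < real_of_int R" using R by simp

lemma funpow_N_e: "(N ^^ k) (x *\<^sub>R e) = (\<rho> ^ k * x) *\<^sub>R e"
  by (induction k) (simp_all add: N_e mult.assoc)

lemma expo_e:
  assumes "d \<in> D"
  shows "expo (x *\<^sub>R e) d = cis (- (2 * pi * (x * of_int (q d))))"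
  using e_digit[OF assms] by (simp add: expo_def cis_conv_exp mult_ac)

lemma mask_periodic: "digit_mask D (\<xi> + of_int z *\<^sub>R e) = digit_mask D \<xi>"
proof -
  have "expo (\<xi> + of_int z *\<^sub>R e) d = expo \<xi> d" if "d \<in> D" for d
  proof -
    have "expo (of_int z *\<^sub>R e) d = cis (2 * pi * of_int (- z * q d))"
      by (simp add: expo_e[OF that])
    also have "\<dots> = 1" by (rule cis_multiple_2pi) simp
    finally show ?thesis by (simp add: expo_add_left)
  qed
  then show ?thesis by (simp add: digit_mask_def cong: sum.cong)
qed

text \<open>
  The zeros of the mask at \<open>j / p\<close> with \<open>0 < j < p\<close> say that all nontrivial characters of
  \<open>\<int> / p\<int>\<close> have mean zero over the residues \<open>q d\<close>, so these are equidistributed; as there are \<open>p\<close>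
  of them, each residue occurs once.
\<close>

lemma digits_distinct_mod_p:
  assumes d: "d \<in> D" "d' \<in> D" and dvd: "int p dvd q d - q d'"
  shows "d = d'"
proof -
  define E where "E = {x \<in> D. int p dvd q d - q x}"
  have p0: "p > 0" using p_ge_2 by simp
  have "(\<Sum>x\<in>D. \<Sum>j<p. cis (2 * pi * (real j * of_int (q d - q x) / real p))) =
      (\<Sum>x\<in>D. if int p dvd q d - q x then of_nat p else 0)"
    by (simp only: sum_roots_of_unity[OF p0])
  also have "\<dots> = of_nat (card E) * of_nat p"
    using finite_D by (simp add: E_def sum.If_cases Int_def)
  finally have 1: "(\<Sum>x\<in>D. \<Sum>j<p. cis (2 * pi * (real j * of_int (q d - q x) / real p))) = of_nat (card E * p)"
    by simp
  have zero: "(\<Sum>x\<in>D. cis (2 * pi * (real j * of_int (q d - q x) / real p))) = 0" if j: "j \<in> {..<p} - {0}" for j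
  proof -
    have "\<not> p dvd j" using j by (auto dest: dvd_imp_le)
    then have "digit_mask D ((real j / real p) *\<^sub>R e) = 0"
      using p0 by (subst e_mask) (intro exI[of _ "int j"], simp)
    then have s0: "(\<Sum>x\<in>D. expo ((real j / real p) *\<^sub>R e) x) = 0"
      using card_D p0 by (simp add: digit_mask_def)
    have "(\<Sum>x\<in>D. cis (2 * pi * (real j * of_int (q d - q x) / real p))) =
       (\<Sum>x\<in>D. cis (2 * pi * (real j * of_int (q d) / real p)) * expo ((real j / real p) *\<^sub>R e) x)"
      by (intro sum.cong refl) (simp add: expo_e cis_mult algebra_simps diff_divide_distrib)
    then show ?thesis using s0 by (simp flip: sum_distrib_left)
  qed
  have "(\<Sum>x\<in>D. \<Sum>j<p. cis (2 * pi * (real j * of_int (q d - q x) / real p))) =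
     (\<Sum>j<p. \<Sum>x\<in>D. cis (2 * pi * (real j * of_int (q d - q x) / real p)))" by (rule sum.swap)
  also have "\<dots> = of_nat p"
    using p0 zero card_D by (subst sum.remove[of _ 0]) auto
  finally have "of_nat (card E * p) = (of_nat p :: complex)" using 1 by simp
  then have "card E * p = p" by (simp only: of_nat_eq_iff)
  then have "card E = 1" using p0 by simp
  moreover have "d \<in> E" "d' \<in> E" using d dvd by (auto simp: E_def)
  ultimately show ?thesis by (metis card_1_singletonE singletonD)
qed

text \<open>
  Parseval's identity on \<open>\<int> / p\<int>\<close>, with the digits as points. Both signs occur because the
  frequencies below are expanded in a negative base.
\<close>

lemma mask_level_sum:
  assumes "\<sigma> = 1 \<or> \<sigma> = (-1 :: int)"
  shows "(\<Sum>j<p. (cmod (digit_mask D (\<eta> - (of_int \<sigma> * real j / real p) *\<^sub>R e)))\<^sup>2) = 1"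
proof -
  have p0: "p > 0" using p_ge_2 by simp
  have sq: "complex_of_real ((cmod (digit_mask D (\<eta> - (of_int \<sigma> * real j / real p) *\<^sub>R e)))\<^sup>2) =
     (\<Sum>d\<in>D. \<Sum>d'\<in>D. expo \<eta> d * cnj (expo \<eta> d') *
        cis (2 * pi * (real j * of_int (\<sigma> * (q d - q d')) / real p))) / of_nat (p\<^sup>2)" for j
  proof -
    have ex: "expo (\<eta> - (of_int \<sigma> * real j / real p) *\<^sub>R e) d = expo \<eta> d * cis (2 * pi * (real j * of_int (\<sigma> * q d) / real p))"
      if "d \<in> D" for d
      using expo_add_left[of \<eta> "(- (of_int \<sigma> * real j / real p)) *\<^sub>R e" d]
        expo_e[OF that, of "- (of_int \<sigma> * real j / real p)"] by (simp add: mult_ac)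
    have "complex_of_real ((cmod (digit_mask D (\<eta> - (of_int \<sigma> * real j / real p) *\<^sub>R e)))\<^sup>2) =
      (\<Sum>d\<in>D. expo \<eta> d * cis (2 * pi * (real j * of_int (\<sigma> * q d) / real p))) *
      (\<Sum>d'\<in>D. cnj (expo \<eta> d') * cnj (cis (2 * pi * (real j * of_int (\<sigma> * q d') / real p)))) / of_nat (p\<^sup>2)"
      unfolding complex_norm_square digit_mask_def card_D
      by (simp add: ex power2_eq_square cong: sum.cong)
    also have "\<dots> = (\<Sum>d\<in>D. \<Sum>d'\<in>D. expo \<eta> d * cnj (expo \<eta> d') *
        cis (2 * pi * (real j * of_int (\<sigma> * (q d - q d')) / real p))) / of_nat (p\<^sup>2)"
      unfolding sum_product
      by (intro arg_cong2[of _ _ _ _ "(/)"] sum.cong refl)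
         (simp add: cis_cnj cis_mult algebra_simps diff_divide_distrib)
    finally show ?thesis .
  qed
  have "complex_of_real (\<Sum>j<p. (cmod (digit_mask D (\<eta> - (of_int \<sigma> * real j / real p) *\<^sub>R e)))\<^sup>2) =
     (\<Sum>j<p. \<Sum>d\<in>D. \<Sum>d'\<in>D. expo \<eta> d * cnj (expo \<eta> d') *
        cis (2 * pi * (real j * of_int (\<sigma> * (q d - q d')) / real p))) / of_nat (p\<^sup>2)"
    unfolding of_real_sum sq by (simp add: sum_divide_distrib)
  also have "(\<Sum>j<p. \<Sum>d\<in>D. \<Sum>d'\<in>D. expo \<eta> d * cnj (expo \<eta> d') *
        cis (2 * pi * (real j * of_int (\<sigma> * (q d - q d')) / real p))) =
     (\<Sum>d\<in>D. \<Sum>d'\<in>D. expo \<eta> d * cnj (expo \<eta> d') *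
        (\<Sum>j<p. cis (2 * pi * (real j * of_int (\<sigma> * (q d - q d')) / real p))))"
    by (subst sum.swap, intro sum.cong refl, subst sum.swap) (simp add: sum_distrib_left)
  also have "\<dots> = (\<Sum>d\<in>D. \<Sum>d'\<in>D. if d' = d then of_nat p else 0)"
  proof (intro sum.cong refl)
    fix d d' assume d: "d \<in> D" "d' \<in> D"
    have "int p dvd \<sigma> * (q d - q d') \<longleftrightarrow> d' = d"
      using assms digits_distinct_mod_p[OF d] by (auto simp: dvd_diff_commute)
    then show "expo \<eta> d * cnj (expo \<eta> d') * (\<Sum>j<p. cis (2 * pi * (real j * of_int (\<sigma> * (q d - q d')) / real p))) =
       (if d' = d then of_nat p else 0)"
      unfolding sum_roots_of_unity[OF p0] by (auto simp: expo_mult_cnj)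
  qed
  also have "\<dots> = of_nat (p\<^sup>2)" using finite_D card_D by (simp add: power2_eq_square)
  finally have "complex_of_real (\<Sum>j<p. (cmod (digit_mask D (\<eta> - (of_int \<sigma> * real j / real p) *\<^sub>R e)))\<^sup>2) = of_real 1"
    using p0 by simp
  then show ?thesis by (simp only: of_real_eq_iff)
qed

text \<open>
  The base \<open>- R\<close> instead of \<open>R\<close> keeps the rescaled frequencies away from \<open>1\<close>, the first
  possible zero of the Fourier transform on the line. For \<open>b = 1\<close> the base \<open>R\<close> would produce
  values arbitrarily close to it.
\<close>

primrec \<Gamma> :: "nat \<Rightarrow> int set" where
  "\<Gamma> 0 = {0}"
| "\<Gamma> (Suc n) = (\<lambda>(g, j). g + b * int j * (- R) ^ n) ` (\<Gamma> n \<times> {..<p})"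

lemma finite_\<Gamma> [simp]: "finite (\<Gamma> n)"
  by (induction n) auto

lemma \<Gamma>_mono: "m \<le> n \<Longrightarrow> \<Gamma> m \<subseteq> \<Gamma> n"
proof (induction n rule: dec_induct)
  case (step n)
  have "\<Gamma> n \<subseteq> \<Gamma> (Suc n)"
  proof
    fix g assume "g \<in> \<Gamma> n"
    then show "g \<in> \<Gamma> (Suc n)" using p_ge_2 by (auto intro!: image_eqI[of _ _ "(g, 0)"])
  qed
  then show ?case using step by blast
qed simp

lemma \<Gamma>_pair_difference:
  assumes IH: "\<And>g g'. g \<in> \<Gamma> n \<Longrightarrow> g' \<in> \<Gamma> n \<Longrightarrow> g \<noteq> g' \<Longrightarrow>
      \<exists>k<n. \<exists>w. \<not> int p dvd w \<and> g - g' = b * R ^ k * w"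
    and "g \<in> \<Gamma> n" "g' \<in> \<Gamma> n" "j < p" "j' < p" "(g, j) \<noteq> (g', j')"
  shows "\<exists>k<Suc n. \<exists>w. \<not> int p dvd w \<and>
    (g + b * int j * (- R) ^ n) - (g' + b * int j' * (- R) ^ n) = b * R ^ k * w"
proof (cases "g = g'")
  case True
  then have "j \<noteq> j'" using assms by auto
  have nd: "\<not> int p dvd int j - int j'"
  proof
    assume "int p dvd int j - int j'"
    then have "int j mod int p = int j' mod int p" by (simp add: mod_eq_dvd_iff)
    then show False using assms(4,5) \<open>j \<noteq> j'\<close> by (simp flip: zmod_int)
  qed
  have "(- R) ^ n = (- 1) ^ n * R ^ n" by (rule power_minus)
  then have "(g + b * int j * (- R) ^ n) - (g' + b * int j' * (- R) ^ n) = b * R ^ n * ((- 1) ^ n * (int j - int j'))"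
    using True by (simp add: algebra_simps)
  moreover have "\<not> int p dvd (- 1) ^ n * (int j - int j')"
    using nd by (cases "even n") (auto simp: dvd_diff_commute)
  ultimately show ?thesis by blast
next
  case False
  obtain k w where k: "k < n" "\<not> int p dvd w" "g - g' = b * R ^ k * w"
    using IH[OF assms(2,3) False] by blast
  obtain m where m: "n = k + Suc m" using k(1) less_iff_Suc_add by auto
  have "(- R) ^ n = R ^ k * (R * ((- 1) ^ n * R ^ m))" by (simp add: m power_minus[of R] power_add)
  then have "(g + b * int j * (- R) ^ n) - (g' + b * int j' * (- R) ^ n) =
     b * R ^ k * (w + R * ((- 1) ^ n * R ^ m * (int j - int j')))"
    using k(3) by (simp add: algebra_simps)
  moreover have "\<not> int p dvd w + R * ((- 1) ^ n * R ^ m * (int j - int j'))"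
    using k(2) R(3) by (metis dvd_add_left_iff dvd_mult2)
  ultimately show ?thesis using k(1) by (meson less_SucI)
qed

lemma \<Gamma>_difference:
  "g \<in> \<Gamma> n \<Longrightarrow> g' \<in> \<Gamma> n \<Longrightarrow> g \<noteq> g' \<Longrightarrow> \<exists>k<n. \<exists>w. \<not> int p dvd w \<and> g - g' = b * R ^ k * w"
proof (induction n arbitrary: g g')
  case (Suc n)
  obtain g1 j where g: "g1 \<in> \<Gamma> n" "j < p" "g = g1 + b * int j * (- R) ^ n" using Suc.prems(1) by auto
  obtain g1' j' where g': "g1' \<in> \<Gamma> n" "j' < p" "g' = g1' + b * int j' * (- R) ^ n" using Suc.prems(2) by auto
  have "(g1, j) \<noteq> (g1', j')" using g g' Suc.prems(3) by auto
  then show ?case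
    using \<Gamma>_pair_difference[OF Suc.IH g(1) g'(1) g(2) g'(2)] g(3) g'(3) by simp
qed simp

lemma \<Gamma>_inj: "inj_on (\<lambda>(g, j). g + b * int j * (- R) ^ n) (\<Gamma> n \<times> {..<p})"
proof (rule inj_onI, rule ccontr)
  fix x y assume x: "x \<in> \<Gamma> n \<times> {..<p}" and y: "y \<in> \<Gamma> n \<times> {..<p}"
    and eq: "(\<lambda>(g, j). g + b * int j * (- R) ^ n) x = (\<lambda>(g, j). g + b * int j * (- R) ^ n) y" and ne: "x \<noteq> y"
  obtain g j g' j' where xy: "x = (g, j)" "y = (g', j')" by (cases x, cases y) auto
  have "\<exists>k<Suc n. \<exists>w. \<not> int p dvd w \<and>
    (g + b * int j * (- R) ^ n) - (g' + b * int j' * (- R) ^ n) = b * R ^ k * w"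
    using x y ne by (intro \<Gamma>_pair_difference \<Gamma>_difference) (auto simp: xy)
  moreover have "(g + b * int j * (- R) ^ n) - (g' + b * int j' * (- R) ^ n) = 0"
    using eq by (simp add: xy)
  ultimately obtain k w where "\<not> int p dvd w" "0 = b * R ^ k * w" by metis
  then show False using b R(1) by auto
qed

text \<open>
  The two signs of the digits \<open>(- R)^k\<close> alternate, so the two bounds are exchanged in each step.
\<close>

lemma \<Gamma>_bound_signed: "g \<in> \<Gamma> n \<Longrightarrow> - (R ^ Suc n) \<le> (R + 1) * ((- 1) ^ n * g) \<and> (R + 1) * ((- 1) ^ n * g) \<le> R ^ n"
proof (induction n arbitrary: g)
  case 0
  then show ?case using R(1) by simp
next
  case (Suc n)
  obtain g1 j where g: "g1 \<in> \<Gamma> n" "j < p" "g = g1 + b * int j * (- R) ^ n" using Suc.prems by auto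
  define c where "c = b * int j"
  have "c \<le> b * (int p - 1)" unfolding c_def using g(2) b by (intro mult_left_mono) auto
  also have "\<dots> \<le> R - 1" using b by (simp add: R_def algebra_simps)
  finally have c: "0 \<le> c" "c \<le> R - 1" using b by (auto simp: c_def)
  have "(- 1) ^ n * (- R) ^ n = R ^ n" by (simp flip: power_mult_distrib)
  then have eq: "(R + 1) * ((- 1) ^ Suc n * g) = - ((R + 1) * ((- 1) ^ n * g1)) - (R + 1) * c * R ^ n"
    unfolding g(3) c_def by (simp add: algebra_simps)
  have Rn: "0 \<le> R ^ n" using R(1) by simp
  have "(R + 1) * c * R ^ n \<le> (R + 1) * (R - 1) * R ^ n"
    using c R(1) Rn by (intro mult_right_mono mult_left_mono) auto
  also have "\<dots> = R ^ Suc (Suc n) - R ^ n" by (simp add: algebra_simps)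
  finally have up: "(R + 1) * c * R ^ n \<le> R ^ Suc (Suc n) - R ^ n" .
  have lo: "0 \<le> (R + 1) * c * R ^ n" using c R(1) Rn by simp
  show ?case using Suc.IH[OF g(1)] up lo unfolding eq by linarith
qed

lemma \<Gamma>_bound:
  assumes "g \<in> \<Gamma> n"
  shows "\<bar>of_int g / of_int R ^ n\<bar> \<le> real_of_int R / (of_int R + 1)"
proof -
  have "\<bar>(R + 1) * ((- 1) ^ n * g)\<bar> \<le> R ^ Suc n"
    using \<Gamma>_bound_signed[OF assms] power_increasing[of n "Suc n" R] R(1) by linarith
  then have "(R + 1) * \<bar>g\<bar> \<le> R ^ Suc n" using R(1) by (simp add: abs_mult power_abs)
  then have "real_of_int ((R + 1) * \<bar>g\<bar>) \<le> of_int (R ^ Suc n)" by (simp only: of_int_le_iff)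
  then have "(of_int R + 1) * \<bar>real_of_int g\<bar> \<le> of_int R * of_int R ^ n" by simp
  then show ?thesis using R_pos by (simp add: abs_divide field_simps)
qed

lemma \<Gamma>_orthogonal:
  assumes "g \<in> \<Gamma> n" "g' \<in> \<Gamma> n" "g \<noteq> g'"
  shows "fourier \<mu> (of_int g *\<^sub>R e - of_int g' *\<^sub>R e) = 0"
proof -
  obtain k w where k: "\<not> int p dvd w" "g - g' = b * R ^ k * w" using \<Gamma>_difference[OF assms] by blast
  have eq: "of_int g *\<^sub>R e - of_int g' *\<^sub>R e = of_int (b * R ^ k * w) *\<^sub>R e"
    using k(2) by (metis of_int_diff scaleR_left_diff_distrib)
  have "real p * (\<rho> ^ Suc k * of_int (b * R ^ k * w)) = of_int w"
    using R_pos p_ge_2 b by (simp add: R(2) power_divide) (simp add: R_def)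
  then have "digit_mask D ((N ^^ Suc k) (of_int (b * R ^ k * w) *\<^sub>R e)) = 0"
    unfolding funpow_N_e e_mask using k(1) by blast
  then have "(\<Prod>j\<in>{1..Suc k}. digit_mask D ((N ^^ j) (of_int (b * R ^ k * w) *\<^sub>R e))) = 0"
    by (auto simp: prod_zero_iff simp del: funpow.simps)
  then show ?thesis unfolding eq by (subst fourier_product[of _ "Suc k"]) simp
qed

lemma \<Gamma>_line_inj: "inj_on (\<lambda>g. real_of_int g *\<^sub>R e) (\<Gamma> n)"
proof (rule inj_onI, rule ccontr)
    fix g g' assume "g \<in> \<Gamma> n" "g' \<in> \<Gamma> n" "real_of_int g *\<^sub>R e = of_int g' *\<^sub>R e" "g \<noteq> g'"
    then show False using \<Gamma>_orthogonal[of g n g'] fourier_0[OF prob] by simp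
qed

definition level_product :: "nat \<Rightarrow> real^'n \<Rightarrow> real" where
  "level_product n \<xi> = (\<Prod>k\<in>{1..n}. (cmod (digit_mask D ((N ^^ k) \<xi>)))\<^sup>2)"

text \<open>
  By periodicity the new digit \<open>b j (- R)^n\<close> changes only the factor of level \<open>n + 1\<close>, where it
  contributes a shift by \<open>\<plusminus> j / p\<close>.
\<close>

lemma level_product_sum: "(\<Sum>g\<in>\<Gamma> n. level_product n (\<xi> - of_int g *\<^sub>R e)) = 1"
proof (induction n)
  case 0
  then show ?case by (simp add: level_product_def)
next
  case (Suc n)
  have split: "level_product (Suc n) (\<xi> - of_int (g + b * int j * (- R) ^ n) *\<^sub>R e) =
      level_product n (\<xi> - of_int g *\<^sub>R e) *
      (cmod (digit_mask D ((N ^^ Suc n) (\<xi> - of_int g *\<^sub>R e) - (of_int ((- 1) ^ n) * real j / real p) *\<^sub>R e)))\<^sup>2"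
    for g j
  proof -
    define x where "x = real_of_int (b * int j * (- R) ^ n)"
    have arg: "\<xi> - of_int (g + b * int j * (- R) ^ n) *\<^sub>R e = (\<xi> - of_int g *\<^sub>R e) - x *\<^sub>R e"
      by (simp add: x_def scaleR_left_distrib)
    have "digit_mask D ((N ^^ k) ((\<xi> - of_int g *\<^sub>R e) - x *\<^sub>R e)) = digit_mask D ((N ^^ k) (\<xi> - of_int g *\<^sub>R e))"
      if k: "k \<in> {1..n}" for k
    proof -
      have "real_of_int R ^ n = of_int R ^ k * of_int R ^ (n - k)" using k by (simp flip: power_add)
      then have "\<rho> ^ k * x = of_int (b * int j * (- 1) ^ n * R ^ (n - k))"
        using R_pos by (simp add: x_def R(2) power_divide power_minus[of "real_of_int R"])
      then have "(N ^^ k) ((\<xi> - of_int g *\<^sub>R e) - x *\<^sub>R e) =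
         (N ^^ k) (\<xi> - of_int g *\<^sub>R e) + of_int (- (b * int j * (- 1) ^ n * R ^ (n - k))) *\<^sub>R e"
        by (simp add: funpow_N_diff funpow_N_e)
      then show ?thesis by (simp only: mask_periodic)
    qed
    then have 1: "level_product n ((\<xi> - of_int g *\<^sub>R e) - x *\<^sub>R e) = level_product n (\<xi> - of_int g *\<^sub>R e)"
      unfolding level_product_def by (intro prod.cong) auto
    have "\<rho> ^ Suc n * x = of_int ((- 1) ^ n) * real j / real p"
      using R_pos p_ge_2 b by (simp add: x_def R(2) power_divide power_minus[of "real_of_int R"]) (simp add: R_def field_simps)
    then have 2: "(N ^^ Suc n) ((\<xi> - of_int g *\<^sub>R e) - x *\<^sub>R e) =
        (N ^^ Suc n) (\<xi> - of_int g *\<^sub>R e) - (of_int ((- 1) ^ n) * real j / real p) *\<^sub>R e"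
      by (simp only: funpow_N_diff funpow_N_e)
    have "level_product (Suc n) z = level_product n z * (cmod (digit_mask D ((N ^^ Suc n) z)))\<^sup>2" for z
      by (simp add: level_product_def)
    then show ?thesis unfolding arg by (simp only: 1 2)
  qed
  have "(\<Sum>g\<in>\<Gamma> (Suc n). level_product (Suc n) (\<xi> - of_int g *\<^sub>R e)) =
     (\<Sum>(g, j)\<in>\<Gamma> n \<times> {..<p}. level_product (Suc n) (\<xi> - of_int (g + b * int j * (- R) ^ n) *\<^sub>R e))"
    unfolding \<Gamma>.simps by (subst sum.reindex[OF \<Gamma>_inj]) (simp add: case_prod_beta comp_def)
  also have "\<dots> = (\<Sum>g\<in>\<Gamma> n. \<Sum>j<p. level_product (Suc n) (\<xi> - of_int (g + b * int j * (- R) ^ n) *\<^sub>R e))"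
    by (simp add: sum.cartesian_product)
  also have "\<dots> = (\<Sum>g\<in>\<Gamma> n. level_product n (\<xi> - of_int g *\<^sub>R e) * 1)"
    unfolding split sum_distrib_left[symmetric]
    by (intro sum.cong refl arg_cong2[of _ _ _ _ "(*)"] mask_level_sum) (cases "even n"; simp)
  finally show ?case using Suc by simp
qed

lemma fourier_sq_level: "(cmod (fourier \<mu> \<xi>))\<^sup>2 = level_product n \<xi> * (cmod (fourier \<mu> ((N ^^ n) \<xi>)))\<^sup>2"
  unfolding level_product_def by (rule fourier_sq_product)

lemma fourier_nonzero_on_segment:
  assumes "\<bar>x\<bar> \<le> real_of_int R / (of_int R + 1)"
  shows "fourier \<mu> (x *\<^sub>R e) \<noteq> 0"
proof
  assume "fourier \<mu> (x *\<^sub>R e) = 0"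
  then obtain k where "k \<ge> 1" "digit_mask D ((N ^^ k) (x *\<^sub>R e)) = 0"
    using fourier_zero_imp_mask_zero by blast
  then obtain w where k: "k \<ge> 1" "\<not> int p dvd w" "real p * (\<rho> ^ k * x) = of_int w"
    unfolding funpow_N_e e_mask by blast
  obtain k' where k': "k = Suc k'" using k(1) by (metis Suc_le_D One_nat_def)
  have "x = of_int (b * R ^ k' * w)"
    unfolding of_int_mult k(3)[symmetric] k' using R_pos p_ge_2 b
    by (simp add: R(2) power_divide) (simp add: R_def)
  moreover have "b * R ^ k' * w \<noteq> 0" using b R(1) k(2) by auto
  ultimately have "\<bar>x\<bar> \<ge> 1" by linarith
  moreover have "real_of_int R / (of_int R + 1) < 1" using R_pos by simp
  ultimately show False using assms by linarith
qed

lemma fourier_lower_bound: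
  obtains \<kappa> \<epsilon> where "0 < \<kappa>" "0 < \<epsilon>"
    "\<And>x y. \<bar>x\<bar> \<le> real_of_int R / (of_int R + 1) \<Longrightarrow> norm y < \<epsilon> \<Longrightarrow> \<kappa> \<le> cmod (fourier \<mu> (y + x *\<^sub>R e))"
proof -
  define B where "B = real_of_int R / (of_int R + 1)"
  have B: "0 \<le> B" "B \<le> 1" using R_pos by (auto simp: B_def)
  have cont: "continuous_on S (fourier \<mu>)" for S
    using isCont_fourier[OF prob sets] continuous_at_imp_continuous_on by blast
  have "\<exists>x\<in>{-B..B}. \<forall>y\<in>{-B..B}. cmod (fourier \<mu> (x *\<^sub>R e)) \<le> cmod (fourier \<mu> (y *\<^sub>R e))"
  proof (rule continuous_attains_inf)
    show "continuous_on {-B..B} (\<lambda>x. cmod (fourier \<mu> (x *\<^sub>R e)))"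
      by (intro continuous_on_norm continuous_on_compose2[OF cont[of UNIV]] continuous_intros) auto
  qed (use B in auto)
  then obtain x0 where x0: "x0 \<in> {-B..B}" "\<And>y. y \<in> {-B..B} \<Longrightarrow> cmod (fourier \<mu> (x0 *\<^sub>R e)) \<le> cmod (fourier \<mu> (y *\<^sub>R e))"
    by blast
  define \<kappa> where "\<kappa> = cmod (fourier \<mu> (x0 *\<^sub>R e)) / 2"
  have \<kappa>: "\<kappa> > 0" 
  proof -
    have "\<bar>x0\<bar> \<le> B" using x0(1) by (simp add: abs_le_iff)
    then show ?thesis using fourier_nonzero_on_segment[of x0] by (simp add: \<kappa>_def B_def)
  qed
  have "uniformly_continuous_on (cball 0 (norm e + 1)) (fourier \<mu>)"
    by (rule compact_uniformly_continuous[OF cont]) simp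
  then obtain d where d: "d > 0" "\<And>x x'. x \<in> cball 0 (norm e + 1) \<Longrightarrow> x' \<in> cball 0 (norm e + 1) \<Longrightarrow>
      dist x' x < d \<Longrightarrow> dist (fourier \<mu> x') (fourier \<mu> x) < \<kappa>"
    unfolding uniformly_continuous_on_def using \<kappa> by blast
  have "\<kappa> \<le> cmod (fourier \<mu> (y + x *\<^sub>R e))" if x: "\<bar>x\<bar> \<le> B" and y: "norm y < min d 1" for x y
  proof -
    have xe: "norm (x *\<^sub>R e) \<le> norm e" using x B by (simp add: mult_left_le_one_le)
    then have "norm (y + x *\<^sub>R e) \<le> norm e + 1" using norm_triangle_ineq[of y "x *\<^sub>R e"] y by linarith
    then have "y + x *\<^sub>R e \<in> cball 0 (norm e + 1)" "x *\<^sub>R e \<in> cball 0 (norm e + 1)"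
      using xe by (simp_all only: mem_cball_0)
    moreover have "dist (y + x *\<^sub>R e) (x *\<^sub>R e) < d" using y by (simp add: dist_norm)
    ultimately have "dist (fourier \<mu> (y + x *\<^sub>R e)) (fourier \<mu> (x *\<^sub>R e)) < \<kappa>"
      by (intro d(2))
    moreover have "2 * \<kappa> \<le> cmod (fourier \<mu> (x *\<^sub>R e))" using x0(2)[of x] x by (auto simp: \<kappa>_def abs_le_iff)
    ultimately show ?thesis
      using norm_triangle_ineq2[of "fourier \<mu> (x *\<^sub>R e)" "fourier \<mu> (y + x *\<^sub>R e)"]
      by (simp add: dist_norm norm_minus_commute)
  qed
  then show ?thesis using that[of \<kappa> "min d 1"] \<kappa> d(1) unfolding B_def by simp
qed

text \<open>
  The sums \<open>S n\<close> of the squared Fourier coefficients increase to a limit by Bessel's inequality.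
  Since the squared coefficient dominates \<open>\<kappa>^2\<close> times the level product, the level products
  have a uniformly small mass outside a fixed \<open>\<Gamma> n1\<close>. Their total mass is 1, and on the finite set
  \<open>\<Gamma> n1\<close> they are close to the squared coefficients.
\<close>

lemma parseval_on_line:
  assumes "0 < \<epsilon>"
  shows "\<exists>n. 1 - \<epsilon> \<le> (\<Sum>g\<in>\<Gamma> n. (cmod (fourier \<mu> (\<xi> - of_int g *\<^sub>R e)))\<^sup>2)"
proof -
  define \<epsilon>' where "\<epsilon>' = min \<epsilon> 1"
  have \<epsilon>': "0 < \<epsilon>'" "\<epsilon>' \<le> 1" "\<epsilon>' \<le> \<epsilon>" using assms by (auto simp: \<epsilon>'_def)
  define f where "f g = (cmod (fourier \<mu> (\<xi> - of_int g *\<^sub>R e)))\<^sup>2" for g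
  define S where "S n = sum f (\<Gamma> n)" for n
  obtain \<kappa> \<epsilon>0 where \<kappa>: "0 < \<kappa>" "0 < \<epsilon>0" and
    low: "\<And>x y. \<bar>x\<bar> \<le> real_of_int R / (of_int R + 1) \<Longrightarrow> norm y < \<epsilon>0 \<Longrightarrow> \<kappa> \<le> cmod (fourier \<mu> (y + x *\<^sub>R e))"
    using fourier_lower_bound by blast
  have S1: "S n \<le> 1" for n
  proof -
    have "(\<Sum>\<kappa>\<in>(\<lambda>g. real_of_int g *\<^sub>R e) ` \<Gamma> n. (cmod (fourier \<mu> (\<xi> - \<kappa>)))\<^sup>2) \<le> 1"
      by (rule fourier_bessel[OF prob sets]) (auto intro: \<Gamma>_orthogonal)
    then show ?thesis by (simp add: S_def f_def sum.reindex[OF \<Gamma>_line_inj])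
  qed
  have mono: "S m \<le> S n" if "m \<le> n" for m n
    unfolding S_def using \<Gamma>_mono[OF that] by (intro sum_mono2) (auto simp: f_def)
  have "convergent S"
    by (rule Bseq_mono_convergent)
       (use S1 mono in \<open>auto intro!: BseqI'[of _ 1] simp: S_def f_def sum_nonneg\<close>)
  then obtain L where L: "S \<longlonglongrightarrow> L" by (auto simp: convergent_def)
  have SL: "S n \<le> L" for n using L mono by (intro LIMSEQ_le_const[OF L]) auto
  have "eventually (\<lambda>n. S n > L - \<kappa>\<^sup>2 * (\<epsilon>' / 2)) sequentially"
    by (rule order_tendstoD[OF L]) (use \<kappa> \<epsilon>' in simp)
  then obtain n1 where n1: "S n1 > L - \<kappa>\<^sup>2 * (\<epsilon>' / 2)" by (auto simp: eventually_sequentially)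
  have ev1: "eventually (\<lambda>n. norm ((N ^^ n) \<xi>) < \<epsilon>0) sequentially"
    using order_tendstoD(2)[OF tendsto_norm[OF N_tendsto[of \<xi>]]] \<kappa> by simp
  have ev2: "eventually (\<lambda>n. \<forall>g\<in>\<Gamma> n1. 1 - \<epsilon>' / 2 < (cmod (fourier \<mu> ((N ^^ n) (\<xi> - of_int g *\<^sub>R e))))\<^sup>2) sequentially"
  proof (rule eventually_ball_finite)
    show "\<forall>g\<in>\<Gamma> n1. eventually (\<lambda>n. 1 - \<epsilon>' / 2 < (cmod (fourier \<mu> ((N ^^ n) (\<xi> - of_int g *\<^sub>R e))))\<^sup>2) sequentially"
    proof
      fix g
      have "(\<lambda>n. (cmod (fourier \<mu> ((N ^^ n) (\<xi> - of_int g *\<^sub>R e))))\<^sup>2) \<longlonglongrightarrow> (cmod (fourier \<mu> 0))\<^sup>2"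
        by (intro tendsto_intros isCont_tendsto_compose[OF isCont_fourier[OF prob sets] N_tendsto])
      then show "eventually (\<lambda>n. 1 - \<epsilon>' / 2 < (cmod (fourier \<mu> ((N ^^ n) (\<xi> - of_int g *\<^sub>R e))))\<^sup>2) sequentially"
        by (rule order_tendstoD(1)) (use \<epsilon>' in \<open>simp add: fourier_0[OF prob]\<close>)
    qed
  qed simp
  have "eventually (\<lambda>n. n1 \<le> n \<and> norm ((N ^^ n) \<xi>) < \<epsilon>0 \<and>
     (\<forall>g\<in>\<Gamma> n1. 1 - \<epsilon>' / 2 < (cmod (fourier \<mu> ((N ^^ n) (\<xi> - of_int g *\<^sub>R e))))\<^sup>2)) sequentially"
    using ev1 ev2 eventually_ge_at_top[of n1] by eventually_elim auto
  then obtain n where n: "n1 \<le> n" "norm ((N ^^ n) \<xi>) < \<epsilon>0"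
    "\<And>g. g \<in> \<Gamma> n1 \<Longrightarrow> 1 - \<epsilon>' / 2 < (cmod (fourier \<mu> ((N ^^ n) (\<xi> - of_int g *\<^sub>R e))))\<^sup>2"
    by (auto simp: eventually_sequentially)
  define P where "P g = level_product n (\<xi> - of_int g *\<^sub>R e)" for g
  have P0: "0 \<le> P g" for g by (simp add: P_def level_product_def prod_nonneg)
  have fP: "f g = P g * (cmod (fourier \<mu> ((N ^^ n) (\<xi> - of_int g *\<^sub>R e))))\<^sup>2" for g
    unfolding f_def P_def by (rule fourier_sq_level)
  have "\<kappa>\<^sup>2 * P g \<le> f g" if g: "g \<in> \<Gamma> n" for g
  proof -
    have "\<rho> ^ n * of_int g = of_int g / of_int R ^ n" by (simp add: R(2) power_divide)
    then have "(N ^^ n) (\<xi> - of_int g *\<^sub>R e) = (N ^^ n) \<xi> + (- (of_int g / of_int R ^ n)) *\<^sub>R e"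
      by (simp add: funpow_N_diff funpow_N_e)
    then have "\<kappa> \<le> cmod (fourier \<mu> ((N ^^ n) (\<xi> - of_int g *\<^sub>R e)))"
      using low[of "- (of_int g / of_int R ^ n)"] \<Gamma>_bound[OF g] n(2) by simp
    then have "\<kappa>\<^sup>2 \<le> (cmod (fourier \<mu> ((N ^^ n) (\<xi> - of_int g *\<^sub>R e))))\<^sup>2"
      using \<kappa> by (intro power_mono) auto
    then show ?thesis unfolding fP using P0 by (simp add: mult.commute mult_left_mono)
  qed
  then have "(\<Sum>g\<in>\<Gamma> n - \<Gamma> n1. \<kappa>\<^sup>2 * P g) \<le> sum f (\<Gamma> n - \<Gamma> n1)" by (intro sum_mono) auto
  also have "\<dots> = S n - S n1" using \<Gamma>_mono[OF n(1)] by (simp add: S_def sum_diff)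
  also have "\<dots> \<le> \<kappa>\<^sup>2 * (\<epsilon>' / 2)" using SL[of n] n1 by linarith
  finally have "\<kappa>\<^sup>2 * sum P (\<Gamma> n - \<Gamma> n1) \<le> \<kappa>\<^sup>2 * (\<epsilon>' / 2)" by (simp add: sum_distrib_left)
  then have tail: "sum P (\<Gamma> n - \<Gamma> n1) \<le> \<epsilon>' / 2" using \<kappa> by simp
  have "1 = sum P (\<Gamma> n)" unfolding P_def by (rule level_product_sum[symmetric])
  also have "\<dots> = sum P (\<Gamma> n1) + sum P (\<Gamma> n - \<Gamma> n1)"
    using \<Gamma>_mono[OF n(1)] by (metis add.commute finite_\<Gamma> sum.subset_diff)
  finally have main: "1 - \<epsilon>' / 2 \<le> sum P (\<Gamma> n1)" using tail by linarith
  have "(1 - \<epsilon>' / 2) * (1 - \<epsilon>' / 2) \<le> (1 - \<epsilon>' / 2) * sum P (\<Gamma> n1)"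
    using main \<epsilon>' by (intro mult_left_mono) auto
  also have "\<dots> \<le> S n1"
    unfolding S_def fP sum_distrib_left mult.commute[of "1 - \<epsilon>' / 2"]
    using n(3) P0 by (intro sum_mono mult_left_mono) (auto intro: less_imp_le)
  finally have "1 - \<epsilon>' + (\<epsilon>' / 2)\<^sup>2 \<le> S n1" by (simp add: power2_eq_square algebra_simps)
  then have "1 - \<epsilon>' \<le> S n1" using zero_le_power2[of "\<epsilon>' / 2"] by linarith
  then show ?thesis using \<epsilon>' unfolding S_def f_def by (intro exI[of _ n1]) linarith
qed

theorem line_is_spectrum:
  assumes K: "compact K" "emeasure \<mu> (- K) = 0"
  shows "is_spectrum \<mu> ((\<lambda>g. of_int g *\<^sub>R e) ` (\<Union>n. \<Gamma> n))"
proof -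
  interpret prob_space \<mu> by (rule prob)
  define \<Lambda> where "\<Lambda> = (\<lambda>g. real_of_int g *\<^sub>R e) ` (\<Union>n. \<Gamma> n)"
  have ortho: "fourier \<mu> (x - y) = 0" if xy: "x \<in> \<Lambda>" "y \<in> \<Lambda>" "x \<noteq> y" for x y
  proof -
    obtain g n g' n' where g: "g \<in> \<Gamma> n" "x = real_of_int g *\<^sub>R e" "g' \<in> \<Gamma> n'" "y = real_of_int g' *\<^sub>R e"
      using xy(1,2) unfolding \<Lambda>_def by blast
    have "g \<in> \<Gamma> (max n n')" "g' \<in> \<Gamma> (max n n')"
      using g \<Gamma>_mono[of n "max n n'"] \<Gamma>_mono[of n' "max n n'"] by auto
    moreover have "g \<noteq> g'" using g xy(3) by auto
    ultimately show ?thesis using \<Gamma>_orthogonal g by blast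
  qed
  have [measurable]: "expo \<eta> \<in> borel_measurable \<mu>" for \<eta>
    using expo_measurable[of \<eta>] measurable_cong_sets[OF sets refl] by blast
  have sq: "square_integrable \<mu> (expo \<eta>)" for \<eta> by (simp add: square_integrable_def)
  define A where "A = {h. \<exists>F c. finite F \<and> F \<subseteq> \<Lambda> \<and> h = (\<lambda>x. \<Sum>\<kappa>\<in>F. c \<kappa> * expo \<kappa> x)}"
  interpret L2_closure \<mu> A K
  proof (rule L2_closure.intro)
    show "prob_space \<mu>" "sets \<mu> = sets borel" by (rule prob, rule sets)
    show "compact K" "emeasure \<mu> (- K) = 0" by fact+
  next
    fix h assume "h \<in> A"
    then obtain F c where F: "finite F" "h = (\<lambda>x. \<Sum>\<kappa>\<in>F. c \<kappa> * expo \<kappa> x)" by (auto simp: A_def)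
    have "square_integrable \<mu> (\<lambda>x. \<Sum>\<kappa>\<in>F. c \<kappa> * expo \<kappa> x)"
      using F(1)
    proof (induction F rule: finite_induct)
      case empty
      then show ?case by (simp add: square_integrable_def)
    next
      case (insert \<kappa> F)
      then show ?case using square_integrable_add[OF square_integrable_scale[OF sq] insert(3)] by simp
    qed
    then show "square_integrable \<mu> h" using F by simp
  next
    fix h h' assume "h \<in> A" "h' \<in> A"
    then obtain F c F' c' where F: "finite F" "F \<subseteq> \<Lambda>" "h = (\<lambda>x. \<Sum>\<kappa>\<in>F. c \<kappa> * expo \<kappa> x)"
      "finite F'" "F' \<subseteq> \<Lambda>" "h' = (\<lambda>x. \<Sum>\<kappa>\<in>F'. c' \<kappa> * expo \<kappa> x)" unfolding A_def by blast
    have widen: "(\<Sum>\<kappa>\<in>G. k \<kappa> * expo \<kappa> x) = (\<Sum>\<kappa>\<in>F \<union> F'. (if \<kappa> \<in> G then k \<kappa> else 0) * expo \<kappa> x)"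
      if "G \<subseteq> F \<union> F'" for G k x
      using that F(1,4) by (intro sum.mono_neutral_cong_left) auto
    define k where "k \<kappa> = (if \<kappa> \<in> F then c \<kappa> else 0) + (if \<kappa> \<in> F' then c' \<kappa> else 0)" for \<kappa>
    have "h x + h' x = (\<Sum>\<kappa>\<in>F \<union> F'. k \<kappa> * expo \<kappa> x)" for x
    proof -
      have "h x = (\<Sum>\<kappa>\<in>F \<union> F'. (if \<kappa> \<in> F then c \<kappa> else 0) * expo \<kappa> x)"
        unfolding F(3) by (rule widen) simp
      moreover have "h' x = (\<Sum>\<kappa>\<in>F \<union> F'. (if \<kappa> \<in> F' then c' \<kappa> else 0) * expo \<kappa> x)"
        unfolding F(6) by (rule widen) simp
      ultimately show ?thesis by (simp only: k_def distrib_right sum.distrib)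
    qed
    then show "(\<lambda>x. h x + h' x) \<in> A"
      unfolding A_def using F(1,2,4,5) by (intro CollectI exI[of _ "F \<union> F'"] exI[of _ k]) auto
  next
    fix h :: "real^'n \<Rightarrow> complex" and k assume "h \<in> A"
    then obtain F c where F: "finite F" "F \<subseteq> \<Lambda>" "h = (\<lambda>x. \<Sum>\<kappa>\<in>F. c \<kappa> * expo \<kappa> x)" unfolding A_def by blast
    have "(\<lambda>x. k * h x) = (\<lambda>x. \<Sum>\<kappa>\<in>F. (k * c \<kappa>) * expo \<kappa> x)"
      unfolding F(3) by (simp add: sum_distrib_left mult.assoc)
    then show "(\<lambda>x. k * h x) \<in> A" unfolding A_def using F(1,2)
      by (intro CollectI exI[of _ F] exI[of _ "\<lambda>\<kappa>. k * c \<kappa>"]) auto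
  qed
  have "approximable (expo \<xi>)" for \<xi>
    unfolding approximable_def
  proof (intro conjI allI impI sq)
    fix \<epsilon> :: real assume \<epsilon>: "\<epsilon> > 0"
    obtain n where n: "1 - \<epsilon> / 2 \<le> (\<Sum>g\<in>\<Gamma> n. (cmod (fourier \<mu> (\<xi> - of_int g *\<^sub>R e)))\<^sup>2)"
      using parseval_on_line[of "\<epsilon> / 2" \<xi>] \<epsilon> by auto
    define I where "I = (\<lambda>g. real_of_int g *\<^sub>R e) ` \<Gamma> n"
    have I: "finite I" "I \<subseteq> \<Lambda>" by (auto simp: I_def \<Lambda>_def)
    have "(LINT x|\<mu>. (cmod (expo \<xi> x - (\<Sum>\<kappa>\<in>I. fourier \<mu> (\<xi> - \<kappa>) * expo \<kappa> x)))\<^sup>2) =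
       1 - (\<Sum>\<kappa>\<in>I. (cmod (fourier \<mu> (\<xi> - \<kappa>)))\<^sup>2)"
      using expo_distance[OF prob sets I(1), of \<xi> "\<lambda>\<kappa>. fourier \<mu> (\<xi> - \<kappa>)"] ortho I(2) by (simp add: subset_iff)
    also have "\<dots> < \<epsilon>" using n \<epsilon> by (simp add: I_def sum.reindex[OF \<Gamma>_line_inj])
    finally show "\<exists>h\<in>A. (LINT x|\<mu>. (cmod (expo \<xi> x - h x))\<^sup>2) < \<epsilon>"
      using I by (intro bexI[of _ "\<lambda>x. \<Sum>\<kappa>\<in>I. fourier \<mu> (\<xi> - \<kappa>) * expo \<kappa> x"]) (auto simp: A_def)
  qed
  then have dense: "approximable f" if "square_integrable \<mu> f" for f
    using all_approximable that by blast
  show ?thesis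
    unfolding is_spectrum_def L2_orthonormal_basis_def \<Lambda>_def[symmetric]
  proof (intro conjI ballI allI impI)
    show "countable \<Lambda>" unfolding \<Lambda>_def by (intro countable_image countable_UN) (auto intro: countable_finite)
    show "square_integrable \<mu> (expo x)" for x by (rule sq)
    show "(LINT z|\<mu>. expo x z * cnj (expo y z)) = (if x = y then 1 else 0)" if "x \<in> \<Lambda>" "y \<in> \<Lambda>" for x y
      using ortho[OF that] fourier_0[OF prob] by (simp add: integral_expo_mult_cnj)
    show "\<exists>F c. finite F \<and> F \<subseteq> \<Lambda> \<and> (LINT x|\<mu>. (cmod (f x - (\<Sum>i\<in>F. c i * expo i x)))\<^sup>2) < \<epsilon>"
      if f: "square_integrable \<mu> f" "0 < \<epsilon>" for f \<epsilon>
    proof -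
      obtain h where h: "h \<in> A" "(LINT x|\<mu>. (cmod (f x - h x))\<^sup>2) < \<epsilon>"
        using dense[OF f(1)] f(2) unfolding approximable_def by blast
      then obtain F c where "finite F" "F \<subseteq> \<Lambda>" "h = (\<lambda>x. \<Sum>\<kappa>\<in>F. c \<kappa> * expo \<kappa> x)"
        unfolding A_def by blast
      then show ?thesis using h(2) by (intro exI[of _ F] exI[of _ c]) simp
    qed
  qed
qed

end

section \<open>Planar triangular systems\<close>

lemma matrix_inv_unique:
  fixes A B :: "real^'n^'n"
  assumes "A ** B = mat 1" "B ** A = mat 1"
  shows "matrix_inv A = B"
proof -
  have "\<exists>A'. A ** A' = mat 1 \<and> A' ** A = mat 1" using assms by blast
  then have inv: "A ** matrix_inv A = mat 1 \<and> matrix_inv A ** A = mat 1"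
    unfolding matrix_inv_def by (rule someI_ex)
  then have "matrix_inv A = (B ** A) ** matrix_inv A" using assms by simp
  also have "\<dots> = B" using inv by (simp flip: matrix_mul_assoc)
  finally show ?thesis .
qed

lemma matrix_inv_upper_triangular:
  fixes \<alpha> \<beta> \<gamma> :: real
  assumes "\<alpha> \<noteq> 0" "\<beta> \<noteq> 0"
  shows "matrix_inv (vector [vector [inverse \<alpha>, \<gamma>], vector [0, inverse \<beta>]] :: real^2^2) =
    vector [vector [\<alpha>, - \<gamma> * \<alpha> * \<beta>], vector [0, \<beta>]]"
proof (rule matrix_inv_unique)
  show "(vector [vector [inverse \<alpha>, \<gamma>], vector [0, inverse \<beta>]] :: real^2^2) ** vector [vector [\<alpha>, - \<gamma> * \<alpha> * \<beta>], vector [0, \<beta>]] = mat 1"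
    unfolding vec_eq_iff forall_2 matrix_matrix_mult_def mat_def using assms by (simp add: sum_2)
  show "vector [vector [\<alpha>, - \<gamma> * \<alpha> * \<beta>], vector [0, \<beta>]] ** (vector [vector [inverse \<alpha>, \<gamma>], vector [0, inverse \<beta>]] :: real^2^2) = mat 1"
    unfolding vec_eq_iff forall_2 matrix_matrix_mult_def mat_def using assms by (simp add: sum_2)
qed

text \<open>
  In the coordinates \<open>\<xi>$1\<close> and \<open>\<xi>$2 - c'' \<xi>$1\<close> the transposed inverse of the matrix is diagonal, which is
  what the equation for \<open>c''\<close> expresses.
\<close>

locale planar_system =
  fixes p :: nat and \<rho>1 \<rho>2 c c'' d11 :: real and D :: "(real^2) set" and a :: "real^2" and \<mu> :: "(real^2) measure"
  assumes prime_p: "prime p"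
    and contraction: "0 < \<rho>1" "\<rho>1 < 1" "0 < \<rho>2" "\<rho>2 < 1"
    and c'': "c'' * (\<rho>2 - \<rho>1) = c * \<rho>1 * \<rho>2"
    and finite_D: "finite D" and card_D: "card D = p" and D_int: "D \<subseteq> int_lattice"
    and zero_in_D: "0 \<in> D" and d1_in_D: "vector [d11, 0] \<in> D" and d11: "d11 \<noteq> 0"
    and a: "a \<in> digit_vectors p"
    and zeros: "zero_set (fourier (delta_set D)) =
           (\<Union>j\<in>{1..p - 1}. {(real j / real p) *\<^sub>R a + z | z. z \<in> int_lattice})"
    and sa: "self_affine_measure (vector [vector [inverse \<rho>1, c], vector [0, inverse \<rho>2]]) D \<mu>"
begin

abbreviation M :: "real^2^2" where
  "M \<equiv> vector [vector [inverse \<rho>1, c], vector [0, inverse \<rho>2]]"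

definition N :: "real^2 \<Rightarrow> real^2" where
  "N \<xi> = \<xi> v* matrix_inv M"

lemma matrix_inv_M: "matrix_inv M = vector [vector [\<rho>1, - c * \<rho>1 * \<rho>2], vector [0, \<rho>2]]"
  by (rule matrix_inv_upper_triangular) (use contraction in auto)

lemma N_components: "N \<xi> $ 1 = \<rho>1 * \<xi> $ 1" "N \<xi> $ 2 - c'' * N \<xi> $ 1 = \<rho>2 * (\<xi> $ 2 - c'' * \<xi> $ 1)"
proof -
  show 1: "N \<xi> $ 1 = \<rho>1 * \<xi> $ 1"
    by (simp add: N_def matrix_inv_M vector_matrix_mult_def sum_2)
  have 2: "N \<xi> $ 2 = - (c * \<rho>1 * \<rho>2) * \<xi> $ 1 + \<rho>2 * \<xi> $ 2"
    by (simp add: N_def matrix_inv_M vector_matrix_mult_def sum_2)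
  show "N \<xi> $ 2 - c'' * N \<xi> $ 1 = \<rho>2 * (\<xi> $ 2 - c'' * \<xi> $ 1)"
    unfolding 1 2 c''[symmetric] by (simp add: algebra_simps)
qed

lemma funpow_N_components:
  "(N ^^ n) \<xi> $ 1 = \<rho>1 ^ n * \<xi> $ 1" "(N ^^ n) \<xi> $ 2 - c'' * (N ^^ n) \<xi> $ 1 = \<rho>2 ^ n * (\<xi> $ 2 - c'' * \<xi> $ 1)"
proof (induction n)
  case (Suc n)
  have eq: "(N ^^ Suc n) \<xi> = N ((N ^^ n) \<xi>)" by simp
  show "(N ^^ Suc n) \<xi> $ 1 = \<rho>1 ^ Suc n * \<xi> $ 1"
    unfolding eq N_components(1) Suc(1) by simp
  show "(N ^^ Suc n) \<xi> $ 2 - c'' * (N ^^ Suc n) \<xi> $ 1 = \<rho>2 ^ Suc n * (\<xi> $ 2 - c'' * \<xi> $ 1)"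
    unfolding eq N_components(2) Suc(2) by simp
qed simp_all

lemma N_tendsto: "(\<lambda>n. (N ^^ n) \<xi>) \<longlonglongrightarrow> 0"
proof (rule vec_tendstoI)
  fix i :: 2
  have l1: "(\<lambda>n. (N ^^ n) \<xi> $ 1) \<longlonglongrightarrow> 0 * \<xi> $ 1"
    unfolding funpow_N_components by (intro tendsto_intros LIMSEQ_power_zero) (use contraction in auto)
  have "(\<lambda>n. \<rho>2 ^ n * (\<xi> $ 2 - c'' * \<xi> $ 1) + c'' * (N ^^ n) \<xi> $ 1) \<longlonglongrightarrow> 0 * (\<xi> $ 2 - c'' * \<xi> $ 1) + c'' * (0 * \<xi> $ 1)"
    by (intro tendsto_intros l1 LIMSEQ_power_zero) (use contraction in auto)
  then have l2: "(\<lambda>n. (N ^^ n) \<xi> $ 2) \<longlonglongrightarrow> 0"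
    by (simp add: funpow_N_components(2)[symmetric])
  show "(\<lambda>n. (N ^^ n) \<xi> $ i) \<longlonglongrightarrow> (0 :: real^2) $ i"
    using l1 l2 exhaust_2[of i] by auto
qed

lemma D_ne: "D \<noteq> {}" using zero_in_D by auto

lemma mask_zero_iff: "digit_mask D \<xi> = 0 \<longleftrightarrow> (\<exists>j\<in>{1..p - 1}. \<exists>z\<in>int_lattice. \<xi> = (real j / real p) *\<^sub>R a + z)"
proof -
  have "digit_mask D \<xi> = 0 \<longleftrightarrow> \<xi> \<in> zero_set (fourier (delta_set D))"
    by (simp add: zero_set_def fourier_delta_set[OF finite_D D_ne])
  then show ?thesis unfolding zeros by blast
qed

lemma p_ge_2: "2 \<le> p" using prime_p by (rule prime_ge_2_nat)

lemma a_components: "\<exists>i1 i2. a = vector [real i1, real i2] \<and> \<not> p dvd i1 \<and> \<not> p dvd i2"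
proof -
  obtain i1 i2 where i: "a = vector [real i1, real i2]" "i1 \<in> {1..p - 1}" "i2 \<in> {1..p - 1}"
    using a by (auto simp: digit_vectors_def)
  have "\<not> p dvd k" if "k \<in> {1..p - 1}" for k using that by (auto dest: dvd_imp_le)
  then show ?thesis using i by blast
qed

lemma d11_ge_1: "1 \<le> \<bar>d11\<bar>"
proof -
  have "d11 \<in> \<int>" using d1_in_D D_int by (auto simp: int_lattice_def forall_2)
  then show ?thesis using d11 by (auto elim!: Ints_cases)
qed

sublocale mask_system p \<rho>1 d11 D \<mu> N "\<lambda>\<xi>. \<xi> $ 1" "vector [1, 0]"
proof (rule mask_system.intro)
  show "prime p" "0 < \<rho>1" "\<rho>1 < 1" "finite D" "D \<noteq> {}" using prime_p contraction finite_D D_ne by auto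
  show "sets \<mu> = sets borel" using sa by (simp add: self_affine_measure_def borel_prob_def)
  show "N (x - y) = N x - N y" for x y 
    by (simp add: N_def vec_eq_iff vector_matrix_mult_def sum_subtractf left_diff_distrib)
  show "(\<lambda>n. (N ^^ n) x) \<longlonglongrightarrow> 0" for x by (rule N_tendsto)
  show "N x $ 1 = \<rho>1 * x $ 1" for x by (rule N_components)
  show "fourier \<mu> \<xi> = digit_mask D (N \<xi>) * fourier \<mu> (N \<xi>)" for \<xi>
    unfolding N_def by (rule self_affine_fourier[OF sa finite_D D_ne])
  show "1 \<le> \<bar>d11\<bar>" by (rule d11_ge_1)
  show "cmod (digit_mask D \<xi>) \<le> cos_bound p (d11 * \<xi> $ 1)" for \<xi>
  proof -
    have ne: "vector [d11, 0] \<noteq> (0 :: real^2)" using d11 by (auto simp: vec_eq_iff forall_2)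
    have "\<xi> \<bullet> (vector [d11, 0] - 0) = d11 * \<xi> $ 1" by (simp add: inner_vec_def sum_2 mult.commute)
    then show ?thesis
      using norm_digit_mask_le_cos_bound[OF finite_D d1_in_D zero_in_D ne, of \<xi>]
      by (simp add: cos_bound_def card_D)
  qed
  show "\<exists>w. \<not> int p dvd w \<and> real p * \<xi> $ 1 = real_of_int w" if zero: "digit_mask D \<xi> = 0" for \<xi>
  proof -
    obtain i1 i2 where i: "a = vector [real i1, real i2]" "\<not> p dvd i1" using a_components by blast
    obtain j z where jz: "j \<in> {1..p - 1}" "z \<in> int_lattice" "\<xi> = (real j / real p) *\<^sub>R a + z"
      using zero unfolding mask_zero_iff by blast
    obtain m where m: "z $ 1 = of_int m" using jz(2) by (auto simp: int_lattice_def elim: Ints_cases)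
    have "\<not> p dvd j" using jz(1) by (auto dest: dvd_imp_le)
    then have "\<not> p dvd j * i1" using i(2) prime_p by (simp add: prime_dvd_mult_iff)
    then have "\<not> int p dvd int (j * i1) + int p * m" by (metis dvd_add_left_iff dvd_triv_left int_dvd_int_iff)
    moreover have "real p * \<xi> $ 1 = of_int (int (j * i1) + int p * m)"
      using p_ge_2 by (simp add: jz(3) i(1) m field_simps)
    ultimately show ?thesis by blast
  qed
  show "(\<tau> *\<^sub>R vector [1, 0] :: real^2) $ 1 = \<tau>" for \<tau> by simp
  show "prob_space \<mu>" using sa by (simp add: self_affine_measure_def borel_prob_def)
  show "(x - y) $ 1 = x $ 1 - y $ 1" for x y :: "real^2" by simp
qed

text \<open>
  The functionals \<open>x$1 + c'' x$2\<close> and \<open>x$2\<close> are the left eigenvectors of the inverse matrix, so each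
  is contracted by the maps and is bounded on a set of full measure.
\<close>

lemma compact_support: "\<exists>K. compact K \<and> emeasure \<mu> (- K) = 0"
proof -
  interpret prob_space \<mu> by (rule prob)
  have contr: "affine_contr M d x = vector [\<rho>1 * (x $ 1 + d $ 1) - c * \<rho>1 * \<rho>2 * (x $ 2 + d $ 2), \<rho>2 * (x $ 2 + d $ 2)]" for d x
    by (simp add: affine_contr_def matrix_inv_M vec_eq_iff forall_2 matrix_vector_mult_def sum_2)
  define L1 where "L1 x = x $ 1 + c'' * x $ 2" for x :: "real^2"
  define L2 where "L2 x = x $ 2" for x :: "real^2"
  have cont: "continuous_on UNIV L1" "continuous_on UNIV L2"
    unfolding L1_def L2_def by (intro continuous_intros)+
  have meas[measurable]: "L1 \<in> borel_measurable borel" "L2 \<in> borel_measurable borel"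
    using cont by (auto intro: borel_measurable_continuous_onI)
  have "L1 (affine_contr M d x) = \<rho>1 * (L1 x + L1 d)" for d x
    unfolding contr L1_def c''[symmetric] by (simp add: algebra_simps)
  then obtain R1 where R1: "measure \<mu> {x. R1 < \<bar>L1 x\<bar>} = 0"
    using self_affine_functional_bounded[OF sa finite_D D_ne meas(1) contraction(1,2)] by blast
  have "L2 (affine_contr M d x) = \<rho>2 * (L2 x + L2 d)" for d x
    unfolding contr L2_def by simp
  then obtain R2 where R2: "measure \<mu> {x. R2 < \<bar>L2 x\<bar>} = 0"
    using self_affine_functional_bounded[OF sa finite_D D_ne meas(2) contraction(3,4)] by blast
  define K where "K = {x. \<bar>L1 x\<bar> \<le> R1} \<inter> {x. \<bar>L2 x\<bar> \<le> R2}"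
  have "closed K"
    unfolding K_def by (intro closed_Int closed_Collect_le continuous_intros cont)
  moreover have "bounded K"
  proof (rule boundedI)
    fix x assume "x \<in> K"
    then have x: "\<bar>x $ 1 + c'' * x $ 2\<bar> \<le> R1" "\<bar>x $ 2\<bar> \<le> R2" by (auto simp: K_def L1_def L2_def)
    have "\<bar>c'' * x $ 2\<bar> \<le> \<bar>c''\<bar> * R2" unfolding abs_mult using x(2) by (intro mult_left_mono) auto
    then have "\<bar>x $ 1\<bar> \<le> R1 + \<bar>c''\<bar> * R2" using x(1) by linarith
    moreover have "norm x \<le> \<bar>x $ 1\<bar> + \<bar>x $ 2\<bar>" using norm_le_l1_cart[of x] by (simp add: sum_2)
    ultimately show "norm x \<le> R1 + \<bar>c''\<bar> * R2 + R2" using x(2) by linarith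
  qed
  ultimately have "compact K" by (simp add: compact_eq_bounded_closed)
  moreover have "emeasure \<mu> (- K) = 0"
  proof -
    have m: "{x. R1 < \<bar>L1 x\<bar>} \<in> sets \<mu>" "{x. R2 < \<bar>L2 x\<bar>} \<in> sets \<mu>"
      unfolding sets by measurable
    have "- K = {x. R1 < \<bar>L1 x\<bar>} \<union> {x. R2 < \<bar>L2 x\<bar>}" by (auto simp: K_def not_le)
    then have "measure \<mu> (- K) \<le> measure \<mu> {x. R1 < \<bar>L1 x\<bar>} + measure \<mu> {x. R2 < \<bar>L2 x\<bar>}"
      using measure_Un_le[OF m] by simp
    then have "measure \<mu> (- K) = 0" using R1 R2 by (simp add: measure_le_0_iff)
    then show ?thesis by (simp add: emeasure_eq_measure)
  qed
  ultimately show ?thesis by blast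
qed

text \<open>
  The vector \<open>e = (l, h)\<close> satisfies \<open>e$2 = c'' e$1\<close>, hence is an eigenvector of \<open>N\<close>. If
  \<open>x e = j a / p\<close> up to the lattice, Bezout's identity for \<open>h\<close> and \<open>l\<close> shows that \<open>p x\<close> is an integer.
  Conversely, \<open>j\<close> is found by solving \<open>j a1 = l w\<close> modulo \<open>p\<close> in the first coordinate, and
  the congruence \<open>l a2 = h a1\<close> modulo \<open>p\<close> makes the same \<open>j\<close> work in the second.
\<close>

lemma spectrum_if_ratio_multiple:
  fixes h l b :: int
  assumes hl: "l > 0" "coprime h l" "c'' = of_int h / of_int l"
    and cong: "\<exists>w. of_int l * a $ 2 - of_int h * a $ 1 = real p * of_int w"
    and ratio: "inverse \<rho>1 = real p * of_int b"
  shows "\<exists>\<Lambda>. is_spectrum \<mu> \<Lambda>"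
proof -
  define e :: "real^2" where "e = vector [of_int l, of_int h]"
  obtain K where K: "compact K" "emeasure \<mu> (- K) = 0" using compact_support by blast
  have p0: "p > 0" using p_ge_2 by simp
  have prime_int: "prime (int p)" using prime_p by simp
  obtain i1 i2 where i: "a = vector [real i1, real i2]" "\<not> p dvd i1" "\<not> p dvd i2" using a_components by blast
  obtain w0 where w0: "l * int i2 - h * int i1 = int p * w0"
  proof -
    obtain w where "of_int l * a $ 2 - of_int h * a $ 1 = real p * of_int w" using cong by blast
    then have "real_of_int (l * int i2 - h * int i1) = of_int (int p * w)" by (simp add: i(1))
    then have "l * int i2 - h * int i1 = int p * w" by (simp only: of_int_eq_iff)
    then show ?thesis by (rule that)
  qed
  have bpos: "1 \<le> b"
  proof -
    have "0 < real p * of_int b" using ratio contraction by (metis inverse_positive_iff_positive)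
    then show ?thesis using p0 by (simp add: zero_less_mult_iff)
  qed
  have not_dvd_l: "\<not> int p dvd l"
  proof
    assume pl: "int p dvd l"
    have "h * int i1 = l * int i2 - int p * w0" using w0 by linarith
    moreover have "int p dvd l * int i2 - int p * w0" using pl by (intro dvd_diff dvd_mult2) auto
    ultimately have "int p dvd h * int i1" by simp
    then have "int p dvd h" using i(2) prime_int by (simp add: prime_dvd_mult_iff)
    then have "int p dvd 1" using pl hl(2) by (metis coprime_def dvd_trans is_unit_gcd gcd_greatest coprime_iff_gcd_eq_1)
    then show False using p_ge_2 by simp
  qed
  have N_e: "N (x *\<^sub>R e) = (\<rho>1 * x) *\<^sub>R e" for x
  proof -
    have he: "e $ 2 = c'' * e $ 1" using hl by (simp add: e_def)
    have 1: "N (x *\<^sub>R e) $ 1 = \<rho>1 * x * e $ 1" by (simp add: N_components)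
    have "N (x *\<^sub>R e) $ 2 = c'' * N (x *\<^sub>R e) $ 1 + \<rho>2 * ((x *\<^sub>R e) $ 2 - c'' * (x *\<^sub>R e) $ 1)"
      using N_components(2)[of "x *\<^sub>R e"] by linarith
    also have "\<dots> = \<rho>1 * x * e $ 2" unfolding 1 by (simp add: he)
    finally show ?thesis using 1 by (simp add: vec_eq_iff forall_2)
  qed
  have e_digit: "e \<bullet> d = of_int \<lfloor>e \<bullet> d\<rfloor>" if "d \<in> D" for d
  proof -
    have "d $ 1 \<in> \<int>" "d $ 2 \<in> \<int>" using that D_int by (auto simp: int_lattice_def)
    then have "e \<bullet> d \<in> \<int>" by (simp add: e_def inner_vec_def sum_2)
    then show ?thesis by simp
  qed
  have e_mask: "digit_mask D (x *\<^sub>R e) = 0 \<longleftrightarrow> (\<exists>w. \<not> int p dvd w \<and> real p * x = of_int w)" for x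
  proof
    assume "digit_mask D (x *\<^sub>R e) = 0"
    then obtain j z where jz: "j \<in> {1..p - 1}" "z \<in> int_lattice" "x *\<^sub>R e = (real j / real p) *\<^sub>R a + z"
      unfolding mask_zero_iff by blast
    obtain m n where mn: "z $ 1 = of_int m" "z $ 2 = of_int n"
      using jz(2) by (auto simp: int_lattice_def elim!: Ints_cases) (metis Ints_cases)
    have e1: "real p * x * of_int l = of_int (int j * int i1 + int p * m)"
      using arg_cong[OF jz(3), of "\<lambda>v. real p * v $ 1"] p0 by (simp add: e_def i(1) mn distrib_left)
    have e2: "real p * x * of_int h = of_int (int j * int i2 + int p * n)"
      using arg_cong[OF jz(3), of "\<lambda>v. real p * v $ 2"] p0 by (simp add: e_def i(1) mn distrib_left)
    obtain s t where st: "s * h + t * l = 1" using bezout_int[of h l] hl(2) by (auto simp: coprime_iff_gcd_eq_1)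
    define w where "w = s * (int j * int i2 + int p * n) + t * (int j * int i1 + int p * m)"
    have "real p * x = real p * x * of_int (s * h + t * l)" using st by simp
    also have "\<dots> = of_int s * (real p * x * of_int h) + of_int t * (real p * x * of_int l)"
      by (simp add: algebra_simps)
    also have "\<dots> = of_int w" unfolding e1 e2 w_def by simp
    finally have xw: "real p * x = of_int w" .
    have "real_of_int (w * l) = of_int (int j * int i1 + int p * m)" using e1 xw by simp
    then have wl: "w * l = int j * int i1 + int p * m" by linarith
    have "\<not> p dvd j" using jz(1) by (auto dest: dvd_imp_le)
    then have "\<not> int p dvd int j * int i1" using i(2) prime_int by (simp add: prime_dvd_mult_iff)
    then have "\<not> int p dvd w * l" unfolding wl by (metis dvd_add_left_iff dvd_triv_left)
    then show "\<exists>w. \<not> int p dvd w \<and> real p * x = of_int w" using xw by (metis dvd_mult2)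
  next
    assume "\<exists>w. \<not> int p dvd w \<and> real p * x = of_int w"
    then obtain w where w: "\<not> int p dvd w" "real p * x = of_int w" by blast
    have "coprime (int i1) (int p)" using i(2) prime_int by (metis coprime_commute int_dvd_int_iff prime_imp_coprime)
    then obtain s t where st: "s * int i1 + t * int p = 1" using bezout_int[of "int i1" "int p"] by (auto simp: coprime_iff_gcd_eq_1)
    \<comment> \<open>\<open>s\<close> is the inverse of \<open>i1\<close> modulo \<open>p\<close>, so \<open>j\<close> solves \<open>j i1 = l w\<close> modulo \<open>p\<close>.\<close>
    define j where "j = nat ((s * l * w) mod int p)"
    have j: "int j = (s * l * w) mod int p" using p0 by (simp add: j_def)
    define k where "k = (s * l * w) div int p"
    have jk: "int j = s * l * w - int p * k" by (simp add: j k_def minus_mult_div_eq_mod)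
    have "int j * int i1 = l * w * (s * int i1) - int p * k * int i1" by (simp add: jk algebra_simps)
    also have "s * int i1 = 1 - t * int p" using st by linarith
    finally have lw: "l * w = int j * int i1 + int p * (l * w * t + k * int i1)" by (simp add: algebra_simps)
    define m where "m = l * w * t + k * int i1"
    have "int i1 * (h * w - int j * int i2) = int p * (m * int i2 - w0 * w)"
    proof -
      have "int i1 * (h * w - int j * int i2) = (h * int i1) * w - (int j * int i1) * int i2" by (simp add: algebra_simps)
      also have "h * int i1 = l * int i2 - int p * w0" using w0 by linarith
      also have "int j * int i1 = l * w - int p * m" using lw by (simp add: m_def)
      finally show ?thesis by (simp add: algebra_simps)
    qed
    then have "int p dvd int i1 * (h * w - int j * int i2)" by simp
    then have "int p dvd h * w - int j * int i2" using i(2) prime_int by (simp add: prime_dvd_mult_iff)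
    then obtain n where n: "h * w = int j * int i2 + int p * n" by (metis diff_add_cancel add.commute dvdE)
    have "j < p" using p0 by (simp add: j_def nat_less_iff)
    moreover have "j \<noteq> 0"
    proof
      assume "j = 0"
      then have "l * w = int p * m" using lw by (simp add: m_def)
      then have "int p dvd l * w" by simp
      then show False using not_dvd_l w(1) prime_int by (simp add: prime_dvd_mult_iff)
    qed
    ultimately have "j \<in> {1..p - 1}" by auto
    moreover have "vector [of_int m, of_int n] \<in> (int_lattice :: (real^2) set)"
      by (simp add: int_lattice_def forall_2)
    moreover have "x *\<^sub>R e = (real j / real p) *\<^sub>R a + vector [of_int m, of_int n]"
    proof -
      have x: "x = of_int w / real p" using w(2) p0 by (simp add: field_simps)
      have "real_of_int (l * w) = of_int (int j * int i1 + int p * m)" using lw by (simp add: m_def)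
      moreover have "real_of_int (h * w) = of_int (int j * int i2 + int p * n)" using n by simp
      ultimately show ?thesis
        using p0 by (simp add: vec_eq_iff forall_2 e_def i(1) x field_simps)
    qed
    ultimately show "digit_mask D (x *\<^sub>R e) = 0" unfolding mask_zero_iff by blast
  qed
  interpret line_spectrum p \<rho>1 d11 D \<mu> N "\<lambda>\<xi>. \<xi> $ 1" "vector [1, 0]" b e "\<lambda>d. \<lfloor>e \<bullet> d\<rfloor>"
  proof
    show "1 / \<rho>1 = of_int (int p * b)" using ratio by (simp add: inverse_eq_divide)
  qed (fact bpos card_D N_e e_digit e_mask)+
  show ?thesis using line_is_spectrum[OF K] by blast
qed

end

theorem theorem1p5:
  fixes p :: nat and \<rho>1 \<rho>2 c c'' d11 :: real and M :: "real^2^2"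
    and d :: "nat \<Rightarrow> real^2" and D :: "(real^2) set" and a :: "real^2"
    and \<mu> :: "(real^2) measure"
  assumes "prime p"
    and "0 < \<rho>1" "\<rho>1 < 1" "0 < \<rho>2" "\<rho>2 < 1" "\<rho>1 \<noteq> \<rho>2"
    and "M = vector [vector [inverse \<rho>1, c], vector [0, inverse \<rho>2]]"
    and "D = d ` {0..p - 1}" "inj_on d {0..p - 1}" "D \<subseteq> int_lattice"
    and "d 0 = vector [0, 0]" "d 1 = vector [d11, 0]" "d11 \<noteq> 0"
    and "a \<in> digit_vectors p"
    and "zero_set (fourier (delta_set D)) =
           (\<Union>j\<in>{1..p - 1}. {(real j / real p) *\<^sub>R a + z | z. z \<in> int_lattice})"
    and "self_affine_measure M D \<mu>"
    and "c'' = c / (inverse \<rho>1 - inverse \<rho>2)"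
    and "c'' \<in> \<rat> - excl_set p a"
  shows "spectral_measure \<mu> \<longleftrightarrow> inverse \<rho>1 \<in> int_multiples p"
proof -
  have p2: "2 \<le> p" using assms(1) by (rule prime_ge_2_nat)
  interpret planar_system p \<rho>1 \<rho>2 c c'' d11 D a \<mu>
  proof
    have "inverse \<rho>1 - inverse \<rho>2 = (\<rho>2 - \<rho>1) / (\<rho>1 * \<rho>2)"
      using assms(2,4) by (simp add: field_simps)
    then show "c'' * (\<rho>2 - \<rho>1) = c * \<rho>1 * \<rho>2" using assms(2,4,6,17) by simp
    show "card D = p" using assms(8,9) p2 by (simp add: card_image)
    have "d 0 = 0" using assms(11) by (simp add: vec_eq_iff forall_2)
    then show "0 \<in> D" using assms(8) by (metis atLeastAtMost_iff imageI le0)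
    have "d 1 \<in> D" unfolding assms(8) using p2 by (intro imageI) simp
    then show "vector [d11, 0] \<in> D" using assms(12) by simp
    show "self_affine_measure (vector [vector [inverse \<rho>1, c], vector [0, inverse \<rho>2]]) D \<mu>"
      using assms(7,16) by simp
    show "finite D" by (simp add: assms(8))
  qed (fact assms)+
  show ?thesis
  proof
    assume "spectral_measure \<mu>"
    then obtain \<Lambda> where "is_spectrum \<mu> \<Lambda>" by (auto simp: spectral_measure_def)
    then show "inverse \<rho>1 \<in> int_multiples p"
      using ratio_multiple_of_p_if_spectrum by (simp add: inverse_eq_divide)
  next
    assume "inverse \<rho>1 \<in> int_multiples p"
    then obtain b :: int where b: "inverse \<rho>1 = real p * of_int b"
      by (auto simp: int_multiples_def elim: Ints_cases)
    have "c'' \<in> \<rat>" using assms(18) by simp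
    then obtain h l :: int where hl: "l > 0" "coprime h l" "c'' = of_int h / of_int l" by (metis Rats_cases')
    obtain i1 i2 where i: "a = vector [real i1, real i2]" using a_components by blast
    have int: "of_int l * a $ 2 - of_int h * a $ 1 \<in> \<int>" by (simp add: i)
    have "of_int l * a $ 2 - of_int h * a $ 1 \<in> int_multiples p"
    proof (rule ccontr)
      assume "\<not> ?thesis"
      then have "of_int l * a $ 2 - of_int h * a $ 1 \<in> \<int> - int_multiples p" using int by blast
      moreover have "l \<noteq> 0" "gcd h l = 1" using hl(1,2) by (simp_all add: coprime_iff_gcd_eq_1)
      ultimately have "c'' \<in> excl_set p a" using hl(3) unfolding excl_set_def
        by (intro UnI1 CollectI exI[of _ h] exI[of _ l] conjI)
      then show False using assms(18) by simp
    qed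
    then have "\<exists>w. of_int l * a $ 2 - of_int h * a $ 1 = real p * of_int w"
      by (auto simp: int_multiples_def elim!: Ints_cases)
    then have "\<exists>\<Lambda>. is_spectrum \<mu> \<Lambda>" using spectrum_if_ratio_multiple[OF hl _ b] by blast
    moreover have "borel_prob \<mu>" using assms(16) by (simp add: self_affine_measure_def)
    ultimately show "spectral_measure \<mu>"
      using compact_support by (simp add: spectral_measure_def compactly_supported_def)
  qed
qed

end
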